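(* For $1\le p<2$, there exist two positive constants $c$ and $C$, depending only on $p$, such that $$c\,n^{\frac52-\frac1p}\le K_G(S_p^{n,\mathrm{sa}},S_p^{n,\mathrm{sa}})\le C\,n^{\frac52-\frac1p}\qquad\text{for all } n\ge1.$$
   Context: $S_p^{n,\mathrm{sa}}$ is the real Banach space of all self-adjoint complex $n\times n$ matrices with the Schatten $p$-norm $\|A\|=(\mathrm{tr}|A|^p)^{1/p}$. All Banach spaces here are real. For $E$ finite-dimensional and $F$ a Banach space, $$K_G(E,F)=\sup\{\|A\otimes\mathrm{id}_F\|_{E\check\otimes F\to E^*\hat\otimes F}:\ A:E\to E^*\text{ linear},\ \|A\|_{E\to E^*}\le1\},$$ with $\check\otimes$, $\hat\otimes$ the injective and projective tensor products. *)

theory Defs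
  imports "HOL-Analysis.Analysis" "Jordan_Normal_Form.Schur_Decomposition"
begin

section \<open>Real normed spaces on explicit carriers\<close>

text \<open>The dimension of the space of self-adjoint \<open>n \<times> n\<close> matrices varies inside the theorem, so
  normed spaces are records with an explicit carrier rather than types. The record carries no
  axioms, and the definitions below are meant for genuine normed spaces.

  All suprema are over real numbers. For a finite-dimensional normed space \<open>E\<close> and a normed space
  \<open>F\<close>, every set whose supremum is taken in \<open>K_G E F\<close> is nonempty and bounded.\<close>

record 'a rnspace =
  points :: "'a set"
  vadd :: "'a \<Rightarrow> 'a \<Rightarrow> 'a"
  vscale :: "real \<Rightarrow> 'a \<Rightarrow> 'a"
  vnorm :: "'a \<Rightarrow> real"

definition real_line :: "real rnspace" where
  "real_line = \<lparr>points = UNIV, vadd = (+), vscale = (*), vnorm = abs\<rparr>"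

definition linear_maps :: "'a rnspace \<Rightarrow> 'b rnspace \<Rightarrow> ('a \<Rightarrow> 'b) set" where
  "linear_maps E G = {T. (\<forall>x\<in>points E. T x \<in> points G) \<and>
     (\<forall>x\<in>points E. \<forall>y\<in>points E. T (vadd E x y) = vadd G (T x) (T y)) \<and>
     (\<forall>a. \<forall>x\<in>points E. T (vscale E a x) = vscale G a (T x))}"

definition op_norm :: "'a rnspace \<Rightarrow> 'b rnspace \<Rightarrow> ('a \<Rightarrow> 'b) \<Rightarrow> real" where
  "op_norm E G T = Sup {vnorm G (T x) | x. x \<in> points E \<and> vnorm E x \<le> 1}"

text \<open>Functionals are set to zero outside the carrier, so that two of them are equal iff they agree
  on \<open>points E\<close>. No continuity is required: this is the Banach space dual in finite dimension,
  which is the case of \<open>E\<close>. For the second factor of a tensor product see \<open>dual_ball\<close>.\<close>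

definition dual :: "'a rnspace \<Rightarrow> ('a \<Rightarrow> real) rnspace" where
  "dual E = \<lparr>points = {f \<in> linear_maps E real_line. \<forall>x. x \<notin> points E \<longrightarrow> f x = 0},
     vadd = (\<lambda>f g x. f x + g x), vscale = (\<lambda>a f x. a * f x), vnorm = op_norm E real_line\<rparr>"

section \<open>Tensor products\<close>

definition bilinear_forms :: "'a rnspace \<Rightarrow> 'b rnspace \<Rightarrow> ('a \<Rightarrow> 'b \<Rightarrow> real) set" where
  "bilinear_forms E F = {b. (\<forall>x\<in>points E. b x \<in> linear_maps F real_line) \<and>
     (\<forall>y\<in>points F. (\<lambda>x. b x y) \<in> linear_maps E real_line)}"

text \<open>The algebraic tensor product is realised inside the dual of the space of bilinear forms:
  \<open>x \<otimes> y\<close> is the evaluation \<open>b \<mapsto> b x y\<close>, and \<open>tensor_of E F [(x\<^sub>1, y\<^sub>1), \<dots>, (x\<^sub>k, y\<^sub>k)]\<close> is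
  \<open>x\<^sub>1 \<otimes> y\<^sub>1 + \<dots> + x\<^sub>k \<otimes> y\<^sub>k\<close>.\<close>

type_synonym ('a, 'b) tensor = "('a \<Rightarrow> 'b \<Rightarrow> real) \<Rightarrow> real"

definition tensor_of :: "'a rnspace \<Rightarrow> 'b rnspace \<Rightarrow> ('a \<times> 'b) list \<Rightarrow> ('a, 'b) tensor" where
  "tensor_of E F xs =
     (\<lambda>b. if b \<in> bilinear_forms E F then \<Sum>(x, y)\<leftarrow>xs. b x y else 0)"

definition tensors :: "'a rnspace \<Rightarrow> 'b rnspace \<Rightarrow> ('a, 'b) tensor set" where
  "tensors E F = {tensor_of E F xs | xs. set xs \<subseteq> points E \<times> points F}"

text \<open>\<open>u (\<lambda>x y. \<phi> x * \<psi> y)\<close> is the value of \<open>\<phi> \<otimes> \<psi>\<close> on \<open>u\<close>. The functionals are those with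
  \<open>\<bar>\<phi> x\<bar> \<le> \<parallel>x\<parallel>\<close> and \<open>\<bar>\<psi> y\<bar> \<le> \<parallel>y\<parallel>\<close>, that is, the elements of the unit balls of the
  (continuous) duals; this form does not require finite dimension.\<close>

definition dual_ball :: "'a rnspace \<Rightarrow> ('a \<Rightarrow> real) set" where
  "dual_ball E = {f \<in> points (dual E). \<forall>x\<in>points E. \<bar>f x\<bar> \<le> vnorm E x}"

definition injective_norm :: "'a rnspace \<Rightarrow> 'b rnspace \<Rightarrow> ('a, 'b) tensor \<Rightarrow> real" where
  "injective_norm E F u =
     Sup {\<bar>u (\<lambda>x y. \<phi> x * \<psi> y)\<bar> | \<phi> \<psi>. \<phi> \<in> dual_ball E \<and> \<psi> \<in> dual_ball F}"

definition projective_norm :: "'a rnspace \<Rightarrow> 'b rnspace \<Rightarrow> ('a, 'b) tensor \<Rightarrow> real" where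
  "projective_norm E F u =
     Inf {\<Sum>(x, y)\<leftarrow>xs. vnorm E x * vnorm F y | xs.
       set xs \<subseteq> points E \<times> points F \<and> u = tensor_of E F xs}"

text \<open>Both normed tensor products live on the algebraic tensor product. If one factor is
  finite-dimensional and the other is a Banach space, this is already complete.\<close>

definition injective_tensor :: "'a rnspace \<Rightarrow> 'b rnspace \<Rightarrow> ('a, 'b) tensor rnspace" where
  "injective_tensor E F = \<lparr>points = tensors E F, vadd = (\<lambda>u v b. u b + v b),
     vscale = (\<lambda>a u b. a * u b), vnorm = injective_norm E F\<rparr>"

definition projective_tensor :: "'a rnspace \<Rightarrow> 'b rnspace \<Rightarrow> ('a, 'b) tensor rnspace" where
  "projective_tensor E F = \<lparr>points = tensors E F, vadd = (\<lambda>u v b. u b + v b),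
     vscale = (\<lambda>a u b. a * u b), vnorm = projective_norm E F\<rparr>"

text \<open>\<open>A \<otimes> id\<^sub>F\<close> for a linear map \<open>A\<close> from \<open>E\<close> to \<open>G\<close>.\<close>

definition tensor_id ::
  "'c rnspace \<Rightarrow> 'b rnspace \<Rightarrow> ('a \<Rightarrow> 'c) \<Rightarrow> ('a, 'b) tensor \<Rightarrow> ('c, 'b) tensor" where
  "tensor_id G F A u =
     (\<lambda>b. if b \<in> bilinear_forms G F then u (\<lambda>x y. b (A x) y) else 0)"

lemma tensor_id_tensor_of:
  assumes A: "A \<in> linear_maps E G" and xs: "set xs \<subseteq> points E \<times> points F"
  shows "tensor_id G F A (tensor_of E F xs) = tensor_of G F (map (\<lambda>(x, y). (A x, y)) xs)"
proof
  fix b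
  show "tensor_id G F A (tensor_of E F xs) b = tensor_of G F (map (\<lambda>(x, y). (A x, y)) xs) b"
  proof (cases "b \<in> bilinear_forms G F")
    case True
    then have "(\<lambda>x y. b (A x) y) \<in> bilinear_forms E F"
      using A unfolding bilinear_forms_def linear_maps_def by auto
    then show ?thesis
      using True by (simp add: tensor_id_def tensor_of_def comp_def case_prod_unfold)
  next
    case False
    then show ?thesis by (simp add: tensor_id_def tensor_of_def)
  qed
qed

definition K_G :: "'a rnspace \<Rightarrow> 'b rnspace \<Rightarrow> real" where
  "K_G E F =
     Sup {op_norm (injective_tensor E F) (projective_tensor (dual E) F) (tensor_id (dual E) F A) | A.
       A \<in> linear_maps E (dual E) \<and> op_norm E (dual E) A \<le> 1}"

section \<open>Schatten norms\<close>

definition unitary_mats :: "nat \<Rightarrow> complex mat set" where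
  "unitary_mats n =
     {U \<in> carrier_mat n n. U * mat_adjoint U = 1\<^sub>m n \<and> mat_adjoint U * U = 1\<^sub>m n}"

text \<open>Functional calculus for self-adjoint matrices: the value does not depend on the chosen
  diagonalisation, see \<open>mat_fun_eq\<close>.\<close>

definition mat_fun :: "(real \<Rightarrow> real) \<Rightarrow> complex mat \<Rightarrow> complex mat" where
  "mat_fun f A = (THE B. \<exists>U d. U \<in> unitary_mats (dim_row A) \<and>
     A = U * mat_diag (dim_row A) (\<lambda>i. complex_of_real (d i)) * mat_adjoint U \<and>
     B = U * mat_diag (dim_row A) (\<lambda>i. complex_of_real (f (d i))) * mat_adjoint U)"

definition mat_abs :: "complex mat \<Rightarrow> complex mat" where
  "mat_abs A = mat_fun sqrt (mat_adjoint A * A)"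

definition mat_trace :: "complex mat \<Rightarrow> complex" where
  "mat_trace A = (\<Sum>i<dim_row A. A $$ (i, i))"

definition schatten_norm :: "real \<Rightarrow> complex mat \<Rightarrow> real" where
  "schatten_norm p A = Re (mat_trace (mat_fun (\<lambda>t. t powr p) (mat_abs A))) powr (1 / p)"

definition schatten_sa :: "real \<Rightarrow> nat \<Rightarrow> complex mat rnspace" where
  "schatten_sa p n = \<lparr>points = {A \<in> carrier_mat n n. mat_adjoint A = A}, vadd = (+),
     vscale = (\<lambda>a A. complex_of_real a \<cdot>\<^sub>m A), vnorm = schatten_norm p\<rparr>"

lemma mat_adjoint_carrier: "A \<in> carrier_mat m n \<Longrightarrow> mat_adjoint A \<in> carrier_mat n m"
  by (auto simp: mat_adjoint_def mat_of_rows_def)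

lemma mat_fun_eq:
  assumes U: "U \<in> unitary_mats n"
    and A: "A = U * mat_diag n (\<lambda>i. complex_of_real (d i)) * mat_adjoint U"
  shows "mat_fun f A = U * mat_diag n (\<lambda>i. complex_of_real (f (d i))) * mat_adjoint U"
proof -
  note mat_simps = assoc_mult_mat[of _ n n _ n _ n] mult_carrier_mat[of _ n n _ n]
    right_mult_one_mat[of _ n n] left_mult_one_mat[of _ n n]
  let ?D = "\<lambda>d. mat_diag n (\<lambda>i. complex_of_real (d i))"
  have Uc: "U \<in> carrier_mat n n" and Uac: "mat_adjoint U \<in> carrier_mat n n"
    and UU: "mat_adjoint U * U = 1\<^sub>m n" "U * mat_adjoint U = 1\<^sub>m n"
    using U mat_adjoint_carrier by (auto simp: unitary_mats_def)
  have n: "dim_row A = n" using A Uc by simp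
  have "B = U * ?D (\<lambda>i. f (d i)) * mat_adjoint U"
    if V: "V \<in> unitary_mats n" and A': "A = V * ?D e * mat_adjoint V"
      and B: "B = V * ?D (\<lambda>i. f (e i)) * mat_adjoint V" for B V e
  proof -
    have Vc: "V \<in> carrier_mat n n" and Vac: "mat_adjoint V \<in> carrier_mat n n"
      and VV: "mat_adjoint V * V = 1\<^sub>m n" "V * mat_adjoint V = 1\<^sub>m n"
      using V mat_adjoint_carrier by (auto simp: unitary_mats_def)
    define W where "W = mat_adjoint V * U"
    have Wc: "W \<in> carrier_mat n n" using Vac Uc by (simp add: W_def)
    have Dc: "?D g \<in> carrier_mat n n" for g by simp
    have conj1: "mat_adjoint V * (U * ?D g * mat_adjoint U) * U = W * ?D g" for g
    proof -
      have "mat_adjoint V * (U * ?D g * mat_adjoint U) * U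
          = mat_adjoint V * (U * ?D g) * (mat_adjoint U * U)"
        using Uc Vac Uac Dc[of g]
        by (simp add: mat_simps)
      also have "\<dots> = W * ?D g"
        unfolding UU W_def using Uc Vac Dc[of g]
        by (simp add: mat_simps)
      finally show ?thesis .
    qed
    have conj2: "mat_adjoint V * (V * ?D g * mat_adjoint V) * U = ?D g * W" for g
    proof -
      have "mat_adjoint V * (V * ?D g * mat_adjoint V) * U
          = (mat_adjoint V * V) * (?D g * mat_adjoint V) * U"
        using Uc Vc Vac Dc[of g]
        by (simp add: mat_simps)
      also have "\<dots> = ?D g * W"
        unfolding VV W_def using Uc Vac Dc[of g]
        by (metis assoc_mult_mat mult_carrier_mat left_mult_one_mat)
      finally show ?thesis .
    qed
    have eq: "W * ?D d = ?D e * W" using conj1 conj2 A A' by metis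
    have "W $$ (i, j) * d j = e i * W $$ (i, j)" if "i < n" "j < n" for i j
      using arg_cong[OF eq, of "\<lambda>M. M $$ (i, j)"] that
      by (simp add: mat_diag_mult_left[OF Wc] mat_diag_mult_right[OF Wc])
    then have "W $$ (i, j) * f (d j) = f (e i) * W $$ (i, j)" if "i < n" "j < n" for i j
      using that by (cases "W $$ (i, j) = 0") (force simp: mult.commute)+
    then have "W * ?D (\<lambda>i. f (d i)) = ?D (\<lambda>i. f (e i)) * W"
      by (intro eq_matI) (use Wc in \<open>auto simp: mat_diag_mult_left[OF Wc] mat_diag_mult_right[OF Wc]\<close>)
    moreover have "V * (mat_adjoint V * M * U) * mat_adjoint U = M" if M: "M \<in> carrier_mat n n" for M
    proof -
      have "V * (mat_adjoint V * M * U) * mat_adjoint U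
          = (V * mat_adjoint V) * M * (U * mat_adjoint U)"
        using Uc Vc Vac Uac M by (simp add: mat_simps)
      then show ?thesis using M UU VV by simp
    qed
    moreover have "B \<in> carrier_mat n n" "U * ?D (\<lambda>i. f (d i)) * mat_adjoint U \<in> carrier_mat n n"
      using B Vc Vac Uc Uac by auto
    ultimately show ?thesis using conj1 conj2 B by metis
  qed
  then show ?thesis
    unfolding mat_fun_def n using U A by (intro the_equality) blast+
qed

end

theory Submission
  imports Defs
begin

text \<open>
  Let \<open>E\<close> be the space of self-adjoint \<open>n \<times> n\<close> matrices with the Schatten \<open>p\<close>-norm and let \<open>f\<^sub>k\<close> be
  an orthonormal basis of it for the Hilbert-Schmidt inner product \<open>tr (x y)\<close>; there are \<open>n\<^sup>2\<close> of them.
  Both bounds come from random signs, a net argument in dimension of order \<open>n\<close>, and the fact that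
  \<open>vv\<^sup>*\<close> has Schatten norm \<open>1\<close> for every unit vector \<open>v\<close>.

  Upper bound. Let \<open>A : E \<rightarrow> E\<^sup>*\<close> have norm at most 1, let \<open>u\<close> be a tensor of injective norm at most 1,
  and let \<open>g = \<Sum> e\<^sub>k f\<^sub>k\<close> with independent random signs \<open>e\<^sub>k\<close>. Since \<open>x\<close> is the mean of \<open>tr (g x) g\<close>
  (\<open>random_expansion\<close>), \<open>(A \<otimes> id) u\<close> is the mean of \<open>A g \<otimes> u\<^sub>g\<close>, where \<open>u\<^sub>g = (tr (g _) \<otimes> id) u\<close>. The norm
  of \<open>u\<^sub>g\<close> is at most the dual norm of \<open>tr (g _)\<close>, so the projective norm is at most the mean of
  \<open>\<parallel>A g\<parallel> * \<parallel>tr (g _)\<parallel>\<close> with both norms taken in \<open>E\<^sup>*\<close>. By the spectral theorem, the dual norm of a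
  functional is at most \<open>n powr (1 - 1/p)\<close> times its supremum over the matrices \<open>vv\<^sup>*\<close> with unit
  vectors \<open>v\<close> (\<open>functional_le_rank_one\<close>). This supremum is over a sphere in \<open>2n\<close> real dimensions, so
  for a random sign combination whose variance on these matrices and on their polarisations is at
  most \<open>\<sigma>\<^sup>2\<close> it is of order at most \<open>\<sigma> * sqrt n\<close> in mean square (\<open>random_functional_bound\<close>). Here \<open>\<sigma> = 1\<close> for \<open>tr (g _)\<close> and \<open>\<sigma> = n powr (1/p - 1/2)\<close> for \<open>A g\<close>,
  because the identity from the Hilbert-Schmidt norm to the Schatten \<open>p\<close>-norm has that norm. The
  product is \<open>n powr (1/p - 1/2) * n * (n powr (1 - 1/p))\<^sup>2 = n powr (5/2 - 1/p)\<close>.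

  Lower bound. Let \<open>G\<close> be a random \<open>n\<^sup>2 \<times> n\<^sup>2\<close> sign matrix, read as a bilinear form on \<open>E\<close>. Net arguments
  show that some \<open>G\<close> has size at most a multiple of \<open>sqrt n\<close> on all pairs \<open>(vv\<^sup>*, ww\<^sup>*)\<close> with
  unit vectors \<open>v\<close> and \<open>w\<close>, and norm at most a multiple of \<open>n\<close> in the Hilbert-Schmidt norm
  (\<open>random_matrix_form\<close>). Interpolation in the eigenvalues (\<open>matrix_interpolation\<close>, \<open>matrix_form_schatten_le\<close>) gives norm of order at most
  \<open>n powr (3/2 - 1/p)\<close> on \<open>E\<close>, so the corresponding multiple of \<open>G\<close> is a contraction \<open>A : E \<rightarrow> E\<^sup>*\<close>. As a
  tensor, \<open>\<Sum> G\<^sub>k\<^sub>l f\<^sub>k \<otimes> f\<^sub>l\<close> has injective norm of order at most \<open>n powr (2/p)\<close>. Pairing its image under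
  \<open>A \<otimes> id\<close> with the evaluation form \<open>(\<phi>, y) \<mapsto> \<phi> y\<close>, which has norm at most 1, gives
  \<open>\<Sum> (G\<^sub>k\<^sub>l)\<^sup>2 = n\<^sup>4\<close> divided by the two normalisations, which is of order \<open>n powr (5/2 - 1/p)\<close>.
\<close>

section \<open>Maxima of random sign sums\<close>

text \<open>The power series compare term by term, because \<open>2 ^ k * fact k \<le> fact (2 * k)\<close>.\<close>

lemma cosh_le_exp_square: "cosh (x::real) \<le> exp (x\<^sup>2 / 2)"
proof -
  have 1: "(\<lambda>k. x ^ (2 * k) / fact (2 * k)) sums cosh x"
  proof -
    have "(\<lambda>n. if even n then x ^ n / fact n else 0) sums cosh x"
      using cosh_converges[of x] by (simp add: divide_inverse scaleR_conv_of_real mult.commute if_distrib cong: if_cong)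
    then show ?thesis
      by (subst (asm) sums_mono_reindex[of "\<lambda>k. 2 * k", symmetric])
        (auto simp: strict_mono_def elim!: evenE)
  qed
  have 2: "(\<lambda>k. (x\<^sup>2 / 2) ^ k / fact k) sums exp (x\<^sup>2 / 2)"
    using exp_converges[of "x\<^sup>2 / 2"] by (simp only: real_scaleR_def divide_inverse[of _ "fact _"] mult.commute[of "inverse (fact _)"])
  have f: "2 ^ k * fact k \<le> (fact (2 * k) :: real)" for k
  proof (induction k)
    case (Suc k)
    have "(2::real) ^ Suc k * fact (Suc k) = (2 * real k + 2) * (2 ^ k * fact k)"
      by (simp add: algebra_simps)
    also have "\<dots> \<le> (2 * real k + 2) * ((2 * real k + 1) * fact (2 * k))"
    proof (rule mult_left_mono)
      have "fact (2 * k) \<le> (2 * real k + 1) * fact (2 * k)" by (simp add: algebra_simps)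
      then show "2 ^ k * fact k \<le> (2 * real k + 1) * fact (2 * k)" using Suc by linarith
    qed simp
    also have "\<dots> = fact (2 * Suc k)" by (simp add: algebra_simps)
    finally show ?case .
  qed simp
  show ?thesis
  proof (rule sums_le[OF _ 1 2])
    fix k
    have "x ^ (2 * k) / fact (2 * k) \<le> x ^ (2 * k) / (2 ^ k * fact k)"
      using f[of k] by (intro divide_left_mono) auto
    then show "x ^ (2 * k) / fact (2 * k) \<le> (x\<^sup>2 / 2) ^ k / fact k"
      by (simp add: power_mult power_divide)
  qed
qed

definition signs :: "'i set \<Rightarrow> ('i \<Rightarrow> real) set" where
  "signs I = I \<rightarrow>\<^sub>E {-1, 1}"

lemma finite_signs: "finite I \<Longrightarrow> finite (signs I)"
  unfolding signs_def by (rule finite_PiE) auto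

lemma card_signs: "finite I \<Longrightarrow> card (signs I) = 2 ^ card I"
  unfolding signs_def by (simp add: card_PiE numeral_2_eq_2)

abbreviation sumsq :: "'i set \<Rightarrow> ('i \<Rightarrow> real) \<Rightarrow> real" where
  "sumsq I a \<equiv> \<Sum>i\<in>I. (a i)\<^sup>2"

text \<open>The sum over all signs factors over the coordinates, so a random sign sum is subgaussian
  with variance equal to the sum of the squares of its coefficients.\<close>

lemma sum_signs_exp_le:
  assumes "finite I"
  shows "(\<Sum>e\<in>signs I. exp (\<Sum>i\<in>I. a i * e i)) \<le> 2 ^ card I * exp ((sumsq I a) / 2)"
proof -
  have "(\<Sum>e\<in>signs I. exp (\<Sum>i\<in>I. a i * e i)) = (\<Sum>e\<in>signs I. \<Prod>i\<in>I. exp (a i * e i))"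
    by (simp add: exp_sum assms)
  also have "\<dots> = (\<Prod>i\<in>I. \<Sum>y\<in>{-1, 1}. exp (a i * y))"
    unfolding signs_def by (rule prod_sum_PiE[symmetric]) (use assms in auto)
  also have "\<dots> = (\<Prod>i\<in>I. 2 * cosh (a i))"
    by (intro prod.cong refl) (simp add: cosh_def)
  also have "\<dots> \<le> (\<Prod>i\<in>I. 2 * exp ((a i)\<^sup>2 / 2))"
    by (intro prod_mono) (auto simp: cosh_le_exp_square)
  also have "\<dots> = 2 ^ card I * exp ((sumsq I a) / 2)"
    by (simp add: prod.distrib exp_sum[OF assms] sum_divide_distrib)
  finally show ?thesis .
qed

lemma sum_signs_mult:
  assumes "finite I" "k \<in> I" "l \<in> I"
  shows "(\<Sum>e\<in>signs I. e k * e l) = (if k = l then 2 ^ card I else 0)"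
proof -
  have "(\<Sum>e\<in>signs I. e k * e l)
      = (\<Sum>e\<in>signs I. \<Prod>i\<in>I. (if i = k then e i else 1) * (if i = l then e i else 1))"
    using assms by (intro sum.cong refl) (simp add: prod.distrib)
  also have "\<dots> = (\<Prod>i\<in>I. \<Sum>y\<in>{-1, 1}. (if i = k then y else 1) * (if i = l then y else 1))"
    unfolding signs_def
    by (rule prod_sum_PiE[symmetric, where f = "\<lambda>i y. (if i = k then y else 1) * (if i = l then y else 1)"])
      (use assms in auto)
  also have "\<dots> = (if k = l then 2 ^ card I else 0)"
  proof (cases "k = l")
    case True
    then have "(\<Prod>i\<in>I. \<Sum>y\<in>{-1, 1}. (if i = k then y else 1) * (if i = l then y else 1)) = (\<Prod>i\<in>I. 2::real)"
      by (intro prod.cong) auto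
    then show ?thesis using True by simp
  next
    case False
    then have "(\<Sum>y\<in>{-1, 1::real}. (if k = k then y else 1) * (if k = l then y else 1)) = 0"
      by simp
    then show ?thesis using False assms by (subst prod_zero) auto
  qed
  finally show ?thesis .
qed

text \<open>With \<open>s = sqrt d\<close>, the mean of \<open>exp (s * M)\<close> is at most the sum of the means of the
  exponentials of \<open>s\<close> times the individual sums, hence at most \<open>exp ((c + 1) * d)\<close>. So \<open>M\<close> exceeds
  \<open>(c + 1) * s\<close> only with exponentially small probability, and its mean square is of order \<open>d\<close>. The
  constant 1 is included in the maximum so that \<open>M\<close> is positive and can be used as a divisor.\<close>

lemma expected_square_of_max:
  fixes a :: "'j \<Rightarrow> 'i \<Rightarrow> real" and c d :: real
  assumes I: "finite I" and J: "finite J" "real (card J) + 1 \<le> exp (c * d)" and d: "1 \<le> d" and c: "0 \<le> c"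
    and a: "\<And>j. j \<in> J \<Longrightarrow> (\<Sum>i\<in>I. (a j i)\<^sup>2) \<le> 1"
  obtains M :: "('i \<Rightarrow> real) \<Rightarrow> real"
  where "\<And>e. 1 \<le> M e" "\<And>e j. j \<in> J \<Longrightarrow> (\<Sum>i\<in>I. a j i * e i) \<le> M e"
    "(\<Sum>e\<in>signs I. (M e)\<^sup>2) \<le> (2 * (c + 2)\<^sup>2 + 4) * d * 2 ^ card I"
proof -
  define M where "M e = Max (insert 1 ((\<lambda>j. \<Sum>i\<in>I. a j i * e i) ` J))" for e
  define s where "s = sqrt d"
  have s: "1 \<le> s" "s * s = d" using d by (auto simp: s_def)
  have M1: "1 \<le> M e" for e unfolding M_def using J by (intro Max_ge) auto
  have MJ: "(\<Sum>i\<in>I. a j i * e i) \<le> M e" if "j \<in> J" for e j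
    unfolding M_def using J that by (intro Max_ge) auto
  have exp_M: "exp (s * M e) \<le> exp s + (\<Sum>j\<in>J. exp (s * (\<Sum>i\<in>I. a j i * e i)))" for e
  proof -
    have "M e \<in> insert 1 ((\<lambda>j. \<Sum>i\<in>I. a j i * e i) ` J)"
      unfolding M_def using J by (intro Max_in) auto
    then consider "M e = 1" | j where "j \<in> J" "M e = (\<Sum>i\<in>I. a j i * e i)" by auto
    then show ?thesis
    proof cases
      case 1
      then show ?thesis by (simp add: sum_nonneg)
    next
      case 2
      then have "exp (s * M e) \<le> (\<Sum>j\<in>J. exp (s * (\<Sum>i\<in>I. a j i * e i)))"
        using J member_le_sum[of j J "\<lambda>j. exp (s * (\<Sum>i\<in>I. a j i * e i))"] by simp
      then show ?thesis by (simp add: add_increasing)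
    qed
  qed
  have "(\<Sum>e\<in>signs I. exp (s * M e)) \<le> 2 ^ card I * (exp (c * d) * exp (d))"
  proof -
    have "(\<Sum>e\<in>signs I. exp (s * M e))
        \<le> (\<Sum>e\<in>signs I. exp s + (\<Sum>j\<in>J. exp (s * (\<Sum>i\<in>I. a j i * e i))))"
      by (intro sum_mono exp_M)
    also have "\<dots> = 2 ^ card I * exp s + (\<Sum>j\<in>J. \<Sum>e\<in>signs I. exp (s * (\<Sum>i\<in>I. a j i * e i)))"
      unfolding sum.distrib by (simp add: card_signs I sum.swap[of _ J])
    also have "\<dots> \<le> 2 ^ card I * exp d + (\<Sum>j\<in>J. 2 ^ card I * exp d)"
    proof (intro add_mono sum_mono mult_left_mono)
      show "exp s \<le> exp d" using s by (simp add: mult_le_cancel_left1 flip: s(2))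
      fix j assume j: "j \<in> J"
      have "(\<Sum>e\<in>signs I. exp (s * (\<Sum>i\<in>I. a j i * e i))) = (\<Sum>e\<in>signs I. exp (\<Sum>i\<in>I. (s * a j i) * e i))"
        by (simp add: sum_distrib_left mult.assoc)
      also have "\<dots> \<le> 2 ^ card I * exp ((\<Sum>i\<in>I. (s * a j i)\<^sup>2) / 2)"
        by (rule sum_signs_exp_le[OF I])
      also have "(\<Sum>i\<in>I. (s * a j i)\<^sup>2) = d * (\<Sum>i\<in>I. (a j i)\<^sup>2)"
        by (simp add: power_mult_distrib sum_distrib_left power2_eq_square[of s] s(2))
      also have "d * (\<Sum>i\<in>I. (a j i)\<^sup>2) / 2 \<le> d"
        using mult_left_mono[OF a[OF j], of d] d by (simp add: sum_nonneg)
      finally show "(\<Sum>e\<in>signs I. exp (s * (\<Sum>i\<in>I. a j i * e i))) \<le> 2 ^ card I * exp d"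
        by simp
    qed simp_all
    also have "\<dots> = 2 ^ card I * ((real (card J) + 1) * exp d)" by (simp add: algebra_simps)
    also have "\<dots> \<le> 2 ^ card I * (exp (c * d) * exp d)"
      using J by (intro mult_left_mono mult_right_mono) auto
    finally show ?thesis .
  qed
  then have E: "(\<Sum>e\<in>signs I. exp (s * M e - (c + 1) * d)) \<le> 2 ^ card I"
  proof -
    have "(\<Sum>e\<in>signs I. exp (s * M e - (c + 1) * d)) = (\<Sum>e\<in>signs I. exp (s * M e)) / exp ((c + 1) * d)"
      by (simp add: exp_diff sum_divide_distrib)
    also have "\<dots> \<le> 2 ^ card I * (exp (c * d) * exp d) / exp ((c + 1) * d)"
      by (rule divide_right_mono) (fact, simp)
    also have "\<dots> = 2 ^ card I" by (simp add: algebra_simps exp_add)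
    finally show ?thesis .
  qed
  have sq: "(M e)\<^sup>2 \<le> 2 * (c + 1)\<^sup>2 * d + 4 * d * exp (s * M e - (c + 1) * d)" for e
  proof -
    define y where "y = M e / s"
    have My: "M e = s * y" and y0: "0 \<le> y" using s M1[of e] by (auto simp: y_def)
    have "y\<^sup>2 \<le> 2 * (c + 1)\<^sup>2 + 4 * exp (d * (y - (c + 1)))"
    proof (cases "y \<le> c + 1")
      case True
      then have "y\<^sup>2 \<le> (c + 1)\<^sup>2" using y0 by (intro power_mono)
      then have "y\<^sup>2 \<le> 2 * (c + 1)\<^sup>2" using zero_le_power2[of "c + 1"] by linarith
      then show ?thesis by (simp add: add_increasing2)
    next
      case False
      define t where "t = y - (c + 1)"
      have t: "0 \<le> t" using False by (simp add: t_def)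
      have "t\<^sup>2 \<le> 2 * exp t"
        using exp_lower_Taylor_quadratic[OF t] t by (simp add: power2_eq_square)
      also have "exp t \<le> exp (d * t)" using d t by (simp add: mult_le_cancel_right1)
      finally have 1: "t\<^sup>2 \<le> 2 * exp (d * t)" by simp
      have "y\<^sup>2 = ((c + 1) + t)\<^sup>2" by (simp add: t_def)
      also have "\<dots> \<le> 2 * (c + 1)\<^sup>2 + 2 * t\<^sup>2"
        using zero_le_power2[of "(c + 1) - t"] by (simp add: power2_sum power2_diff)
      finally show ?thesis using 1 by (simp add: t_def)
    qed
    then have "d * y\<^sup>2 \<le> d * (2 * (c + 1)\<^sup>2 + 4 * exp (d * (y - (c + 1))))"
      using d by (intro mult_left_mono) auto
    moreover have "(M e)\<^sup>2 = d * y\<^sup>2" "s * M e = d * y"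
      unfolding My s(2)[symmetric] by (simp_all add: power2_eq_square)
    ultimately show ?thesis by (simp add: algebra_simps)
  qed
  have "(\<Sum>e\<in>signs I. (M e)\<^sup>2) \<le> (\<Sum>e\<in>signs I. 2 * (c + 1)\<^sup>2 * d + 4 * d * exp (s * M e - (c + 1) * d))"
    by (intro sum_mono sq)
  also have "\<dots> = 2 ^ card I * (2 * (c + 1)\<^sup>2 * d) + 4 * d * (\<Sum>e\<in>signs I. exp (s * M e - (c + 1) * d))"
    by (simp add: sum.distrib card_signs I sum_distrib_left)
  also have "\<dots> \<le> 2 ^ card I * (2 * (c + 2)\<^sup>2 * d) + 4 * d * 2 ^ card I"
    using E d c by (intro add_mono mult_left_mono mult_right_mono power_mono) auto
  also have "\<dots> = (2 * (c + 2)\<^sup>2 + 4) * d * 2 ^ card I" by (simp add: algebra_simps)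
  finally show ?thesis using M1 MJ that by blast
qed

section \<open>A net of the Euclidean ball\<close>

text \<open>Rounding the coordinates of a unit vector towards zero to multiples of \<open>1 / (2 * sqrt d)\<close>, where
  \<open>d = card I\<close>, keeps it in the unit ball and moves it by at most \<open>1/2\<close>. The net consists of the grid
  points in the ball; membership is expressed by the integer coordinates.\<close>

definition ball_net :: "'i set \<Rightarrow> ('i \<Rightarrow> real) set" where
  "ball_net I = (\<lambda>k i. of_int (k i) / (2 * sqrt (card I))) `
     {k \<in> I \<rightarrow>\<^sub>E {- 4 * int (card I)..4 * int (card I)}. (\<Sum>i\<in>I. (k i)\<^sup>2) \<le> 4 * int (card I)}"

lemma finite_ball_net: "finite I \<Longrightarrow> finite (ball_net I)"
  unfolding ball_net_def by (intro finite_imageI finite_subset[OF _ finite_PiE[of I "\<lambda>_. {- 4 * int (card I)..4 * int (card I)}"]]) auto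

lemma sum_half_power_int_le: "(\<Sum>k\<in>{- int m..int m}. (1/2::real) ^ nat \<bar>k\<bar>) \<le> 3 - 2 / 2 ^ m"
proof (induction m)
  case (Suc m)
  have "{- int (Suc m)..int (Suc m)} = insert (int (Suc m)) (insert (- int (Suc m)) {- int m..int m})"
    by auto
  then have "(\<Sum>k\<in>{- int (Suc m)..int (Suc m)}. (1/2::real) ^ nat \<bar>k\<bar>)
      = 2 * (1/2) ^ Suc m + (\<Sum>k\<in>{- int m..int m}. (1/2::real) ^ nat \<bar>k\<bar>)"
    by (simp add: nat_add_distrib)
  also have "\<dots> \<le> 2 * (1/2) ^ Suc m + (3 - 2 / 2 ^ m)" using Suc by simp
  also have "\<dots> = 3 - 2 / 2 ^ Suc m" by (simp add: power_divide field_simps)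
  finally show ?case .
qed simp

lemma abs_le_square_int: "\<bar>k :: int\<bar> \<le> k\<^sup>2"
proof (cases "k = 0")
  case False
  then have "\<bar>k\<bar> ^ 1 \<le> \<bar>k\<bar> ^ 2" by (intro power_increasing) auto
  then show ?thesis by simp
qed simp

text \<open>Integer coordinates satisfy \<open>\<bar>k\<bar> \<le> k\<^sup>2\<close>, so \<open>\<Sum> \<bar>k\<^sub>i\<bar> \<le> 4 * d\<close> on the net and each of its points has
  weight at least 1 for the product weight \<open>16 ^ d * \<Prod> (1/2) ^ \<bar>k\<^sub>i\<bar>\<close>. Each factor
  \<open>\<Sum> (1/2) ^ \<bar>k\<bar>\<close> is at most 3.\<close>

lemma card_ball_net_le:
  assumes "finite I"
  shows "real (card (ball_net I)) \<le> 48 ^ card I"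
proof -
  define d where "d = card I"
  define B where "B = {- int (4 * d)..int (4 * d)}"
  define S where "S = {k \<in> I \<rightarrow>\<^sub>E B. (\<Sum>i\<in>I. (k i)\<^sup>2) \<le> 4 * int d}"
  have fin: "finite (I \<rightarrow>\<^sub>E B)" using assms by (intro finite_PiE) (auto simp: B_def)
  then have finS: "finite S" unfolding S_def by (rule rev_finite_subset) auto
  have net: "ball_net I = (\<lambda>k i. of_int (k i) / (2 * sqrt (card I))) ` S"
    unfolding ball_net_def S_def B_def d_def by simp
  have "real (card (ball_net I)) \<le> real (card S)"
    unfolding net using finS by (simp add: card_image_le)
  also have "\<dots> = (\<Sum>k\<in>S. 1)" by simp
  also have "\<dots> \<le> (\<Sum>k\<in>S. 16 ^ d * (\<Prod>i\<in>I. (1/2) ^ nat \<bar>k i\<bar>))"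
  proof (rule sum_mono)
    fix k assume k: "k \<in> S"
    have "\<bar>k i\<bar> \<le> (k i)\<^sup>2" for i
      by (rule abs_le_square_int)
    then have "(\<Sum>i\<in>I. \<bar>k i\<bar>) \<le> 4 * int d"
      using k sum_mono[of I "\<lambda>i. \<bar>k i\<bar>" "\<lambda>i. (k i)\<^sup>2"] unfolding S_def by fastforce
    moreover have "(\<Sum>i\<in>I. \<bar>k i\<bar>) = int (\<Sum>i\<in>I. nat \<bar>k i\<bar>)" by simp
    ultimately have le: "(\<Sum>i\<in>I. nat \<bar>k i\<bar>) \<le> 4 * d" by linarith
    have "(\<Prod>i\<in>I. (1/2::real) ^ nat \<bar>k i\<bar>) = (1/2) ^ (\<Sum>i\<in>I. nat \<bar>k i\<bar>)"
      by (simp add: power_sum)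
    also have "\<dots> \<ge> (1/2) ^ (4 * d)" using le by (intro power_decreasing) auto
    finally have "16 ^ d * (1/2) ^ (4 * d) \<le> 16 ^ d * (\<Prod>i\<in>I. (1/2::real) ^ nat \<bar>k i\<bar>)"
      by (intro mult_left_mono) auto
    moreover have "16 ^ d * (1/2::real) ^ (4 * d) = 1"
      by (simp add: power_mult power_divide flip: power_mult_distrib)
    ultimately show "1 \<le> 16 ^ d * (\<Prod>i\<in>I. (1/2::real) ^ nat \<bar>k i\<bar>)" by simp
  qed
  also have "\<dots> \<le> (\<Sum>k\<in>I \<rightarrow>\<^sub>E B. 16 ^ d * (\<Prod>i\<in>I. (1/2) ^ nat \<bar>k i\<bar>))"
    using fin by (intro sum_mono2) (auto simp: S_def prod_nonneg)
  also have "\<dots> = 16 ^ d * (\<Prod>i\<in>I. \<Sum>y\<in>B. (1/2) ^ nat \<bar>y\<bar>)"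
    using assms by (subst prod_sum_PiE) (auto simp: sum_distrib_left B_def)
  also have "\<dots> \<le> 16 ^ d * (\<Prod>i\<in>I. 3)"
  proof (intro mult_left_mono prod_mono conjI)
    have "0 \<le> 2 / (2::real) ^ (4 * d)" by simp
    then show "(\<Sum>y\<in>B. (1/2::real) ^ nat \<bar>y\<bar>) \<le> 3"
      using sum_half_power_int_le[of "4 * d"] unfolding B_def by linarith
  qed (auto simp: sum_nonneg)
  also have "\<dots> = 48 ^ card I" by (simp add: d_def flip: power_mult_distrib)
  finally show ?thesis .
qed

lemma ball_net_le_1:
  assumes "finite I" "z \<in> ball_net I"
  shows "(sumsq I z) \<le> 1"
proof -
  obtain k where z: "z = (\<lambda>i. of_int (k i) / (2 * sqrt (card I)))"
    and k: "(\<Sum>i\<in>I. (k i)\<^sup>2) \<le> 4 * int (card I)"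
    using assms unfolding ball_net_def by auto
  show ?thesis
  proof (cases "card I = 0")
    case False
    have "(sumsq I z) = of_int (\<Sum>i\<in>I. (k i)\<^sup>2) / (4 * real (card I))"
      unfolding z by (simp add: power_divide power_mult_distrib sum_divide_distrib)
    also have "\<dots> \<le> of_int (4 * int (card I)) / (4 * real (card I))"
      by (rule divide_right_mono[OF of_int_le_iff[THEN iffD2, OF k]]) simp
    also have "\<dots> = 1" using False by simp
    finally show ?thesis .
  qed (use assms in simp)
qed

lemma sum_mult_le_sqrt: "\<bar>\<Sum>i\<in>I. a i * b i\<bar> \<le> sqrt (sumsq I a) * sqrt (sumsq I b)"
  for a b :: "'i \<Rightarrow> real"
proof -
  have "\<bar>\<Sum>i\<in>I. a i * b i\<bar> = sqrt ((\<Sum>i\<in>I. a i * b i)\<^sup>2)" by simp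
  also have "\<dots> \<le> sqrt ((sumsq I a) * (sumsq I b))"
    by (intro real_sqrt_le_mono Cauchy_Schwarz_ineq_sum)
  finally show ?thesis by (simp add: real_sqrt_mult)
qed

text \<open>Test \<open>a\<close> against the net point that approximates \<open>a / \<parallel>a\<parallel>\<close>: by the Cauchy-Schwarz inequality the
  approximation costs at most half of \<open>\<parallel>a\<parallel>\<close>.\<close>

lemma l2_norm_le_of_ball_net:
  assumes I: "finite I" and t: "\<And>z. z \<in> ball_net I \<Longrightarrow> (\<Sum>i\<in>I. a i * z i) \<le> t"
  shows "sqrt (sumsq I a) \<le> 2 * t"
proof -
  define s where "s = sqrt (sumsq I a)"
  have s0: "0 \<le> s" unfolding s_def by (simp add: sum_nonneg)
  have ss: "s * s = (sumsq I a)" unfolding s_def by (simp add: sum_nonneg)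
  show ?thesis
  proof (cases "s = 0")
    case True
    have "(\<lambda>i. of_int ((\<lambda>i\<in>I. 0) i) / (2 * sqrt (card I))) \<in> ball_net I"
      unfolding ball_net_def by (intro imageI) auto
    from t[OF this] show ?thesis using True unfolding s_def by simp
  next
    case False
    define d where "d = card I"
    have "I \<noteq> {}" using False by (auto simp: s_def)
    then have d: "0 < d" using I by (simp add: d_def card_gt_0_iff)
    define x where "x i = a i / s" for i
    define c where "c = 2 * sqrt d"
    have c: "0 < c" "c * c = 4 * d" using d by (auto simp: c_def)
    define k where "k = (\<lambda>i\<in>I. (if 0 \<le> x i then 1 else -1) * \<lfloor>c * \<bar>x i\<bar>\<rfloor>)"
    have xx: "(sumsq I x) = 1"
      using False by (simp add: x_def power_divide power2_eq_square[of s] ss flip: sum_divide_distrib)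
        (metis ss mult_eq_0_iff)
    have ax: "(\<Sum>i\<in>I. a i * x i) = s"
      using False ss by (simp add: x_def power2_eq_square[symmetric] field_simps flip: sum_divide_distrib)
    have kle: "(of_int (k i))\<^sup>2 \<le> c * c * (x i)\<^sup>2" if "i \<in> I" for i
    proof -
      have "\<bar>of_int (k i) :: real\<bar> = of_int \<lfloor>c * \<bar>x i\<bar>\<rfloor>"
      proof -
        have "0 \<le> \<lfloor>c * \<bar>x i\<bar>\<rfloor>" using c by simp
        then show ?thesis using that by (simp only: k_def restrict_apply' flip: of_int_abs) (simp add: abs_mult)
      qed
      also have "\<dots> \<le> c * \<bar>x i\<bar>" by simp
      finally have "\<bar>of_int (k i) :: real\<bar> \<le> \<bar>c * x i\<bar>" using c by (simp add: abs_mult)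
      then show ?thesis by (simp add: abs_le_square_iff power_mult_distrib power2_eq_square mult_ac)
    qed
    have kx: "\<bar>x i - of_int (k i) / c\<bar> \<le> 1 / c" if "i \<in> I" for i
    proof -
      have "\<bar>c * x i - of_int (k i)\<bar> \<le> 1"
        using that c by (cases "0 \<le> x i") (auto simp: k_def abs_le_iff floor_le_iff le_floor_iff, linarith+)
      then have "\<bar>c * x i - of_int (k i)\<bar> / c \<le> 1 / c" using c by (intro divide_right_mono) auto
      moreover have "x i - of_int (k i) / c = (c * x i - of_int (k i)) / c"
        using c by (simp add: diff_divide_distrib)
      ultimately show ?thesis using c by simp
    qed
    have ksum: "(\<Sum>i\<in>I. (k i)\<^sup>2) \<le> 4 * int d"
    proof -
      have "of_int (\<Sum>i\<in>I. (k i)\<^sup>2) \<le> (\<Sum>i\<in>I. c * c * (x i)\<^sup>2)"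
        using kle by (simp add: sum_mono)
      also have "\<dots> = of_int (4 * int d)" using xx c by (simp flip: sum_distrib_left)
      finally show ?thesis by (simp only: of_int_le_iff)
    qed
    have "k i \<in> {- 4 * int d..4 * int d}" if "i \<in> I" for i
    proof -
      have "\<bar>k i\<bar> \<le> (k i)\<^sup>2"
        by (rule abs_le_square_int)
      also have "\<dots> \<le> (\<Sum>i\<in>I. (k i)\<^sup>2)" using that I by (intro member_le_sum) auto
      finally show ?thesis using ksum by auto
    qed
    then have "k \<in> I \<rightarrow>\<^sub>E {- 4 * int d..4 * int d}" by (auto simp: k_def)
    then have "(\<lambda>i. of_int (k i) / c) \<in> ball_net I"
      unfolding ball_net_def c_def using ksum by (intro image_eqI) (auto simp: d_def)
    from t[OF this] have 1: "(\<Sum>i\<in>I. a i * (of_int (k i) / c)) \<le> t" .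
    have "(\<Sum>i\<in>I. a i * (x i - of_int (k i) / c))
        \<le> sqrt (sumsq I a) * sqrt (\<Sum>i\<in>I. (x i - of_int (k i) / c)\<^sup>2)"
      using sum_mult_le_sqrt[where a = a and b = "\<lambda>i. x i - of_int (k i) / c" and I = I] by linarith
    also have "\<dots> \<le> s * (1 / 2)"
      unfolding s_def[symmetric]
    proof (rule mult_left_mono[OF _ s0], rule real_le_lsqrt)
      have "(\<Sum>i\<in>I. (x i - of_int (k i) / c)\<^sup>2) \<le> (\<Sum>i\<in>I. (1 / c)\<^sup>2)"
        using kx c by (intro sum_mono) (auto simp: abs_le_square_iff[symmetric])
      also have "\<dots> = (1 / 2)\<^sup>2"
        using c(2) d by (simp add: power_divide power2_eq_square d_def[symmetric])
      finally show "(\<Sum>i\<in>I. (x i - of_int (k i) / c)\<^sup>2) \<le> (1 / 2)\<^sup>2" .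
    qed (auto simp: sum_nonneg)
    finally have 2: "(\<Sum>i\<in>I. a i * (x i - of_int (k i) / c)) \<le> s / 2" by simp
    have "s = (\<Sum>i\<in>I. a i * (of_int (k i) / c)) + (\<Sum>i\<in>I. a i * (x i - of_int (k i) / c))"
      unfolding ax[symmetric] by (simp add: sum.distrib[symmetric] algebra_simps)
    then show ?thesis using 1 2 unfolding s_def[symmetric] by linarith
  qed
qed

text \<open>Multilinear expressions are bounded one variable at a time, so it is enough to have a notion of
  linearity in a single variable.\<close>

definition linear_form :: "'i set \<Rightarrow> (('i \<Rightarrow> real) \<Rightarrow> real) \<Rightarrow> bool" where
  "linear_form I f \<longleftrightarrow> (\<exists>a. \<forall>x. f x = (\<Sum>i\<in>I. a i * x i))"

lemma linear_form_le_of_ball_net: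
  assumes I: "finite I" and f: "linear_form I f" and t: "\<And>z. z \<in> ball_net I \<Longrightarrow> f z \<le> t"
  shows "\<bar>f x\<bar> \<le> 2 * t * sqrt (sumsq I x)"
proof -
  obtain a where a: "\<And>x. f x = (\<Sum>i\<in>I. a i * x i)" using f by (auto simp: linear_form_def)
  have "sqrt (sumsq I a) \<le> 2 * t" using t by (intro l2_norm_le_of_ball_net I) (simp add: a)
  then have "sqrt (sumsq I a) * sqrt (sumsq I x) \<le> 2 * t * sqrt (sumsq I x)"
    by (intro mult_right_mono) (auto simp: sum_nonneg)
  then show ?thesis unfolding a using sum_mult_le_sqrt[of a x I] by linarith
qed

lemma linear_form_sum:
  assumes "\<And>k. k \<in> K \<Longrightarrow> linear_form I (f k)"
  shows "linear_form I (\<lambda>x. \<Sum>k\<in>K. f k x * c k)"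
proof -
  obtain a where a: "\<And>k x. k \<in> K \<Longrightarrow> f k x = (\<Sum>i\<in>I. a k i * x i)"
    using assms unfolding linear_form_def by metis
  have "(\<Sum>k\<in>K. f k x * c k) = (\<Sum>i\<in>I. (\<Sum>k\<in>K. a k i * c k) * x i)" for x
  proof -
    have "(\<Sum>k\<in>K. f k x * c k) = (\<Sum>k\<in>K. \<Sum>i\<in>I. a k i * c k * x i)"
      by (intro sum.cong refl) (simp add: a sum_distrib_left mult_ac)
    also have "\<dots> = (\<Sum>i\<in>I. \<Sum>k\<in>K. a k i * c k * x i)" by (rule sum.swap)
    finally show ?thesis by (simp add: sum_distrib_right)
  qed
  then show ?thesis unfolding linear_form_def by (intro exI[of _ "\<lambda>i. \<Sum>k\<in>K. a k i * c k"] allI)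
qed

lemma linear_form_coord: "finite I \<Longrightarrow> i \<in> I \<Longrightarrow> linear_form I (\<lambda>x. x i * c)"
  unfolding linear_form_def
proof (intro exI[of _ "\<lambda>j. if j = i then c else 0"] allI)
  fix x :: "'a \<Rightarrow> real"
  assume I: "finite I" "i \<in> I"
  have "(\<Sum>j\<in>I. (if j = i then c else 0) * x j) = (\<Sum>j\<in>I. if j = i then c * x j else 0)"
    by (intro sum.cong) auto
  then show "x i * c = (\<Sum>j\<in>I. (if j = i then c else 0) * x j)" using I by simp
qed

lemma linear_form_add: "linear_form I f \<Longrightarrow> linear_form I g \<Longrightarrow> linear_form I (\<lambda>x. f x + g x)"
  unfolding linear_form_def by (metis (mono_tags, lifting) distrib_right sum.cong sum.distrib)

section \<open>Interpolation and inequalities between power sums\<close>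

lemma mult_le_mean_squares: "u * v \<le> (u\<^sup>2 + v\<^sup>2) / 2" for u v :: real
  using zero_le_power2[of "u - v"] by (simp add: power2_diff)

lemma powr_divide_eq_mult: "0 < u \<Longrightarrow> 0 < v \<Longrightarrow> (u / v) powr a = u powr a * v powr (- a)" for u v a :: real
  by (simp add: powr_divide powr_minus_divide)

text \<open>The sum is dominated by the geometric series that descends from the largest element of \<open>R\<close> up to
  \<open>Y\<close>.\<close>

lemma sum_dyadic_powr_le:
  fixes b Y :: real
  assumes R: "finite R" "\<And>r. r \<in> R \<Longrightarrow> \<exists>k::int. r = 2 powr of_int k" and b: "0 < b" and Y: "0 < Y"
  shows "(\<Sum>r\<in>{r\<in>R. r \<le> Y}. r powr b) \<le> 1 / (1 - 2 powr (- b)) * Y powr b"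
proof -
  define q where "q = (2::real) powr (- b)"
  have q: "0 < q" "q < 1" using b powr_less_one[of 2 "-b"] by (auto simp: q_def)
  define R' where "R' = {r\<in>R. r \<le> Y}"
  have fin: "finite R'" using R by (simp add: R'_def)
  show ?thesis
  proof (cases "R' = {}")
    case False
    define m where "m = Max R'"
    have mR: "m \<in> R'" unfolding m_def using fin False by simp
    then obtain k0 :: int where k0: "m = 2 powr of_int k0" using R(2) by (auto simp: R'_def)
    define g where "g j = (2::real) powr of_int (k0 - int j)" for j
    have "R' \<subseteq> range g"
    proof
      fix r assume r: "r \<in> R'"
      then obtain k :: int where k: "r = 2 powr of_int k" using R(2) by (auto simp: R'_def)
      have "r \<le> m" unfolding m_def using r fin by simp
      then have "k \<le> k0" unfolding k k0 by simp
      then have "r = g (nat (k0 - k))" unfolding g_def k by simp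
      then show "r \<in> range g" by blast
    qed
    then obtain S where S: "finite S" "R' = g ` S" using finite_subset_image[OF fin] by blast
    have inj: "inj_on g S" by (auto simp: inj_on_def g_def powr_inj)
    have gb: "g j powr b = m powr b * q ^ j" for j
    proof -
      have "g j powr b = 2 powr (of_int k0 * b + (- b) * real j)"
        by (simp add: g_def powr_powr algebra_simps)
      also have "\<dots> = m powr b * (2 powr (- b)) powr real j"
        unfolding powr_add k0 powr_powr by simp
      also have "(2 powr (- b)) powr real j = q ^ j" unfolding q_def by (simp add: powr_realpow)
      finally show ?thesis .
    qed
    have "(\<Sum>r\<in>R'. r powr b) = (\<Sum>j\<in>S. m powr b * q ^ j)"
      unfolding S(2) using inj by (simp add: sum.reindex gb)
    also have "\<dots> = m powr b * (\<Sum>j\<in>S. q ^ j)" by (simp add: sum_distrib_left)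
    also have "\<dots> \<le> Y powr b * (1 / (1 - q))"
    proof (rule mult_mono)
      show "m powr b \<le> Y powr b" using mR b k0 by (intro powr_mono2) (auto simp: R'_def)
      have "(\<Sum>j\<in>S. q ^ j) \<le> (\<Sum>j. q ^ j)"
        using q S by (intro sum_le_suminf summable_geometric) auto
      then show "(\<Sum>j\<in>S. q ^ j) \<le> 1 / (1 - q)" using q suminf_geometric[of q] by simp
    qed (use q in \<open>auto simp: sum_nonneg\<close>)
    finally show ?thesis unfolding R'_def q_def by (simp add: mult.commute)
  next
    case True
    then show ?thesis using q Y by (simp add: R'_def[symmetric] q_def[symmetric])
  qed
qed

text \<open>The two summands come from the two sets of pairs that are separated in \<open>matrix_interpolation\<close>.\<close>

definition interp_const :: "real \<Rightarrow> real" where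
  "interp_const p = 2 powr (p - 1) + (1 + 1 / (1 - 2 powr (p - 2))) / 2"

lemma interp_const_pos: "p < 2 \<Longrightarrow> 0 < interp_const p"
  using powr_less_one[of 2 "p - 2"] by (simp add: interp_const_def add_pos_nonneg)

text \<open>Up to the constant, this is the Riesz-Thorin bound between \<open>l\<^sub>1 \<rightarrow> l\<^sub>\<infinity>\<close> (norm \<open>K1\<close>) and
  \<open>l\<^sub>2 \<rightarrow> l\<^sub>2\<close> (norm \<open>K2\<close>). Round \<open>\<bar>x i\<bar>\<close> up to a power of two \<open>r i\<close> and fix a threshold \<open>t\<close>. On the pairs
  with \<open>r i * \<bar>y j\<bar> > t\<close> the bound of the entries contributes at most a multiple of
  \<open>K1 * t powr (1 - p)\<close>. The other pairs form a product set for each dyadic value of \<open>r\<close>, so the \<open>l\<^sub>2\<close>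
  bound applies to each of these sets, and summing a geometric series over the dyadic values
  contributes at most a multiple of \<open>K2 * t powr (1 - p / 2)\<close>. The choice of \<open>t\<close> makes the two
  contributions comparable. A cut by \<open>\<bar>x i\<bar> * \<bar>y j\<bar>\<close> itself would produce staircase-shaped sets of pairs,
  on which the \<open>l\<^sub>2\<close> bound can fail.\<close>

lemma matrix_interpolation:
  fixes m :: "nat \<Rightarrow> nat \<Rightarrow> real" and x y :: "nat \<Rightarrow> real"
  assumes p: "1 \<le> p" "p < 2" and K: "0 < K1" "0 < K2"
    and m1: "\<And>i j. i < n \<Longrightarrow> j < n \<Longrightarrow> \<bar>m i j\<bar> \<le> K1"
    and m2: "\<And>a b. \<bar>\<Sum>i<n. \<Sum>j<n. m i j * a i * b j\<bar> \<le> K2 * sqrt (\<Sum>i<n. (a i)\<^sup>2) * sqrt (\<Sum>j<n. (b j)\<^sup>2)"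
    and x: "(\<Sum>i<n. \<bar>x i\<bar> powr p) \<le> 1" and y: "(\<Sum>j<n. \<bar>y j\<bar> powr p) \<le> 1"
  shows "\<bar>\<Sum>i<n. \<Sum>j<n. m i j * x i * y j\<bar> \<le> interp_const p * K1 powr (2 / p - 1) * K2 powr (2 - 2 / p)"
proof -
  \<comment> \<open>The threshold at which \<open>K1 * t powr (1 - p) = K2 * t powr (1 - p / 2)\<close>.\<close>
  define t where "t = (K1 / K2) powr (2 / p)"
  have t: "0 < t" using K by (simp add: t_def)
  define r where "r i = (2::real) powr of_int \<lceil>log 2 \<bar>x i\<bar>\<rceil>" for i
  have r0: "0 < r i" for i by (simp add: r_def)
  have xr: "\<bar>x i\<bar> \<le> r i" for i
  proof (cases "x i = 0")
    case False
    then have "\<bar>x i\<bar> = 2 powr (log 2 \<bar>x i\<bar>)" by simp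
    also have "\<dots> \<le> r i" unfolding r_def by (intro powr_mono) auto
    finally show ?thesis .
  qed (simp add: less_imp_le[OF r0])
  have rx: "r i \<le> 2 * \<bar>x i\<bar>" if "x i \<noteq> 0" for i
  proof -
    have "r i \<le> 2 powr (log 2 \<bar>x i\<bar> + 1)" unfolding r_def by (intro powr_mono of_int_ceiling_le_add_one) auto
    also have "\<dots> = 2 * \<bar>x i\<bar>" using that by (simp add: powr_add)
    finally show ?thesis .
  qed
  define big where "big i j \<longleftrightarrow> t < r i * \<bar>y j\<bar>" for i j
  have split: "(\<Sum>i<n. \<Sum>j<n. m i j * x i * y j)
      = (\<Sum>i<n. \<Sum>j<n. if big i j then m i j * x i * y j else 0) + (\<Sum>i<n. \<Sum>j<n. if big i j then 0 else m i j * x i * y j)"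
    unfolding sum.distrib[symmetric] by (intro sum.cong refl) simp
  have "\<bar>\<Sum>i<n. \<Sum>j<n. if big i j then m i j * x i * y j else 0\<bar>
      \<le> (\<Sum>i<n. \<Sum>j<n. \<bar>if big i j then m i j * x i * y j else 0\<bar>)"
    by (rule order.trans[OF sum_abs], intro sum_mono, rule sum_abs)
  also have "\<dots> \<le> (\<Sum>i<n. \<Sum>j<n. K1 * t powr (1 - p) * 2 powr (p - 1) * (\<bar>x i\<bar> powr p * \<bar>y j\<bar> powr p))"
  proof (intro sum_mono)
    fix i j assume ij: "i \<in> {..<n}" "j \<in> {..<n}"
    show "\<bar>if big i j then m i j * x i * y j else 0\<bar>
        \<le> K1 * t powr (1 - p) * 2 powr (p - 1) * (\<bar>x i\<bar> powr p * \<bar>y j\<bar> powr p)"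
    proof (cases "big i j \<and> x i \<noteq> 0")
      case True
      then have y0: "0 < \<bar>y j\<bar>" using t r0[of i] by (auto simp: big_def) 
      have x0: "0 < \<bar>x i\<bar>" using True by simp
      have "1 \<le> (r i * \<bar>y j\<bar> / t) powr (p - 1)"
        using True t p by (intro ge_one_powr_ge_zero) (auto simp: big_def)
      also have "\<dots> \<le> (2 * \<bar>x i\<bar> * \<bar>y j\<bar> / t) powr (p - 1)"
        using rx[of i] True t p y0 r0[of i] by (intro powr_mono2 divide_right_mono mult_right_mono) (auto simp: less_imp_le)
      finally have 1: "1 \<le> (2 * \<bar>x i\<bar> * \<bar>y j\<bar> / t) powr (p - 1)" .
      have "\<bar>m i j * x i * y j\<bar> \<le> K1 * (\<bar>x i\<bar> * \<bar>y j\<bar>)"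
        using m1[of i j] ij by (simp add: abs_mult mult.assoc mult_right_mono)
      also have "\<dots> \<le> K1 * (\<bar>x i\<bar> * \<bar>y j\<bar>) * (2 * \<bar>x i\<bar> * \<bar>y j\<bar> / t) powr (p - 1)"
        using mult_left_mono[OF 1, of "K1 * (\<bar>x i\<bar> * \<bar>y j\<bar>)"] K by simp
      also have "\<dots> = K1 * t powr (1 - p) * 2 powr (p - 1) * (\<bar>x i\<bar> powr p * \<bar>y j\<bar> powr p)"
      proof -
        have e: "u powr p = u * u powr (p - 1)" if "0 < u" for u :: real
          using that by (metis add.commute diff_add_cancel powr_add powr_one less_imp_le)
        have "t powr (1 - p) = 1 / t powr (p - 1)" by (metis minus_diff_eq powr_minus_divide)
        then show ?thesis
          using x0 y0 t by (simp add: e[OF x0] e[OF y0] powr_mult powr_divide)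
      qed
      finally show ?thesis using True by simp
    qed (use K t in \<open>auto\<close>)
  qed
  also have "\<dots> = K1 * t powr (1 - p) * 2 powr (p - 1) * ((\<Sum>i<n. \<bar>x i\<bar> powr p) * (\<Sum>j<n. \<bar>y j\<bar> powr p))"
    by (simp only: sum_product) (simp only: sum_distrib_left)
  also have "\<dots> \<le> K1 * t powr (1 - p) * 2 powr (p - 1) * 1"
    using x y K by (intro mult_left_mono mult_le_one sum_nonneg) auto
  finally have B: "\<bar>\<Sum>i<n. \<Sum>j<n. if big i j then m i j * x i * y j else 0\<bar> \<le> 2 powr (p - 1) * (K1 * t powr (1 - p))"
    by (simp add: mult_ac)
  define R where "R = r ` {..<n}"
  define al where "al = t powr (1 - p / 2)"
  have al: "0 < al" "al * al = t powr (2 - p)" using t by (auto simp: al_def powr_add[symmetric])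
  define D where "D = 1 / (1 - (2::real) powr (p - 2))"
  have D0: "0 < D" using p powr_less_one[of 2 "p - 2"] by (simp add: D_def)
  define xs where "xs s i = (if r i = s then x i else 0)" for s i
  define ys where "ys s j = (if s * \<bar>y j\<bar> \<le> t then y j else 0)" for s j
  define A where "A s = (\<Sum>i<n. (xs s i)\<^sup>2)" for s
  define Bs where "Bs s = (\<Sum>j<n. (ys s j)\<^sup>2)" for s
  have "(\<Sum>i<n. \<Sum>j<n. if big i j then 0 else m i j * x i * y j)
      = (\<Sum>i<n. \<Sum>s\<in>R. \<Sum>j<n. m i j * xs s i * ys s j)"
  proof (intro sum.cong refl)
    fix i assume i: "i \<in> {..<n}"
    have "(\<Sum>s\<in>R. \<Sum>j<n. m i j * xs s i * ys s j)
        = (\<Sum>s\<in>R. if r i = s then \<Sum>j<n. m i j * x i * (if r i * \<bar>y j\<bar> \<le> t then y j else 0) else 0)"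
      by (intro sum.cong refl) (auto simp: xs_def ys_def)
    also have "\<dots> = (\<Sum>j<n. m i j * x i * (if r i * \<bar>y j\<bar> \<le> t then y j else 0))"
      using i by (simp add: R_def)
    also have "\<dots> = (\<Sum>j<n. if big i j then 0 else m i j * x i * y j)"
      by (intro sum.cong refl) (auto simp: big_def)
    finally show "(\<Sum>j<n. if big i j then 0 else m i j * x i * y j)
      = (\<Sum>s\<in>R. \<Sum>j<n. m i j * xs s i * ys s j)" by simp
  qed
  also have "\<dots> = (\<Sum>s\<in>R. \<Sum>i<n. \<Sum>j<n. m i j * xs s i * ys s j)"
    by (rule sum.swap)
  finally have "\<bar>\<Sum>i<n. \<Sum>j<n. if big i j then 0 else m i j * x i * y j\<bar>
      = \<bar>\<Sum>s\<in>R. \<Sum>i<n. \<Sum>j<n. m i j * xs s i * ys s j\<bar>"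
    by (rule arg_cong)
  also have "\<dots> \<le> (\<Sum>s\<in>R. \<bar>\<Sum>i<n. \<Sum>j<n. m i j * xs s i * ys s j\<bar>)"
    by (rule sum_abs)
  also have "\<dots> \<le> (\<Sum>s\<in>R. K2 * ((al * (\<Sum>i<n. if r i = s then \<bar>x i\<bar> powr p else 0) + Bs s * s powr (2 - p) / al) / 2))"
  proof (rule sum_mono)
    fix s assume "s \<in> R"
    then have s: "0 < s" using r0 by (auto simp: R_def)
    have A0: "0 \<le> A s" "0 \<le> Bs s" by (auto simp: A_def Bs_def sum_nonneg)
    define w where "w = s powr (2 - p) / al"
    have w: "0 < w" using s al by (simp add: w_def)
    have "sqrt (A s) * sqrt (Bs s) \<le> (A s / w + Bs s * w) / 2"
    proof -
      have "sqrt (A s) * sqrt (Bs s) = sqrt (A s / w) * sqrt (Bs s * w)"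
        using w by (simp add: real_sqrt_divide real_sqrt_mult)
      also have "\<dots> \<le> ((sqrt (A s / w))\<^sup>2 + (sqrt (Bs s * w))\<^sup>2) / 2"
        by (rule mult_le_mean_squares)
      also have "\<dots> = (A s / w + Bs s * w) / 2" using A0 w by simp
      finally show ?thesis .
    qed
    also have "A s / w \<le> al * (\<Sum>i<n. if r i = s then \<bar>x i\<bar> powr p else 0)"
    proof -
      have "A s / w = (\<Sum>i<n. (xs s i)\<^sup>2 / w)" by (simp add: A_def sum_divide_distrib)
      also have "\<dots> \<le> (\<Sum>i<n. al * (if r i = s then \<bar>x i\<bar> powr p else 0))"
      proof (rule sum_mono)
        fix i
        show "(xs s i)\<^sup>2 / w \<le> al * (if r i = s then \<bar>x i\<bar> powr p else 0)"
        proof (cases "r i = s \<and> x i \<noteq> 0")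
          case True
          then have x0: "0 < \<bar>x i\<bar>" by simp
          have "(x i)\<^sup>2 = \<bar>x i\<bar> powr 2" using x0 by (subst powr_numeral) auto
          also have "\<dots> = \<bar>x i\<bar> powr p * \<bar>x i\<bar> powr (2 - p)" by (simp flip: powr_add)
          also have "\<dots> \<le> \<bar>x i\<bar> powr p * s powr (2 - p)"
            using xr[of i] True p by (intro mult_left_mono powr_mono2) auto
          also have "\<dots> = al * \<bar>x i\<bar> powr p * w" using al by (simp add: w_def)
          finally show ?thesis using True w by (simp add: xs_def divide_le_eq)
        qed (auto simp: xs_def)
      qed
      finally show ?thesis by (simp add: sum_distrib_left)
    qed
    finally have "sqrt (A s) * sqrt (Bs s)
        \<le> (al * (\<Sum>i<n. if r i = s then \<bar>x i\<bar> powr p else 0) + Bs s * w) / 2" by simp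
    then have "K2 * (sqrt (A s) * sqrt (Bs s)) \<le> K2 * ((al * (\<Sum>i<n. if r i = s then \<bar>x i\<bar> powr p else 0) + Bs s * w) / 2)"
      using K by (intro mult_left_mono) auto
    then show "\<bar>\<Sum>i<n. \<Sum>j<n. m i j * xs s i * ys s j\<bar>
        \<le> K2 * ((al * (\<Sum>i<n. if r i = s then \<bar>x i\<bar> powr p else 0) + Bs s * s powr (2 - p) / al) / 2)"
      using m2[of "xs s" "ys s"]
      unfolding A_def Bs_def w_def by (simp add: mult.assoc)
  qed
  also have "\<dots> = K2 * ((al * (\<Sum>s\<in>R. \<Sum>i<n. if r i = s then \<bar>x i\<bar> powr p else 0) + (\<Sum>s\<in>R. Bs s * s powr (2 - p)) / al) / 2)"
    by (simp only: sum_distrib_left[symmetric] sum_divide_distrib[symmetric] sum.distrib)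
  also have "\<dots> \<le> K2 * ((al * 1 + D * (al * al) / al) / 2)"
  proof (intro mult_left_mono divide_right_mono add_mono)
    have "(\<Sum>s\<in>R. \<Sum>i<n. if r i = s then \<bar>x i\<bar> powr p else 0) = (\<Sum>i<n. \<Sum>s\<in>R. if r i = s then \<bar>x i\<bar> powr p else 0)"
      by (rule sum.swap)
    also have "\<dots> = (\<Sum>i<n. \<bar>x i\<bar> powr p)" by (intro sum.cong refl) (simp add: R_def)
    finally show "(\<Sum>s\<in>R. \<Sum>i<n. if r i = s then \<bar>x i\<bar> powr p else 0) \<le> 1" using x by simp
    have "(\<Sum>s\<in>R. Bs s * s powr (2 - p)) = (\<Sum>j<n. \<Sum>s\<in>R. (ys s j)\<^sup>2 * s powr (2 - p))"
      unfolding Bs_def sum_distrib_right by (rule sum.swap)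
    also have "\<dots> \<le> (\<Sum>j<n. D * (al * al) * \<bar>y j\<bar> powr p)"
    proof (rule sum_mono)
      fix j
      show "(\<Sum>s\<in>R. (ys s j)\<^sup>2 * s powr (2 - p)) \<le> D * (al * al) * \<bar>y j\<bar> powr p"
      proof (cases "y j = 0")
        case False
        then have y0: "0 < \<bar>y j\<bar>" by simp
        have "(\<Sum>s\<in>R. (ys s j)\<^sup>2 * s powr (2 - p))
            = (\<Sum>s\<in>R. if s \<le> t / \<bar>y j\<bar> then (y j)\<^sup>2 * s powr (2 - p) else 0)"
          using y0 by (intro sum.cong refl) (auto simp: ys_def field_simps)
        also have "\<dots> = (y j)\<^sup>2 * (\<Sum>s\<in>{s\<in>R. s \<le> t / \<bar>y j\<bar>}. s powr (2 - p))"
          unfolding sum_distrib_left by (rule sum.inter_filter[symmetric]) (simp add: R_def)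
        also have "\<dots> \<le> (y j)\<^sup>2 * (1 / (1 - 2 powr (- (2 - p))) * (t / \<bar>y j\<bar>) powr (2 - p))"
          using p t y0 by (intro mult_left_mono sum_dyadic_powr_le) (auto simp: R_def r_def)
        also have "\<dots> = D * (al * al) * \<bar>y j\<bar> powr p"
        proof -
          have "(y j)\<^sup>2 = \<bar>y j\<bar> powr 2" using y0 by (subst powr_numeral) auto
          also have "\<dots> = \<bar>y j\<bar> powr p * \<bar>y j\<bar> powr (2 - p)" by (simp flip: powr_add)
          finally show ?thesis using y0 t unfolding al(2) D_def by (simp add: powr_divide)
        qed
        finally show ?thesis .
      qed (simp add: ys_def)
    qed
    also have "\<dots> = D * (al * al) * (\<Sum>j<n. \<bar>y j\<bar> powr p)" by (simp add: sum_distrib_left)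
    also have "\<dots> \<le> D * (al * al) * 1" using y D0 al by (intro mult_left_mono) auto
    finally show "(\<Sum>s\<in>R. Bs s * s powr (2 - p)) \<le> D * (al * al)" by simp
  qed (use K al in auto)
  also have "\<dots> = (1 + D) / 2 * (K2 * al)" using al(1) by (simp add: field_simps)
  finally have S: "\<bar>\<Sum>i<n. \<Sum>j<n. if big i j then 0 else m i j * x i * y j\<bar> \<le> (1 + D) / 2 * (K2 * al)" .
  have p0: "p \<noteq> 0" using p by simp
  have e1: "K1 * t powr (1 - p) = K1 powr (2 / p - 1) * K2 powr (2 - 2 / p)"
  proof -
    have "2 / p * (1 - p) = 2 / p - 2" using p0 by (simp add: right_diff_distrib)
    then have "t powr (1 - p) = (K1 / K2) powr (2 / p - 2)" by (simp only: t_def powr_powr)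
    also have "\<dots> = K1 powr (2 / p - 2) * K2 powr (- (2 / p - 2))"
      by (rule powr_divide_eq_mult[OF K])
    also have "K1 * \<dots> = (K1 powr 1 * K1 powr (2 / p - 2)) * K2 powr (2 - 2 / p)" using K by simp
    also have "K1 powr 1 * K1 powr (2 / p - 2) = K1 powr (2 / p - 1)" by (simp only: powr_add[symmetric]) simp
    finally show ?thesis .
  qed
  have e2: "K2 * al = K1 powr (2 / p - 1) * K2 powr (2 - 2 / p)"
  proof -
    have "2 / p * (1 - p / 2) = 2 / p - 1" using p0 by (simp add: right_diff_distrib)
    then have "al = (K1 / K2) powr (2 / p - 1)" by (simp only: al_def t_def powr_powr)
    also have "\<dots> = K1 powr (2 / p - 1) * K2 powr (- (2 / p - 1))"
      by (rule powr_divide_eq_mult[OF K])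
    also have "K2 * \<dots> = K1 powr (2 / p - 1) * (K2 powr 1 * K2 powr (1 - 2 / p))" using K by simp
    also have "K2 powr 1 * K2 powr (1 - 2 / p) = K2 powr (2 - 2 / p)" by (simp only: powr_add[symmetric]) simp
    finally show ?thesis .
  qed
  show ?thesis
    using order.trans[OF abs_triangle_ineq add_mono[OF B S]]
    unfolding split e1 e2 interp_const_def D_def[symmetric]
    by (simp only: distrib_right[symmetric] mult.assoc)
qed

text \<open>Young's inequality applied to \<open>\<bar>d k\<bar>\<close> divided by the \<open>q\<close>-th power mean of \<open>d\<close>.\<close>

lemma lp_norm_le_lq_norm:
  fixes d :: "nat \<Rightarrow> real"
  assumes p: "0 < p" "p \<le> q" and n: "0 < n"
  shows "(\<Sum>k<n. \<bar>d k\<bar> powr p) powr (1 / p) \<le> real n powr (1 / p - 1 / q) * (\<Sum>k<n. \<bar>d k\<bar> powr q) powr (1 / q)"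
proof -
  define S where "S = (\<Sum>k<n. \<bar>d k\<bar> powr q)"
  have S0: "0 \<le> S" by (simp add: S_def sum_nonneg)
  show ?thesis
  proof (cases "S = 0")
    case True
    then have "\<bar>d k\<bar> powr q = 0" if "k < n" for k
      using that unfolding S_def by (subst (asm) sum_nonneg_eq_0_iff) auto
    then have "d k = 0" if "k < n" for k using that by force
    then show ?thesis using p by simp
  next
    case False
    define t where "t = (S / n) powr (1 / q)"
    have t: "0 < t" "t powr q = S / n" using False S0 n p by (auto simp: t_def powr_powr)
    have "(\<Sum>k<n. \<bar>d k\<bar> powr p) \<le> (\<Sum>k<n. t powr p * (p / q * (\<bar>d k\<bar> powr q / t powr q) + (1 - p / q)))"
    proof (rule sum_mono)
      fix k
      show "\<bar>d k\<bar> powr p \<le> t powr p * (p / q * (\<bar>d k\<bar> powr q / t powr q) + (1 - p / q))"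
      proof (cases "d k = 0")
        case False
        have "((\<bar>d k\<bar> / t) powr q) powr (p / q) * 1 powr (1 - p / q) \<le> p / q * (\<bar>d k\<bar> / t) powr q + (1 - p / q) * 1"
          using False t(1) p by (intro Youngs_inequality_0) auto
        then have "(\<bar>d k\<bar> / t) powr p \<le> p / q * (\<bar>d k\<bar> powr q / t powr q) + (1 - p / q)"
          using t(1) p unfolding powr_powr by (simp add: powr_divide)
        then have "t powr p * (\<bar>d k\<bar> / t) powr p \<le> t powr p * (p / q * (\<bar>d k\<bar> powr q / t powr q) + (1 - p / q))"
          by (intro mult_left_mono) auto
        then show ?thesis using t by (simp add: powr_divide)
      qed (use p in simp)
    qed
    also have "\<dots> = t powr p * (p / q * (S / t powr q) + real n * (1 - p / q))"
    proof -
      have "(\<Sum>k<n. \<bar>d k\<bar> powr q / t powr q) = S / t powr q" by (simp add: S_def sum_divide_distrib)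
      then show ?thesis by (simp only: sum_distrib_left[symmetric] sum.distrib) simp
    qed
    also have "\<dots> = t powr p * n"
      using t False n p by (simp add: field_simps)
    finally have "(\<Sum>k<n. \<bar>d k\<bar> powr p) powr (1 / p) \<le> (t powr p * n) powr (1 / p)"
      using p by (intro powr_mono2) (auto simp: sum_nonneg)
    also have "\<dots> = t * n powr (1 / p)" using t p by (simp add: powr_mult powr_powr)
    also have "\<dots> = real n powr (1 / p - 1 / q) * S powr (1 / q)"
      using n S0 by (simp add: t_def powr_divide powr_diff)
    finally show ?thesis by (simp add: S_def)
  qed
qed

lemma lp_norm_le_sum:
  fixes d :: "nat \<Rightarrow> real"
  assumes p: "1 \<le> p" and d: "\<And>k. k < n \<Longrightarrow> 0 \<le> d k"
  shows "(\<Sum>k<n. \<bar>d k\<bar> powr p) powr (1 / p) \<le> (\<Sum>k<n. d k)"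
proof -
  define S where "S = (\<Sum>k<n. d k)"
  have S0: "0 \<le> S" unfolding S_def using d by (intro sum_nonneg) auto
  have "(\<Sum>k<n. \<bar>d k\<bar> powr p) \<le> (\<Sum>k<n. d k * S powr (p - 1))"
  proof (rule sum_mono)
    fix k assume k: "k \<in> {..<n}"
    show "\<bar>d k\<bar> powr p \<le> d k * S powr (p - 1)"
    proof (cases "d k = 0")
      case False
      then have d0: "0 < d k" using d[of k] k by force
      have "d k \<le> S" unfolding S_def using d k by (intro member_le_sum) auto
      then have "d k powr 1 * d k powr (p - 1) \<le> d k * S powr (p - 1)"
        using d0 p by (simp add: powr_mono2)
      then show ?thesis using d0 by (simp only: powr_add[symmetric]) simp
    qed simp
  qed
  also have "\<dots> = S * S powr (p - 1)" by (simp add: S_def sum_distrib_right)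
  also have "\<dots> = S powr p"
    using S0 by (cases "S = 0") (simp_all add: powr_mult_base)
  finally have "(\<Sum>k<n. \<bar>d k\<bar> powr p) powr (1 / p) \<le> (S powr p) powr (1 / p)"
    using p by (intro powr_mono2) (auto simp: sum_nonneg)
  also have "\<dots> = S" using p S0 by (simp add: powr_powr)
  finally show ?thesis by (simp add: S_def)
qed

section \<open>Diagonalisation of self-adjoint matrices\<close>

lemma mat_adjoint_index:
  fixes A :: "complex mat"
  assumes "A \<in> carrier_mat m n" "i < n" "j < m"
  shows "mat_adjoint A $$ (i, j) = cnj (A $$ (j, i))"
  using assms unfolding mat_adjoint_def by (simp add: mat_of_rows_index)

lemma mat_mult_index:
  fixes A B :: "complex mat"
  assumes "A \<in> carrier_mat m n" "B \<in> carrier_mat n r" "i < m" "j < r"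
  shows "(A * B) $$ (i, j) = (\<Sum>k<n. A $$ (i, k) * B $$ (k, j))"
  using assms by (simp add: scalar_prod_def atLeast0LessThan)

lemma mat_adjoint_mult:
  fixes A B :: "complex mat"
  assumes A: "A \<in> carrier_mat m n" and B: "B \<in> carrier_mat n r"
  shows "mat_adjoint (A * B) = mat_adjoint B * mat_adjoint A"
proof (rule eq_matI)
  note c = mat_adjoint_carrier[OF A] mat_adjoint_carrier[OF B] mult_carrier_mat[OF A B]
    mat_adjoint_carrier[OF mult_carrier_mat[OF A B]]
  show "dim_row (mat_adjoint (A * B)) = dim_row (mat_adjoint B * mat_adjoint A)"
    "dim_col (mat_adjoint (A * B)) = dim_col (mat_adjoint B * mat_adjoint A)"
    using c by auto
  fix i j assume "i < dim_row (mat_adjoint B * mat_adjoint A)" "j < dim_col (mat_adjoint B * mat_adjoint A)"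
  then have ij: "i < r" "j < m" using c by auto
  show "mat_adjoint (A * B) $$ (i, j) = (mat_adjoint B * mat_adjoint A) $$ (i, j)"
    using ij by (simp add: mat_adjoint_index[OF c(3)] mat_mult_index[OF A B] mat_mult_index[OF c(2) c(1)]
        mat_adjoint_index[OF A] mat_adjoint_index[OF B] mult.commute del: index_mult_mat)
qed

lemma mat_adjoint_adjoint:
  fixes A :: "complex mat"
  assumes A: "A \<in> carrier_mat m n"
  shows "mat_adjoint (mat_adjoint A) = A"
proof (rule eq_matI)
  note c = mat_adjoint_carrier[OF A] mat_adjoint_carrier[OF mat_adjoint_carrier[OF A]]
  show "dim_row (mat_adjoint (mat_adjoint A)) = dim_row A" "dim_col (mat_adjoint (mat_adjoint A)) = dim_col A"
    using c A by auto
  fix i j assume "i < dim_row A" "j < dim_col A"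
  then show "mat_adjoint (mat_adjoint A) $$ (i, j) = A $$ (i, j)"
    using A by (simp add: mat_adjoint_index[OF c(1)] mat_adjoint_index[OF A])
qed

lemma unitary_matsI:
  assumes U: "U \<in> carrier_mat n n"
    and o: "\<And>k l. k < n \<Longrightarrow> l < n \<Longrightarrow> (\<Sum>i<n. cnj (U $$ (i, k)) * U $$ (i, l)) = (if k = l then 1 else 0)"
  shows "U \<in> unitary_mats n"
proof -
  note c = mat_adjoint_carrier[OF U]
  have 1: "mat_adjoint U * U = 1\<^sub>m n"
  proof (rule eq_matI)
    fix i j assume "i < dim_row (1\<^sub>m n :: complex mat)" "j < dim_col (1\<^sub>m n :: complex mat)"
    then have ij: "i < n" "j < n" by auto
    then show "(mat_adjoint U * U) $$ (i, j) = 1\<^sub>m n $$ (i, j)"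
      by (simp add: mat_mult_index[OF c U] mat_adjoint_index[OF U] o del: index_mult_mat)
  qed (use c U in auto)
  then show ?thesis
    using mat_mult_left_right_inverse[OF c U 1] U by (simp add: unitary_mats_def)
qed

lemma unitary_mats_carrier: "U \<in> unitary_mats n \<Longrightarrow> U \<in> carrier_mat n n"
  by (simp add: unitary_mats_def)

lemma unitary_mats_cols:
  assumes "U \<in> unitary_mats n" "k < n" "l < n"
  shows "(\<Sum>i<n. cnj (U $$ (i, k)) * U $$ (i, l)) = (if k = l then 1 else 0)"
proof -
  have U: "U \<in> carrier_mat n n" "mat_adjoint U * U = 1\<^sub>m n" using assms by (auto simp: unitary_mats_def)
  have "(mat_adjoint U * U) $$ (k, l) = 1\<^sub>m n $$ (k, l)" using U by simp
  then show ?thesis using assms(2,3)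
    by (simp add: mat_mult_index[OF mat_adjoint_carrier[OF U(1)] U(1)] mat_adjoint_index[OF U(1)] del: index_mult_mat(1))
qed

lemma unitary_mats_rows:
  assumes "U \<in> unitary_mats n" "i < n" "j < n"
  shows "(\<Sum>k<n. U $$ (i, k) * cnj (U $$ (j, k))) = (if i = j then 1 else 0)"
proof -
  have U: "U \<in> carrier_mat n n" "U * mat_adjoint U = 1\<^sub>m n" using assms by (auto simp: unitary_mats_def)
  have "(U * mat_adjoint U) $$ (i, j) = 1\<^sub>m n $$ (i, j)" using U by simp
  then show ?thesis using assms(2,3)
    by (simp add: mat_mult_index[OF U(1) mat_adjoint_carrier[OF U(1)]] mat_adjoint_index[OF U(1)] del: index_mult_mat(1))
qed

lemma unitary_mats_mult:
  assumes "U \<in> unitary_mats n" "V \<in> unitary_mats n"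
  shows "U * V \<in> unitary_mats n"
proof -
  have U: "U \<in> carrier_mat n n" "mat_adjoint U * U = 1\<^sub>m n"
    and V: "V \<in> carrier_mat n n" "mat_adjoint V * V = 1\<^sub>m n" using assms by (auto simp: unitary_mats_def)
  note c = mat_adjoint_carrier[OF U(1)] mat_adjoint_carrier[OF V(1)]
  have UV: "U * V \<in> carrier_mat n n" using U V by simp
  have "mat_adjoint (U * V) * (U * V) = mat_adjoint V * (mat_adjoint U * U) * V"
    unfolding mat_adjoint_mult[OF U(1) V(1)] using U(1) V(1) c
    by (simp add: assoc_mult_mat[of _ n n _ n _ n] mult_carrier_mat[of _ n n _ n])
  also have "\<dots> = 1\<^sub>m n" unfolding U(2) using V c by simp
  finally have 1: "mat_adjoint (U * V) * (U * V) = 1\<^sub>m n" .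
  then show ?thesis
    using mat_mult_left_right_inverse[OF mat_adjoint_carrier[OF UV] UV 1] UV by (simp add: unitary_mats_def)
qed

text \<open>Gram-Schmidt applied to a basis that starts with \<open>v\<close>, followed by normalisation of the columns.\<close>

lemma unitary_first_column:
  assumes v: "v \<in> carrier_vec n" "v \<noteq> 0\<^sub>v n"
  obtains W and c :: complex where "W \<in> unitary_mats n" "col W 0 = c \<cdot>\<^sub>v v" "0 < n"
proof -
  interpret cof_vec_space n "TYPE(complex)" .
  define b where "b = basis_completion v"
  define ws where "ws = gram_schmidt n b"
  have n: "n \<noteq> 0" using v by (auto intro: eq_vecI)
  from basis_completion[OF v, folded b_def]
  have dist_b: "distinct b" and indep: "\<not> lin_dep (set b)" and b: "set b \<subseteq> carrier_vec n"
    and hdb: "hd b = v" and len_b: "length b = n" by auto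
  from gram_schmidt_result[OF b dist_b indep refl, folded ws_def]
  have ws: "set ws \<subseteq> carrier_vec n" "corthogonal ws" "length ws = n" by (auto simp: len_b)
  from hdb len_b n obtain vs where bv: "b = v # vs" by (cases b) auto
  have hdws: "ws ! 0 = v"
    using gram_schmidt_hd[OF v(1), of vs] ws n by (simp add: ws_def bv hd_conv_nth[symmetric] flip: length_greater_0_conv)
  define x where "x i j = vec_index (ws ! j) i" for i j
  have wc: "ws ! j \<in> carrier_vec n" if "j < n" for j using ws that by (metis nth_mem subsetD)
  have orth: "(\<Sum>i<n. cnj (x i k) * x i l) = 0 \<longleftrightarrow> k \<noteq> l" if "k < n" "l < n" for k l
  proof -
    have "ws ! l \<bullet>c ws ! k = (\<Sum>i<n. cnj (x i k) * x i l)"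
      using wc[OF that(1)] wc[OF that(2)]
      by (simp add: scalar_prod_def x_def atLeast0LessThan mult.commute)
    then show ?thesis using corthogonalD[OF ws(2), of l k] that ws by auto
  qed
  define s where "s k = sqrt (\<Sum>i<n. (cmod (x i k))\<^sup>2)" for k
  have s2: "(\<Sum>i<n. cnj (x i k) * x i k) = complex_of_real (s k * s k)" for k
    by (simp add: s_def sum_nonneg mult.commute[of "cnj _"] complex_norm_square[symmetric] del: of_real_power)
  have s0: "s k \<noteq> 0" if "k < n" for k
  proof
    assume "s k = 0"
    then have "(\<Sum>i<n. cnj (x i k) * x i k) = 0" unfolding s2 by simp
    then show False using orth[OF that that] by simp
  qed
  define W where "W = Matrix.mat n n (\<lambda>(i, k). x i k / complex_of_real (s k))"
  have "W \<in> unitary_mats n"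
  proof (rule unitary_matsI)
    fix k l assume kl: "k < n" "l < n"
    have "(\<Sum>i<n. cnj (W $$ (i, k)) * W $$ (i, l)) = (\<Sum>i<n. cnj (x i k) * x i l) / (s k * s l)"
      using kl by (simp add: W_def sum_divide_distrib)
    also have "\<dots> = (if k = l then 1 else 0)"
      using orth[OF kl] s2[of k] s0[OF kl(1)] by (cases "k = l") auto
    finally show "(\<Sum>i<n. cnj (W $$ (i, k)) * W $$ (i, l)) = (if k = l then 1 else 0)" .
  qed (simp add: W_def)
  moreover have "col W 0 = (1 / complex_of_real (s 0)) \<cdot>\<^sub>v v"
    using n v by (intro eq_vecI) (auto simp: W_def x_def hdws)
  ultimately show ?thesis using that n by blast
qed

definition spec :: "complex mat \<Rightarrow> (nat \<Rightarrow> real) \<Rightarrow> complex mat" where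
  "spec U d = U * mat_diag (dim_row U) (\<lambda>i. complex_of_real (d i)) * mat_adjoint U"

lemma spec_carrier: "U \<in> carrier_mat n n \<Longrightarrow> spec U d \<in> carrier_mat n n"
  unfolding spec_def using mat_adjoint_carrier[of U n n] by auto

lemma spec_index:
  assumes U: "U \<in> carrier_mat n n" and ij: "i < n" "j < n"
  shows "spec U d $$ (i, j) = (\<Sum>k<n. d k * U $$ (i, k) * cnj (U $$ (j, k)))"
proof -
  have n: "dim_row U = n" using U by simp
  have c: "U * mat_diag n (\<lambda>i. complex_of_real (d i)) \<in> carrier_mat n n" using U by simp
  show ?thesis
    unfolding spec_def n mat_mult_index[OF c mat_adjoint_carrier[OF U] ij]
    using ij U
    by (intro sum.cong refl) (simp add: mat_diag_mult_right[OF U] mat_adjoint_index[OF U])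
qed

lemma mat_adjoint_spec:
  assumes U: "U \<in> carrier_mat n n"
  shows "mat_adjoint (spec U d) = spec U d"
  using spec_carrier[OF U, of d] mat_adjoint_carrier[OF spec_carrier[OF U, of d]]
  by (intro eq_matI) (auto simp: mat_adjoint_index[OF spec_carrier[OF U]] spec_index[OF U] mult_ac)

text \<open>Induction by deflation: conjugation by a unitary matrix whose first column is an eigenvector
  makes the first column, and by symmetry the first row, vanish off the diagonal. The remaining
  block is again self-adjoint.\<close>

theorem hermitian_eq_spec:
  assumes "A \<in> carrier_mat n n" "mat_adjoint A = A"
  shows "\<exists>U d. U \<in> unitary_mats n \<and> A = spec U d"
  using assms
proof (induction n arbitrary: A)
  case 0
  have "1\<^sub>m 0 \<in> unitary_mats 0" by (rule unitary_matsI) auto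
  moreover have "A = spec (1\<^sub>m 0) (\<lambda>_. 0)"
    using 0 spec_carrier[of "1\<^sub>m 0" 0 "\<lambda>_. 0"] by (intro eq_matI) auto
  ultimately show ?case by blast
next
  case (Suc n)
  let ?N = "Suc n"
  note A = Suc.prems(1)
  obtain as where as: "char_poly A = (\<Prod>a\<leftarrow>as. [:- a, 1:])" "length as = ?N"
    using char_poly_factorized[OF A] by blast
  then obtain e as' where "as = e # as'" by (cases as) auto
  then have "eigenvalue A e" unfolding eigenvalue_root_char_poly[OF A] as(1) by simp
  then obtain v where v: "v \<in> carrier_vec ?N" "v \<noteq> 0\<^sub>v ?N" "A *\<^sub>v v = e \<cdot>\<^sub>v v"
    using A by (auto simp: eigenvalue_def eigenvector_def)
  obtain W c where W: "W \<in> unitary_mats ?N" "col W 0 = c \<cdot>\<^sub>v v"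
    using unitary_first_column[OF v(1,2)] by metis
  have Wc: "W \<in> carrier_mat ?N ?N" and WW: "mat_adjoint W * W = 1\<^sub>m ?N" "W * mat_adjoint W = 1\<^sub>m ?N"
    using W(1) by (auto simp: unitary_mats_def)
  note Wac = mat_adjoint_carrier[OF Wc]
  note mat_simps = assoc_mult_mat[of _ ?N ?N _ ?N _ ?N] mult_carrier_mat[of _ ?N ?N _ ?N]
  define B where "B = mat_adjoint W * (A * W)"
  have AW: "A * W \<in> carrier_mat ?N ?N" using A Wc by simp
  have Bc: "B \<in> carrier_mat ?N ?N" unfolding B_def using Wac AW by simp
  have Bh: "mat_adjoint B = B"
    unfolding B_def mat_adjoint_mult[OF Wac AW] mat_adjoint_mult[OF A Wc] mat_adjoint_adjoint[OF Wc] Suc.prems(2)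
    using A Wc Wac by (simp add: mat_simps)
  have Bcnj: "B $$ (i, j) = cnj (B $$ (j, i))" if "i < ?N" "j < ?N" for i j
    using mat_adjoint_index[OF Bc that] unfolding Bh .
  have AW0: "(A * W) $$ (i, 0) = e * W $$ (i, 0)" if "i < ?N" for i
  proof -
    have "(A * W) $$ (i, 0) = vec_index (A *\<^sub>v col W 0) i" using that A Wc by simp
    also have "A *\<^sub>v col W 0 = e \<cdot>\<^sub>v col W 0"
      unfolding W(2) using v A by (simp add: mult_mat_vec smult_smult_assoc mult.commute)
    finally show ?thesis using that Wc by simp
  qed
  have B0: "B $$ (i, 0) = (if i = 0 then e else 0)" if "i < ?N" for i
  proof -
    have "B $$ (i, 0) = (\<Sum>k<?N. cnj (W $$ (k, i)) * (e * W $$ (k, 0)))"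
      unfolding B_def mat_mult_index[OF Wac AW that zero_less_Suc]
      by (intro sum.cong refl) (simp add: mat_adjoint_index[OF Wc] that AW0 del: index_mult_mat)
    also have "\<dots> = e * (\<Sum>k<?N. cnj (W $$ (k, i)) * W $$ (k, 0))"
      unfolding sum_distrib_left by (intro sum.cong refl) (simp add: mult_ac)
    also have "\<dots> = (if i = 0 then e else 0)"
      unfolding unitary_mats_cols[OF W(1) that zero_less_Suc] by simp
    finally show ?thesis .
  qed
  have e: "e = complex_of_real (Re e)"
    using Bcnj[of 0 0] B0[of 0] by (simp add: complex_eq_iff)
  define A3 where "A3 = Matrix.mat n n (\<lambda>(i, j). B $$ (Suc i, Suc j))"
  have A3c: "A3 \<in> carrier_mat n n" by (simp add: A3_def)
  have "mat_adjoint A3 = A3"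
  proof (rule eq_matI)
    fix i j assume "i < dim_row A3" "j < dim_col A3"
    then have ij: "i < n" "j < n" using A3c by auto
    show "mat_adjoint A3 $$ (i, j) = A3 $$ (i, j)"
      unfolding mat_adjoint_index[OF A3c ij] using ij Bcnj[of "Suc i" "Suc j"] by (simp add: A3_def)
  qed (use A3c mat_adjoint_carrier[OF A3c] in auto)
  then obtain V d where V: "V \<in> unitary_mats n" "A3 = spec V d" using Suc.IH[OF A3c] by blast
  note Vc = unitary_mats_carrier[OF V(1)]
  define V' where "V' = Matrix.mat ?N ?N (\<lambda>(i, j). case i of 0 \<Rightarrow> (case j of 0 \<Rightarrow> 1 | Suc _ \<Rightarrow> 0)
      | Suc i' \<Rightarrow> (case j of 0 \<Rightarrow> 0 | Suc j' \<Rightarrow> V $$ (i', j')))"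
  define d' where "d' k = (case k of 0 \<Rightarrow> Re e | Suc k' \<Rightarrow> d k')" for k
  have V'c: "V' \<in> carrier_mat ?N ?N" by (simp add: V'_def)
  have V'u: "V' \<in> unitary_mats ?N"
  proof (rule unitary_matsI[OF V'c])
    fix k l assume kl: "k < ?N" "l < ?N"
    show "(\<Sum>i<?N. cnj (V' $$ (i, k)) * V' $$ (i, l)) = (if k = l then 1 else 0)"
      unfolding sum.lessThan_Suc_shift using kl unitary_mats_cols[OF V(1), of "k - 1" "l - 1"]
      by (auto simp: V'_def split: nat.split)
  qed
  have BV: "B = spec V' d'"
  proof (rule eq_matI)
    fix i j assume "i < dim_row (spec V' d')" "j < dim_col (spec V' d')"
    then have ij: "i < ?N" "j < ?N" using spec_carrier[OF V'c, of d'] by auto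
    have Bij: "B $$ (Suc i', Suc j') = (\<Sum>k<n. d k * V $$ (i', k) * cnj (V $$ (j', k)))" if "i' < n" "j' < n" for i' j'
    proof -
      have "B $$ (Suc i', Suc j') = spec V d $$ (i', j')"
        unfolding V(2)[symmetric] using that by (simp add: A3_def)
      then show ?thesis unfolding spec_index[OF Vc that] .
    qed
    show "B $$ (i, j) = spec V' d' $$ (i, j)"
      unfolding spec_index[OF V'c ij] sum.lessThan_Suc_shift
      using ij B0[of i] B0[of j] Bcnj[of 0 j] e Bij[of "i - 1" "j - 1"]
      by (auto simp: V'_def d'_def split: nat.split)
  qed (use Bc spec_carrier[OF V'c, of d'] in auto)
  have U: "W * V' \<in> unitary_mats ?N" by (rule unitary_mats_mult[OF W(1) V'u])
  have "A = W * B * mat_adjoint W"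
  proof -
    have "W * B * mat_adjoint W = (W * mat_adjoint W) * A * (W * mat_adjoint W)"
      unfolding B_def using A Wc Wac by (simp add: mat_simps)
    then show ?thesis unfolding WW using A by simp
  qed
  also have "\<dots> = spec (W * V') d'"
  proof -
    have dim: "dim_row (W * V') = ?N" "dim_row V' = ?N" using Wc V'c by auto
    show ?thesis
      unfolding BV spec_def dim mat_adjoint_mult[OF Wc V'c]
      using Wc V'c Wac mat_adjoint_carrier[OF V'c] mat_diag_dim[of ?N "\<lambda>i. complex_of_real (d' i)"]
      by (simp add: mat_simps)
  qed
  finally show ?case using U by blast
qed

lemma spec_mult_spec:
  assumes "U \<in> unitary_mats n"
  shows "spec U d * spec U e = spec U (\<lambda>i. d i * e i)"
proof -
  have U: "U \<in> carrier_mat n n" "mat_adjoint U * U = 1\<^sub>m n" using assms by (auto simp: unitary_mats_def)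
  have n: "dim_row U = n" using U by simp
  let ?D = "\<lambda>d. mat_diag n (\<lambda>i. complex_of_real (d i))"
  note mat_simps = assoc_mult_mat[of _ n n _ n _ n] mult_carrier_mat[of _ n n _ n]
  note c = U(1) mat_adjoint_carrier[OF U(1)] mat_diag_dim[of n "\<lambda>i. complex_of_real (d i)"] mat_diag_dim[of n "\<lambda>i. complex_of_real (e i)"]
  have "spec U d * spec U e = U * ?D d * (mat_adjoint U * U) * ?D e * mat_adjoint U"
    unfolding spec_def n using c by (simp add: mat_simps)
  also have "\<dots> = U * (?D d * ?D e) * mat_adjoint U"
    unfolding U(2) using c by (simp add: mat_simps left_mult_one_mat[of _ n n] del: mat_diag_diag)
  also have "\<dots> = spec U (\<lambda>i. d i * e i)" unfolding spec_def n by simp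
  finally show ?thesis .
qed

lemma mat_trace_spec:
  assumes "U \<in> unitary_mats n"
  shows "mat_trace (spec U d) = complex_of_real (\<Sum>k<n. d k)"
proof -
  note U = unitary_mats_carrier[OF assms]
  have n: "dim_row (spec U d) = n" using spec_carrier[OF U, of d] by simp
  have "mat_trace (spec U d) = (\<Sum>i<n. \<Sum>k<n. d k * (cnj (U $$ (i, k)) * U $$ (i, k)))"
    unfolding mat_trace_def n by (intro sum.cong refl) (simp add: spec_index[OF U] mult_ac)
  also have "\<dots> = (\<Sum>k<n. d k * (\<Sum>i<n. cnj (U $$ (i, k)) * U $$ (i, k)))"
    unfolding sum_distrib_left by (rule sum.swap)
  also have "\<dots> = (\<Sum>k<n. complex_of_real (d k))"
    by (intro sum.cong refl) (simp add: unitary_mats_cols[OF assms])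
  finally show ?thesis by simp
qed

lemma schatten_norm_spec:
  assumes U: "U \<in> unitary_mats n"
  shows "schatten_norm p (spec U d) = (\<Sum>k<n. \<bar>d k\<bar> powr p) powr (1 / p)"
proof -
  note Uc = unitary_mats_carrier[OF U]
  have n: "dim_row U = n" using Uc by simp
  have mf: "mat_fun f (spec U d) = spec U (\<lambda>i. f (d i))" for f d
    unfolding spec_def n by (rule mat_fun_eq[OF U refl])
  have "mat_abs (spec U d) = spec U (\<lambda>i. \<bar>d i\<bar>)"
    unfolding mat_abs_def mat_adjoint_spec[OF Uc] spec_mult_spec[OF U] mf by simp
  then show ?thesis
    unfolding schatten_norm_def mf mat_trace_spec[OF U] by (simp add: mf mat_trace_spec[OF U])
qed

section \<open>Real coordinates on self-adjoint matrices\<close>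

definition sa :: "nat \<Rightarrow> complex mat set" where
  "sa n = {A \<in> carrier_mat n n. mat_adjoint A = A}"

abbreviation idx :: "nat \<Rightarrow> (nat \<times> nat) set" where
  "idx n \<equiv> {..<n} \<times> {..<n}"

text \<open>The coordinates in an orthonormal basis for the Hilbert-Schmidt inner product: the diagonal
  entries, \<open>sqrt 2\<close> times the real parts of the entries above the diagonal, and \<open>sqrt 2\<close> times the
  imaginary parts of the entries below it. The inverse map is \<open>herm\<close>.\<close>

definition coord :: "complex mat \<Rightarrow> nat \<times> nat \<Rightarrow> real" where
  "coord X k = Re ((if fst k = snd k then 1 else if fst k < snd k then sqrt 2 else - (sqrt 2 * \<i>)) * X $$ k)"

definition herm :: "nat \<Rightarrow> (nat \<times> nat \<Rightarrow> real) \<Rightarrow> complex mat" where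
  "herm n a = Matrix.mat n n (\<lambda>(i, j).
     if i = j then complex_of_real (a (i, i))
     else if i < j then Complex (a (i, j)) (- a (j, i)) / sqrt 2
     else Complex (a (j, i)) (a (i, j)) / sqrt 2)"

lemma saI:
  assumes "X \<in> carrier_mat n n" "\<And>i j. i < n \<Longrightarrow> j < n \<Longrightarrow> X $$ (i, j) = cnj (X $$ (j, i))"
  shows "X \<in> sa n"
proof -
  have "mat_adjoint X = X"
  proof (rule eq_matI)
    fix i j assume "i < dim_row X" "j < dim_col X"
    then have ij: "i < n" "j < n" using assms(1) by auto
    show "mat_adjoint X $$ (i, j) = X $$ (i, j)"
      unfolding mat_adjoint_index[OF assms(1) ij] by (rule assms(2)[OF ij, symmetric])
  qed (use assms(1) mat_adjoint_carrier[OF assms(1)] in auto)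
  then show ?thesis using assms(1) by (simp add: sa_def)
qed

lemma sa_carrier: "X \<in> sa n \<Longrightarrow> X \<in> carrier_mat n n"
  by (simp add: sa_def)

lemma sa_cnj: "X \<in> sa n \<Longrightarrow> i < n \<Longrightarrow> j < n \<Longrightarrow> cnj (X $$ (j, i)) = X $$ (i, j)"
  using mat_adjoint_index[of X n n i j] by (simp add: sa_def)

lemma sa_Re_Im:
  assumes "X \<in> sa n" "i < n" "j < n"
  shows "Re (X $$ (j, i)) = Re (X $$ (i, j))" "Im (X $$ (j, i)) = - Im (X $$ (i, j))"
  unfolding sa_cnj[OF assms, symmetric] by simp_all

lemma herm_sa: "herm n a \<in> sa n"
  by (rule saI) (auto simp: herm_def complex_eq_iff)

lemma coord_herm: "k \<in> idx n \<Longrightarrow> coord (herm n a) k = a k"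
  by (cases k) (auto simp: coord_def herm_def)

lemma herm_coord:
  assumes "X \<in> sa n"
  shows "herm n (coord X) = X"
proof (rule eq_matI)
  fix i j assume "i < dim_row X" "j < dim_col X"
  then have ij: "i < n" "j < n" using sa_carrier[OF assms] by auto
  show "herm n (coord X) $$ (i, j) = X $$ (i, j)"
    using ij sa_Re_Im[OF assms ij]
    by (cases i j rule: linorder_cases) (simp_all add: herm_def coord_def complex_eq_iff)
qed (use sa_carrier[OF assms] in \<open>auto simp: herm_def\<close>)

lemma herm_cong: "(\<And>k. k \<in> idx n \<Longrightarrow> a k = b k) \<Longrightarrow> herm n a = herm n b"
  by (intro eq_matI) (auto simp: herm_def)

lemma herm_add: "herm n a + herm n b = herm n (\<lambda>k. a k + b k)"
  by (intro eq_matI) (auto simp: herm_def complex_eq_iff add_divide_distrib diff_divide_distrib)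

lemma herm_smult: "complex_of_real c \<cdot>\<^sub>m herm n a = herm n (\<lambda>k. c * a k)"
  by (intro eq_matI) (auto simp: herm_def complex_eq_iff)

text \<open>On both sides the terms of \<open>(i, j)\<close> and \<open>(j, i)\<close> have the same sum.\<close>

lemma sum_coord_mult:
  assumes X: "X \<in> sa n" and Y: "Y \<in> sa n"
  shows "(\<Sum>k\<in>idx n. coord X k * coord Y k) = (\<Sum>i<n. \<Sum>j<n. Re (X $$ (i, j) * cnj (Y $$ (i, j))))"
proof -
  define F where "F i j = coord X (i, j) * coord Y (i, j)" for i j
  define G where "G i j = Re (X $$ (i, j) * cnj (Y $$ (i, j)))" for i j
  have s2: "sqrt 2 * (sqrt 2 * t) = 2 * t" for t :: real by (simp flip: mult.assoc)
  have FG: "F i j + F j i = G i j + G j i" if "i < n" "j < n" for i j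
    using sa_Re_Im[OF X that] sa_Re_Im[OF Y that]
    by (cases i j rule: linorder_cases) (simp_all add: F_def G_def coord_def algebra_simps s2)
  have sw: "(\<Sum>i<n. \<Sum>j<n. H j i) = (\<Sum>i<n. \<Sum>j<n. H i j)" for H :: "nat \<Rightarrow> nat \<Rightarrow> real"
    by (rule sum.swap)
  have "2 * (\<Sum>i<n. \<Sum>j<n. F i j) = (\<Sum>i<n. \<Sum>j<n. F i j + F j i)"
    by (simp add: sum.distrib sw[of F])
  also have "\<dots> = (\<Sum>i<n. \<Sum>j<n. G i j + G j i)" by (intro sum.cong refl FG) auto
  also have "\<dots> = 2 * (\<Sum>i<n. \<Sum>j<n. G i j)" by (simp add: sum.distrib sw[of G])
  finally show ?thesis by (simp add: F_def G_def sum.cartesian_product)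
qed

lemma unitary_parseval:
  assumes "U \<in> unitary_mats n"
  shows "(\<Sum>k<n. (cmod (\<Sum>i<n. cnj (v i) * U $$ (i, k)))\<^sup>2) = (\<Sum>i<n. (cmod (v i))\<^sup>2)"
proof -
  have "complex_of_real (\<Sum>k<n. (cmod (\<Sum>i<n. cnj (v i) * U $$ (i, k)))\<^sup>2)
      = (\<Sum>k<n. (\<Sum>i<n. cnj (v i) * U $$ (i, k)) * (\<Sum>j<n. v j * cnj (U $$ (j, k))))"
    by (simp add: complex_norm_square del: of_real_power)
  also have "\<dots> = (\<Sum>k<n. \<Sum>i<n. \<Sum>j<n. cnj (v i) * v j * (U $$ (i, k) * cnj (U $$ (j, k))))"
    unfolding sum_product by (intro sum.cong refl) (simp add: mult_ac)
  also have "\<dots> = (\<Sum>i<n. \<Sum>k<n. \<Sum>j<n. cnj (v i) * v j * (U $$ (i, k) * cnj (U $$ (j, k))))"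
    by (rule sum.swap)
  also have "\<dots> = (\<Sum>i<n. \<Sum>j<n. cnj (v i) * v j * (\<Sum>k<n. U $$ (i, k) * cnj (U $$ (j, k))))"
    unfolding sum_distrib_left by (rule sum.cong[OF refl], rule sum.swap)
  also have "\<dots> = (\<Sum>i<n. \<Sum>j<n. if i = j then cnj (v i) * v j else 0)"
    by (intro sum.cong refl) (simp add: unitary_mats_rows[OF assms])
  also have "\<dots> = (\<Sum>i<n. cnj (v i) * v i)" by simp
  also have "\<dots> = complex_of_real (\<Sum>i<n. (cmod (v i))\<^sup>2)"
    by (simp add: complex_norm_square mult.commute del: of_real_power)
  finally show ?thesis by (simp only: of_real_eq_iff)
qed

text \<open>The squared moduli of the inner products of the columns of two unitary matrices; by Parseval's
  identity they form a doubly stochastic matrix.\<close>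

definition overlap :: "nat \<Rightarrow> complex mat \<Rightarrow> complex mat \<Rightarrow> nat \<Rightarrow> nat \<Rightarrow> real" where
  "overlap n U V k l = (cmod (\<Sum>i<n. cnj (V $$ (i, l)) * U $$ (i, k)))\<^sup>2"

lemma unitary_cols_norm:
  assumes "U \<in> unitary_mats n" "k < n"
  shows "(\<Sum>i<n. (cmod (U $$ (i, k)))\<^sup>2) = 1"
proof -
  have "complex_of_real (\<Sum>i<n. (cmod (U $$ (i, k)))\<^sup>2) = (\<Sum>i<n. cnj (U $$ (i, k)) * U $$ (i, k))"
    by (simp add: complex_norm_square mult.commute del: of_real_power)
  also have "\<dots> = complex_of_real 1" using unitary_mats_cols[OF assms assms(2)] by simp
  finally show ?thesis by (simp only: of_real_eq_iff)
qed

lemma sum_overlap_left: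
  assumes "U \<in> unitary_mats n" "V \<in> unitary_mats n" "l < n"
  shows "(\<Sum>k<n. overlap n U V k l) = 1"
  unfolding overlap_def unitary_parseval[OF assms(1)] by (rule unitary_cols_norm[OF assms(2,3)])

lemma sum_overlap_right:
  assumes "U \<in> unitary_mats n" "V \<in> unitary_mats n" "k < n"
  shows "(\<Sum>l<n. overlap n U V k l) = 1"
proof -
  have "overlap n U V k l = (cmod (\<Sum>i<n. cnj (U $$ (i, k)) * V $$ (i, l)))\<^sup>2" for l
  proof -
    have "(\<Sum>i<n. cnj (U $$ (i, k)) * V $$ (i, l)) = cnj (\<Sum>i<n. cnj (V $$ (i, l)) * U $$ (i, k))"
      by (simp add: mult.commute)
    then show ?thesis unfolding overlap_def by (simp only: complex_mod_cnj)
  qed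
  then show ?thesis using unitary_parseval[OF assms(2), of "\<lambda>i. U $$ (i, k)"] unitary_cols_norm[OF assms(1,3)] by simp
qed

lemma overlap_self:
  assumes "U \<in> unitary_mats n" "k < n" "l < n"
  shows "overlap n U U k l = (if k = l then 1 else 0)"
  unfolding overlap_def unitary_mats_cols[OF assms(1,3,2)] by simp

lemma spec_sa: "U \<in> carrier_mat n n \<Longrightarrow> spec U d \<in> sa n"
  by (simp add: sa_def spec_carrier mat_adjoint_spec)

lemma sa_eq_spec: "X \<in> sa n \<Longrightarrow> \<exists>U d. U \<in> unitary_mats n \<and> X = spec U d"
  by (rule hermitian_eq_spec) (auto simp: sa_def)

text \<open>The Hilbert-Schmidt inner product expressed through eigenvalues and eigenvectors.\<close>

lemma sum_coord_spec:
  assumes U: "U \<in> unitary_mats n" and V: "V \<in> unitary_mats n"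
  shows "(\<Sum>m\<in>idx n. coord (spec U d) m * coord (spec V e) m) = (\<Sum>k<n. \<Sum>l<n. d k * e l * overlap n U V k l)"
proof -
  note c = unitary_mats_carrier[OF U] unitary_mats_carrier[OF V]
  have ov: "complex_of_real (overlap n U V k l)
      = (\<Sum>i<n. \<Sum>j<n. (U $$ (i, k) * cnj (U $$ (j, k))) * (cnj (V $$ (i, l)) * V $$ (j, l)))" for k l
    unfolding overlap_def complex_norm_square
    by (simp add: sum_product mult_ac)
  have "(\<Sum>i<n. \<Sum>j<n. spec U d $$ (i, j) * cnj (spec V e $$ (i, j)))
      = (\<Sum>i<n. \<Sum>j<n. \<Sum>k<n. \<Sum>l<n. d k * e l * ((U $$ (i, k) * cnj (U $$ (j, k))) * (cnj (V $$ (i, l)) * V $$ (j, l))))"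
    by (intro sum.cong refl) (simp add: spec_index[OF c(1)] spec_index[OF c(2)] sum_product mult_ac)
  also have "\<dots> = (\<Sum>i<n. \<Sum>k<n. \<Sum>l<n. \<Sum>j<n. d k * e l * ((U $$ (i, k) * cnj (U $$ (j, k))) * (cnj (V $$ (i, l)) * V $$ (j, l))))"
    by (rule sum.cong[OF refl], rule trans[OF sum.swap], rule sum.cong[OF refl], rule sum.swap)
  also have "\<dots> = (\<Sum>k<n. \<Sum>l<n. \<Sum>i<n. \<Sum>j<n. d k * e l * ((U $$ (i, k) * cnj (U $$ (j, k))) * (cnj (V $$ (i, l)) * V $$ (j, l))))"
    by (rule trans[OF sum.swap], rule sum.cong[OF refl], rule sum.swap)
  also have "\<dots> = (\<Sum>k<n. \<Sum>l<n. complex_of_real (d k * e l * overlap n U V k l))"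
    by (simp add: ov sum_distrib_left)
  also have "\<dots> = complex_of_real (\<Sum>k<n. \<Sum>l<n. d k * e l * overlap n U V k l)" by simp
  finally have "Re (\<Sum>i<n. \<Sum>j<n. spec U d $$ (i, j) * cnj (spec V e $$ (i, j))) = (\<Sum>k<n. \<Sum>l<n. d k * e l * overlap n U V k l)"
    by (simp only: Re_complex_of_real)
  then show ?thesis
    unfolding sum_coord_mult[OF spec_sa[OF c(1)] spec_sa[OF c(2)]] by simp
qed

lemma sum_coord_spec_same:
  assumes U: "U \<in> unitary_mats n"
  shows "(\<Sum>m\<in>idx n. coord (spec U d) m * coord (spec U e) m) = (\<Sum>k<n. d k * e k)"
proof -
  have "(\<Sum>k<n. \<Sum>l<n. d k * e l * overlap n U U k l) = (\<Sum>k<n. \<Sum>l<n. if k = l then d k * e l else 0)"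
    by (intro sum.cong refl) (simp add: overlap_self[OF U])
  then show ?thesis unfolding sum_coord_spec[OF U U] by simp
qed

lemma spec_smult:
  assumes U: "U \<in> carrier_mat n n"
  shows "complex_of_real c \<cdot>\<^sub>m spec U d = spec U (\<lambda>i. c * d i)"
  using spec_carrier[OF U, of d] spec_carrier[OF U, of "\<lambda>i. c * d i"]
  by (intro eq_matI) (auto simp: spec_index[OF U] sum_distrib_left mult.assoc)

lemma schatten_norm_smult:
  assumes "X \<in> sa n" "0 < p"
  shows "schatten_norm p (complex_of_real c \<cdot>\<^sub>m X) = \<bar>c\<bar> * schatten_norm p X"
proof -
  obtain U d where U: "U \<in> unitary_mats n" "X = spec U d" using sa_eq_spec[OF assms(1)] by blast
  have "(\<Sum>k<n. \<bar>c * d k\<bar> powr p) = \<bar>c\<bar> powr p * (\<Sum>k<n. \<bar>d k\<bar> powr p)"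
    by (simp add: abs_mult powr_mult sum_distrib_left)
  then show ?thesis
    unfolding U(2) spec_smult[OF unitary_mats_carrier[OF U(1)]] schatten_norm_spec[OF U(1)]
    using assms(2) by (simp add: powr_mult powr_powr sum_nonneg)
qed

lemma schatten_norm_nonneg: "0 \<le> schatten_norm p X"
  by (simp add: schatten_norm_def)

lemma schatten_norm_le_hs:
  assumes X: "X \<in> sa n" and p: "1 \<le> p" "p \<le> 2" and n: "0 < n"
  shows "schatten_norm p X \<le> real n powr (1 / p - 1 / 2) * sqrt (\<Sum>k\<in>idx n. (coord X k)\<^sup>2)"
proof -
  obtain U d where U: "U \<in> unitary_mats n" "X = spec U d" using sa_eq_spec[OF X] by blast
  have "(\<Sum>k\<in>idx n. (coord X k)\<^sup>2) = (\<Sum>k<n. (d k)\<^sup>2)"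
    using sum_coord_spec_same[OF U(1), of d d] unfolding U(2) by (simp add: power2_eq_square)
  moreover have "\<bar>d k\<bar> powr 2 = (d k)\<^sup>2" for k
    by (cases "d k = 0") (simp_all add: powr_numeral)
  ultimately show ?thesis
    using lp_norm_le_lq_norm[of p 2 n d] p n unfolding U(2) schatten_norm_spec[OF U(1)]
    by (simp add: powr_half_sqrt sum_nonneg)
qed

abbreviation cidx :: "nat \<Rightarrow> (nat \<times> bool) set" where
  "cidx n \<equiv> {..<n} \<times> UNIV"

text \<open>A complex vector is encoded by its \<open>2n\<close> real coordinates, since the nets and the linear forms are
  real.\<close>

definition cvec :: "(nat \<times> bool \<Rightarrow> real) \<Rightarrow> nat \<Rightarrow> complex" where
  "cvec x i = Complex (x (i, False)) (x (i, True))"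

text \<open>The real symmetric bilinear map whose diagonal is \<open>v \<mapsto> vv\<^sup>*\<close>.\<close>

definition symprod :: "nat \<Rightarrow> (nat \<times> bool \<Rightarrow> real) \<Rightarrow> (nat \<times> bool \<Rightarrow> real) \<Rightarrow> complex mat" where
  "symprod n x y = Matrix.mat n n (\<lambda>(i, j). (cvec x i * cnj (cvec y j) + cvec y i * cnj (cvec x j)) / 2)"

lemma symprod_sa: "symprod n x y \<in> sa n"
  by (rule saI) (auto simp: symprod_def)

lemma symprod_commute: "symprod n x y = symprod n y x"
  by (simp add: symprod_def add.commute)

lemma sum_cidx: "(\<Sum>m\<in>cidx n. f m) = (\<Sum>i<n. f (i, False) + f (i, True))"
proof -
  have "(\<Sum>m\<in>cidx n. f m) = (\<Sum>i<n. \<Sum>b\<in>UNIV. f (i, b))" by (simp add: sum.cartesian_product)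
  then show ?thesis by (simp add: UNIV_bool add.commute)
qed

lemma sum_cmod_cvec: "(\<Sum>i<n. (cmod (cvec x i))\<^sup>2) = (sumsq (cidx n) x)"
  unfolding sum_cidx by (intro sum.cong refl) (simp add: cvec_def cmod_power2)

lemma sum_coord_symprod_le:
  "(\<Sum>k\<in>idx n. (coord (symprod n x y) k)\<^sup>2) \<le> (sumsq (cidx n) x) * (sumsq (cidx n) y)"
proof -
  have "(\<Sum>k\<in>idx n. (coord (symprod n x y) k)\<^sup>2) = (\<Sum>i<n. \<Sum>j<n. (cmod (symprod n x y $$ (i, j)))\<^sup>2)"
    unfolding power2_eq_square sum_coord_mult[OF symprod_sa symprod_sa]
    by (intro sum.cong refl) (simp add: cmod_power2 flip: power2_eq_square)
  also have "\<dots> \<le> (\<Sum>i<n. \<Sum>j<n. ((cmod (cvec x i))\<^sup>2 * (cmod (cvec y j))\<^sup>2 + (cmod (cvec y i))\<^sup>2 * (cmod (cvec x j))\<^sup>2) / 2)"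
  proof (intro sum_mono)
    fix i j assume ij: "i \<in> {..<n}" "j \<in> {..<n}"
    define a where "a = cmod (cvec x i) * cmod (cvec y j)"
    define b where "b = cmod (cvec y i) * cmod (cvec x j)"
    have "cmod (symprod n x y $$ (i, j)) \<le> (a + b) / 2"
      using norm_triangle_ineq[of "cvec x i * cnj (cvec y j)" "cvec y i * cnj (cvec x j)"] ij
      by (simp add: symprod_def norm_divide norm_mult a_def b_def)
    then have "(cmod (symprod n x y $$ (i, j)))\<^sup>2 \<le> ((a + b) / 2)\<^sup>2" by (intro power_mono) auto
    also have "\<dots> \<le> (a\<^sup>2 + b\<^sup>2) / 2"
      using zero_le_power2[of "a - b"] by (simp add: power2_eq_square field_simps)
    finally show "(cmod (symprod n x y $$ (i, j)))\<^sup>2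
        \<le> ((cmod (cvec x i))\<^sup>2 * (cmod (cvec y j))\<^sup>2 + (cmod (cvec y i))\<^sup>2 * (cmod (cvec x j))\<^sup>2) / 2"
      by (simp add: a_def b_def power_mult_distrib)
  qed
  also have "\<dots> = ((\<Sum>i<n. (cmod (cvec x i))\<^sup>2) * (\<Sum>j<n. (cmod (cvec y j))\<^sup>2)
      + (\<Sum>i<n. (cmod (cvec y i))\<^sup>2) * (\<Sum>j<n. (cmod (cvec x j))\<^sup>2)) / 2"
    by (simp only: sum_product sum.distrib[symmetric] sum_divide_distrib[symmetric])
  also have "\<dots> = (sumsq (cidx n) x) * (sumsq (cidx n) y)"
    unfolding sum_cmod_cvec by simp
  finally show ?thesis .
qed

lemma linear_form_coord_symprod:
  assumes "k \<in> idx n"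
  shows "linear_form (cidx n) (\<lambda>x. coord (symprod n x y) k)"
proof -
  obtain i j where k: "k = (i, j)" "i < n" "j < n" using assms by auto
  define g where "g = (if i = j then 1 else if i < j then sqrt 2 else - (sqrt 2 * \<i>))"
  define a where "a = g * cnj (cvec y j) / 2"
  define b where "b = g * cvec y i / 2"
  have "coord (symprod n x y) k
      = (x (i, False) * Re a + x (i, True) * (- Im a)) + (x (j, False) * Re b + x (j, True) * Im b)" for x
  proof -
    have "coord (symprod n x y) k = Re (g * ((cvec x i * cnj (cvec y j) + cvec y i * cnj (cvec x j)) / 2))"
      using k unfolding coord_def symprod_def g_def by simp
    also have "g * ((cvec x i * cnj (cvec y j) + cvec y i * cnj (cvec x j)) / 2) = a * cvec x i + b * cnj (cvec x j)"
      by (simp add: a_def b_def field_simps)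
    finally show ?thesis by (simp add: cvec_def algebra_simps)
  qed
  then have "(\<lambda>x. coord (symprod n x y) k) = (\<lambda>x.
      (x (i, False) * Re a + x (i, True) * (- Im a)) + (x (j, False) * Re b + x (j, True) * Im b))"
    by (rule ext)
  then show ?thesis
    using k by (simp only:) (intro linear_form_add linear_form_coord; simp)
qed

definition rvec :: "complex mat \<Rightarrow> nat \<Rightarrow> nat \<times> bool \<Rightarrow> real" where
  "rvec U k = (\<lambda>(i, b). if b then Im (U $$ (i, k)) else Re (U $$ (i, k)))"

abbreviation eigproj :: "nat \<Rightarrow> complex mat \<Rightarrow> nat \<Rightarrow> complex mat" where
  "eigproj n U k \<equiv> symprod n (rvec U k) (rvec U k)"

lemma cvec_rvec: "cvec (rvec U k) i = U $$ (i, k)"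
  by (simp add: cvec_def rvec_def)

lemma sum_rvec_square: "U \<in> unitary_mats n \<Longrightarrow> k < n \<Longrightarrow> (\<Sum>m\<in>cidx n. (rvec U k m)\<^sup>2) = 1"
  unfolding sum_cmod_cvec[symmetric] cvec_rvec by (rule unitary_cols_norm)

lemma coord_spec:
  assumes U: "U \<in> carrier_mat n n" and m: "m \<in> idx n"
  shows "coord (spec U d) m = (\<Sum>k<n. d k * coord (eigproj n U k) m)"
proof -
  obtain i j where ij: "m = (i, j)" "i < n" "j < n" using m by auto
  have "spec U d $$ m = (\<Sum>k<n. complex_of_real (d k) * eigproj n U k $$ m)"
    using ij unfolding ij(1) spec_index[OF U ij(2,3)] by (intro sum.cong refl) (simp add: symprod_def cvec_rvec)
  then show ?thesis
    unfolding coord_def by (simp add: sum_distrib_left Re_sum[symmetric] del: Re_sum) (simp add: algebra_simps)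
qed

lemma spec_indicator:
  assumes "U \<in> carrier_mat n n" "k < n" "i \<in> {..<n}" "j \<in> {..<n}"
  shows "spec U (\<lambda>l. if l = k then 1 else 0) $$ (i, j) = U $$ (i, k) * cnj (U $$ (j, k))"
proof -
  have "spec U (\<lambda>l. if l = k then 1 else 0) $$ (i, j)
      = (\<Sum>l<n. if l = k then U $$ (i, l) * cnj (U $$ (j, l)) else 0)"
    using assms(3,4) by (subst spec_index[OF assms(1)]; (intro sum.cong refl)?) auto
  then show ?thesis using assms by simp
qed

text \<open>The eigenvalues of \<open>vv\<^sup>*\<close> are the squared moduli of the coordinates of \<open>v\<close> in an orthonormal basis
  of eigenvectors. They are nonnegative with sum \<open>\<parallel>v\<parallel>\<^sup>2\<close>, and the \<open>l\<^sub>p\<close> norm is at most the \<open>l\<^sub>1\<close> norm.\<close>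

lemma schatten_norm_symprod_le:
  assumes p: "1 \<le> p"
  shows "schatten_norm p (symprod n x x) \<le> (sumsq (cidx n) x)"
proof -
  obtain U d where U: "U \<in> unitary_mats n" and X: "symprod n x x = spec U d" using sa_eq_spec[OF symprod_sa] by blast
  note Uc = unitary_mats_carrier[OF U]
  have d: "d k = (cmod (\<Sum>i<n. cnj (cvec x i) * U $$ (i, k)))\<^sup>2" if k: "k < n" for k
  proof -
    have "d k = (\<Sum>m\<in>idx n. coord (spec U d) m * coord (spec U (\<lambda>l. if l = k then 1 else 0)) m)"
      unfolding sum_coord_spec_same[OF U] using k by (simp add: if_distrib cong: if_cong)
    also have "\<dots> = (\<Sum>i<n. \<Sum>j<n. Re (cvec x i * cnj (cvec x j) * cnj (U $$ (i, k)) * U $$ (j, k)))"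
      unfolding X[symmetric] sum_coord_mult[OF symprod_sa spec_sa[OF Uc]]
      using k by (intro sum.cong refl) (simp only: spec_indicator[OF Uc k], simp add: symprod_def mult_ac)
    also have "\<dots> = Re (\<Sum>i<n. \<Sum>j<n. cvec x i * cnj (cvec x j) * cnj (U $$ (i, k)) * U $$ (j, k))" by simp
    also have "(\<Sum>i<n. \<Sum>j<n. cvec x i * cnj (cvec x j) * cnj (U $$ (i, k)) * U $$ (j, k))
        = cnj (\<Sum>i<n. cnj (cvec x i) * U $$ (i, k)) * (\<Sum>i<n. cnj (cvec x i) * U $$ (i, k))"
      by (simp add: sum_product mult_ac)
    also have "\<dots> = complex_of_real ((cmod (\<Sum>i<n. cnj (cvec x i) * U $$ (i, k)))\<^sup>2)"
      by (simp add: complex_norm_square mult.commute del: of_real_power)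
    finally show ?thesis by (simp only: Re_complex_of_real)
  qed
  have "schatten_norm p (symprod n x x) \<le> (\<Sum>k<n. d k)"
    unfolding X schatten_norm_spec[OF U] using p by (rule lp_norm_le_sum) (simp add: d)
  also have "\<dots> = (\<Sum>k<n. (cmod (\<Sum>i<n. cnj (cvec x i) * U $$ (i, k)))\<^sup>2)"
    by (intro sum.cong refl) (simp add: d)
  also have "\<dots> = (sumsq (cidx n) x)" unfolding unitary_parseval[OF U] by (rule sum_cmod_cvec)
  finally show ?thesis .
qed

lemma young_powr:
  fixes a b p :: real
  assumes "0 \<le> a" "0 \<le> b" "1 \<le> p"
  shows "a * b powr (p - 1) \<le> a powr p / p + (1 - 1 / p) * b powr p"
proof (cases "a = 0 \<or> b = 0")
  case False
  have "(a powr p) powr (1 / p) * (b powr p) powr (1 - 1 / p) \<le> 1 / p * a powr p + (1 - 1 / p) * b powr p"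
    using False assms by (intro Youngs_inequality_0) auto
  moreover have "p * (1 - 1 / p) = p - 1" using assms by (simp add: field_simps)
  ultimately show ?thesis using False assms by (simp add: powr_powr)
qed (use assms in auto)

text \<open>Duality of Schatten norms. If \<open>e\<close> are the eigenvalues of \<open>Y\<close> and \<open>N\<close> is its norm, then \<open>B\<close> has the
  same eigenvectors and the eigenvalues \<open>sgn e * \<bar>e / N\<bar> powr (p - 1)\<close>. For the bound, expand the inner
  product over the overlaps and use Young's inequality in the form \<open>young_powr\<close> for each term; the
  weights sum to 1 in each row and column. No conjugate exponent appears, so \<open>p = 1\<close> is covered.\<close>

lemma schatten_norming:
  assumes Y: "Y \<in> sa n" and p: "1 \<le> p"
  shows "\<exists>B\<in>sa n. (\<Sum>m\<in>idx n. coord Y m * coord B m) = schatten_norm p Y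
    \<and> (\<forall>X\<in>sa n. \<bar>\<Sum>m\<in>idx n. coord X m * coord B m\<bar> \<le> schatten_norm p X)"
proof -
  obtain V e where V: "V \<in> unitary_mats n" and Ye: "Y = spec V e" using sa_eq_spec[OF Y] by blast
  define N where "N = schatten_norm p Y"
  have N: "N = (\<Sum>l<n. \<bar>e l\<bar> powr p) powr (1 / p)" unfolding N_def Ye schatten_norm_spec[OF V] ..
  then have Np: "N powr p = (\<Sum>l<n. \<bar>e l\<bar> powr p)" using p by (simp add: powr_powr sum_nonneg)
  show ?thesis
  proof (cases "N = 0")
    case True
    have "(\<Sum>m\<in>idx n. coord X m * coord (herm n (\<lambda>_. 0)) m) = 0" for X
      by (intro sum.neutral) (simp add: coord_herm)
    then show ?thesis using herm_sa[of n "\<lambda>_. 0"] True schatten_norm_nonneg unfolding N_def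
      by (intro bexI[of _ "herm n (\<lambda>_. 0)"]) auto
  next
    case False
    then have N0: "0 < N" using schatten_norm_nonneg[of p Y] by (simp add: N_def)
    define f where "f l = sgn (e l) * \<bar>e l / N\<bar> powr (p - 1)" for l
    have fle: "\<bar>f l\<bar> \<le> \<bar>e l / N\<bar> powr (p - 1)" for l
      by (cases "e l = 0") (simp_all add: f_def abs_mult)
    have 1: "(\<Sum>m\<in>idx n. coord Y m * coord (spec V f) m) = N"
    proof -
      have "e l * f l = N * (\<bar>e l\<bar> powr p / N powr p)" for l
      proof (cases "e l = 0")
        case False
        have "e l * f l = (e l * sgn (e l)) * \<bar>e l / N\<bar> powr (p - 1)" by (simp add: f_def)
        also have "e l * sgn (e l) = \<bar>e l\<bar>" by (rule abs_sgn[symmetric])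
        also have "\<bar>e l\<bar> = N * \<bar>e l / N\<bar> powr 1" using N0 by simp
        also have "N * \<bar>e l / N\<bar> powr 1 * \<bar>e l / N\<bar> powr (p - 1) = N * (\<bar>e l / N\<bar> powr 1 * \<bar>e l / N\<bar> powr (p - 1))"
          by (rule mult.assoc)
        also have "\<dots> = N * \<bar>e l / N\<bar> powr p" by (simp only: powr_add[symmetric]) simp
        finally show ?thesis using N0 by (simp add: powr_divide)
      qed (simp add: f_def)
      then have "(\<Sum>l<n. e l * f l) = N * ((\<Sum>l<n. \<bar>e l\<bar> powr p) / N powr p)"
        by (simp add: sum_distrib_left sum_divide_distrib)
      also have "\<dots> = N" using N0 by (simp flip: Np)
      finally show ?thesis unfolding Ye sum_coord_spec_same[OF V] .
    qed
    have 2: "\<bar>\<Sum>m\<in>idx n. coord X m * coord (spec V f) m\<bar> \<le> schatten_norm p X" if X: "X \<in> sa n" for X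
    proof -
      obtain U d where U: "U \<in> unitary_mats n" and Xd: "X = spec U d" using sa_eq_spec[OF X] by blast
      define M where "M = schatten_norm p X"
      have M: "M = (\<Sum>k<n. \<bar>d k\<bar> powr p) powr (1 / p)" unfolding M_def Xd schatten_norm_spec[OF U] ..
      then have Mp: "M powr p = (\<Sum>k<n. \<bar>d k\<bar> powr p)" using p by (simp add: powr_powr sum_nonneg)
      have ov: "0 \<le> overlap n U V k l" for k l by (simp add: overlap_def)
      show ?thesis
      proof (cases "M = 0")
        case True
        then have "\<bar>d k\<bar> powr p = 0" if "k < n" for k
          using that Mp by (simp add: sum_nonneg_eq_0_iff)
        then have "d k = 0" if "k < n" for k using that by force
        then show ?thesis unfolding Xd sum_coord_spec[OF U V] by (simp add: schatten_norm_nonneg)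
      next
        case False
        then have M0: "0 < M" using schatten_norm_nonneg[of p X] by (simp add: M_def)
        let ?W = "\<lambda>k l. M * (\<bar>d k\<bar> powr p / M powr p / p * overlap n U V k l
            + (1 - 1 / p) * (\<bar>e l\<bar> powr p / N powr p) * overlap n U V k l)"
        have "\<bar>\<Sum>m\<in>idx n. coord X m * coord (spec V f) m\<bar> \<le> (\<Sum>k<n. \<Sum>l<n. \<bar>d k * f l * overlap n U V k l\<bar>)"
          unfolding Xd sum_coord_spec[OF U V] by (rule order.trans[OF sum_abs], intro sum_mono, rule sum_abs)
        also have "\<dots> \<le> (\<Sum>k<n. \<Sum>l<n. ?W k l)"
        proof (intro sum_mono)
          fix k l
          have "\<bar>d k * f l * overlap n U V k l\<bar> = \<bar>d k\<bar> * \<bar>f l\<bar> * overlap n U V k l"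
            using ov by (simp add: abs_mult)
          also have "\<dots> \<le> \<bar>d k\<bar> * \<bar>e l / N\<bar> powr (p - 1) * overlap n U V k l"
            using fle ov by (intro mult_right_mono mult_left_mono) auto
          also have "\<dots> = M * (\<bar>d k\<bar> / M * (\<bar>e l\<bar> / N) powr (p - 1)) * overlap n U V k l"
            using M0 N0 by simp
          also have "\<dots> \<le> M * ((\<bar>d k\<bar> / M) powr p / p + (1 - 1 / p) * (\<bar>e l\<bar> / N) powr p) * overlap n U V k l"
            using M0 N0 p ov by (intro mult_right_mono mult_left_mono young_powr) auto
          also have "\<dots> = ?W k l"
            using M0 N0 by (simp add: powr_divide algebra_simps)
          finally show "\<bar>d k * f l * overlap n U V k l\<bar> \<le> ?W k l" .
        qed
        also have "\<dots> = M * ((\<Sum>k<n. \<bar>d k\<bar> powr p / M powr p / p * (\<Sum>l<n. overlap n U V k l))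
            + (\<Sum>l<n. (1 - 1 / p) * (\<bar>e l\<bar> powr p / N powr p) * (\<Sum>k<n. overlap n U V k l)))"
        proof -
          have "(\<Sum>k<n. \<Sum>l<n. (1 - 1 / p) * (\<bar>e l\<bar> powr p / N powr p) * overlap n U V k l)
            = (\<Sum>l<n. \<Sum>k<n. (1 - 1 / p) * (\<bar>e l\<bar> powr p / N powr p) * overlap n U V k l)" by (rule sum.swap)
          then show ?thesis by (simp only: sum_distrib_left[symmetric] sum.distrib)
        qed
        also have "(\<Sum>k<n. \<bar>d k\<bar> powr p / M powr p / p * (\<Sum>l<n. overlap n U V k l)) = (\<Sum>k<n. \<bar>d k\<bar> powr p / M powr p / p)"
          by (intro sum.cong refl) (simp add: sum_overlap_right[OF U V])
        also have "\<dots> = 1 / p" using M0 by (simp flip: sum_divide_distrib Mp)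
        also have "(\<Sum>l<n. (1 - 1 / p) * (\<bar>e l\<bar> powr p / N powr p) * (\<Sum>k<n. overlap n U V k l))
            = (\<Sum>l<n. (1 - 1 / p) * (\<bar>e l\<bar> powr p / N powr p))"
          by (intro sum.cong refl) (simp add: sum_overlap_left[OF U V])
        also have "\<dots> = 1 - 1 / p" using N0 by (simp flip: sum_divide_distrib sum_distrib_left Np)
        finally show ?thesis by (simp add: M_def)
      qed
    qed
    show ?thesis using 1 2 spec_sa[OF unitary_mats_carrier[OF V]] unfolding N_def by blast
  qed
qed

section \<open>Functionals and contractions on the Schatten space\<close>

abbreviation Sp :: "real \<Rightarrow> nat \<Rightarrow> complex mat rnspace" where
  "Sp p n \<equiv> schatten_sa p n"

abbreviation Sp_functionals :: "real \<Rightarrow> nat \<Rightarrow> (complex mat \<Rightarrow> real) set" where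
  "Sp_functionals p n \<equiv> linear_maps (Sp p n) real_line"

abbreviation dual_norm :: "real \<Rightarrow> nat \<Rightarrow> (complex mat \<Rightarrow> real) \<Rightarrow> real" where
  "dual_norm p n \<equiv> op_norm (Sp p n) real_line"

lemma schatten_sa_simps [simp]:
  "points (Sp p n) = sa n" "vadd (Sp p n) = (+)"
  "vscale (Sp p n) = (\<lambda>a A. complex_of_real a \<cdot>\<^sub>m A)" "vnorm (Sp p n) = schatten_norm p"
  by (simp_all add: schatten_sa_def sa_def)

lemma real_line_simps [simp]:
  "points real_line = UNIV" "vadd real_line = (+)" "vscale real_line = (*)" "vnorm real_line = abs"
  by (simp_all add: real_line_def)

lemma dual_simps [simp]:
  "points (dual E) = {f \<in> linear_maps E real_line. \<forall>x. x \<notin> points E \<longrightarrow> f x = 0}"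
  "vadd (dual E) = (\<lambda>f g x. f x + g x)" "vscale (dual E) = (\<lambda>a f x. a * f x)"
  "vnorm (dual E) = op_norm E real_line"
  by (simp_all add: dual_def)

lemma sa_add: "X \<in> sa n \<Longrightarrow> Y \<in> sa n \<Longrightarrow> X + Y \<in> sa n"
  using herm_coord herm_add herm_sa by metis

lemma sa_smult: "X \<in> sa n \<Longrightarrow> complex_of_real c \<cdot>\<^sub>m X \<in> sa n"
  using herm_coord herm_smult herm_sa by metis

lemma coord_add: "X \<in> sa n \<Longrightarrow> Y \<in> sa n \<Longrightarrow> k \<in> idx n \<Longrightarrow> coord (X + Y) k = coord X k + coord Y k"
  by (metis (no_types, lifting) herm_coord herm_add coord_herm)

lemma coord_smult: "X \<in> sa n \<Longrightarrow> k \<in> idx n \<Longrightarrow> coord (complex_of_real c \<cdot>\<^sub>m X) k = c * coord X k"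
  by (metis (no_types, lifting) herm_coord herm_smult coord_herm)

lemma linear_functional_iff:
  "f \<in> Sp_functionals p n \<longleftrightarrow>
    (\<forall>X\<in>sa n. \<forall>Y\<in>sa n. f (X + Y) = f X + f Y) \<and> (\<forall>c. \<forall>X\<in>sa n. f (complex_of_real c \<cdot>\<^sub>m X) = c * f X)"
  by (simp add: linear_maps_def)

text \<open>The orthonormal basis that belongs to the coordinates.\<close>

definition bas :: "nat \<Rightarrow> nat \<times> nat \<Rightarrow> complex mat" where
  "bas n k = herm n (\<lambda>l. if l = k then 1 else 0)"

lemma bas_sa: "bas n k \<in> sa n"
  by (simp add: bas_def herm_sa)

lemma coord_bas: "l \<in> idx n \<Longrightarrow> coord (bas n k) l = (if l = k then 1 else 0)"
  by (simp add: bas_def coord_herm)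

lemma linear_functional_herm:
  assumes f: "f \<in> Sp_functionals p n"
  shows "f (herm n a) = (\<Sum>k\<in>idx n. a k * f (bas n k))"
proof -
  have add: "f (X + Y) = f X + f Y" if "X \<in> sa n" "Y \<in> sa n" for X Y
    using f that by (simp add: linear_functional_iff)
  have scale: "f (complex_of_real c \<cdot>\<^sub>m X) = c * f X" if "X \<in> sa n" for c X
    using f that by (simp add: linear_functional_iff)
  have "f (herm n (\<lambda>l. if l \<in> S then a l else 0)) = (\<Sum>k\<in>S. a k * f (bas n k))" if "finite S" for S
    using that
  proof (induction S)
    case empty
    have "complex_of_real 0 \<cdot>\<^sub>m herm n (\<lambda>l. 0) = herm n (\<lambda>l. 0)" by (simp only: herm_smult mult_zero_left)
    then show ?case using scale[OF herm_sa, of 0 "\<lambda>l. 0"] by simp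
  next
    case (insert k S)
    have "herm n (\<lambda>l. if l \<in> insert k S then a l else 0)
        = complex_of_real (a k) \<cdot>\<^sub>m bas n k + herm n (\<lambda>l. if l \<in> S then a l else 0)"
      unfolding bas_def herm_smult herm_add using insert.hyps by (intro arg_cong[of _ _ "herm n"] ext) auto
    then show ?case
      using insert add[OF sa_smult[OF bas_sa] herm_sa] scale[OF bas_sa] by simp
  qed
  from this[of "idx n"] have "f (herm n (\<lambda>l. if l \<in> idx n then a l else 0)) = (\<Sum>k\<in>idx n. a k * f (bas n k))"
    by simp
  moreover have "herm n (\<lambda>l. if l \<in> idx n then a l else 0) = herm n a" by (rule herm_cong) auto
  ultimately show ?thesis by simp
qed

lemma linear_functional_expand:
  assumes f: "f \<in> Sp_functionals p n" and X: "X \<in> sa n"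
  shows "f X = (\<Sum>k\<in>idx n. coord X k * f (bas n k))"
  using linear_functional_herm[OF f, of "coord X"] herm_coord[OF X] by simp

text \<open>The functional with coefficients \<open>c\<close>, set to zero off the carrier as \<open>dual\<close> requires.\<close>

definition coord_functional :: "nat \<Rightarrow> (nat \<times> nat \<Rightarrow> real) \<Rightarrow> complex mat \<Rightarrow> real" where
  "coord_functional n c X = (if X \<in> sa n then \<Sum>k\<in>idx n. coord X k * c k else 0)"

lemma coord_functional_linear: "coord_functional n c \<in> Sp_functionals p n"
  unfolding linear_functional_iff coord_functional_def
  by (simp add: sa_add sa_smult coord_add coord_smult distrib_right sum.distrib sum_distrib_left mult.assoc)

lemma coord_functional_dual: "coord_functional n c \<in> points (dual (Sp p n))"
  using coord_functional_linear by (simp add: coord_functional_def)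

lemma linear_functional_symprod:
  assumes f: "f \<in> Sp_functionals p n"
  shows "linear_form (cidx n) (\<lambda>x. f (symprod n x y))"
  unfolding linear_functional_expand[OF f symprod_sa]
  by (intro linear_form_sum linear_form_coord_symprod)

text \<open>The map \<open>symprod\<close> is recovered from its diagonal by polarisation, and the parallelogram identity
  keeps the constant.\<close>

lemma functional_polarization:
  assumes f: "f \<in> Sp_functionals p n"
    and K: "\<And>x. \<bar>f (symprod n x x)\<bar> \<le> K * (sumsq (cidx n) x)"
    and x: "(sumsq (cidx n) x) \<le> 1" and y: "(sumsq (cidx n) y) \<le> 1" and K0: "0 \<le> K"
  shows "\<bar>f (symprod n x y)\<bar> \<le> K"
proof -
  define s where "s m = x m + y m" for m
  define d where "d m = x m - y m" for m
  have c: "coord (symprod n x y) k = (coord (symprod n s s) k - coord (symprod n d d) k) / 4" if k: "k \<in> idx n" for k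
  proof -
    obtain i j where ij: "k = (i, j)" "i < n" "j < n" using k by auto
    have cv: "cvec s = (\<lambda>i. cvec x i + cvec y i)" "cvec d = (\<lambda>i. cvec x i - cvec y i)"
      by (auto simp: cvec_def s_def d_def complex_eq_iff)
    have eq: "symprod n x y $$ k = (symprod n s s $$ k - symprod n d d $$ k) / 4"
      using ij by (simp add: symprod_def cv field_simps)
    have "Re (w * ((a - b) / 4)) = (Re (w * a) - Re (w * b)) / 4" for w a b :: complex
      by (simp add: right_diff_distrib)
    then show ?thesis unfolding coord_def eq by blast
  qed
  have "f (symprod n x y) = (f (symprod n s s) - f (symprod n d d)) / 4"
  proof -
    have "(\<Sum>k\<in>idx n. coord (symprod n x y) k * f (bas n k))
        = (\<Sum>k\<in>idx n. (coord (symprod n s s) k * f (bas n k) - coord (symprod n d d) k * f (bas n k)) / 4)"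
      by (intro sum.cong refl) (subst c, assumption, simp add: left_diff_distrib)
    then show ?thesis
      unfolding linear_functional_expand[OF f symprod_sa] by (simp only: sum_divide_distrib[symmetric] sum_subtractf)
  qed
  then have "\<bar>f (symprod n x y)\<bar> \<le> (\<bar>f (symprod n s s)\<bar> + \<bar>f (symprod n d d)\<bar>) / 4" by simp
  also have "\<dots> \<le> (K * (sumsq (cidx n) s) + K * (sumsq (cidx n) d)) / 4"
    using K by (intro divide_right_mono add_mono) auto
  also have "\<dots> = K * ((sumsq (cidx n) x) + (sumsq (cidx n) y)) / 2"
  proof -
    have "(sumsq (cidx n) s) + (sumsq (cidx n) d) = (\<Sum>m\<in>cidx n. 2 * (x m)\<^sup>2 + 2 * (y m)\<^sup>2)"
      unfolding sum.distrib[symmetric] by (intro sum.cong refl) (simp add: s_def d_def power2_sum power2_diff)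
    also have "\<dots> = 2 * ((sumsq (cidx n) x) + (sumsq (cidx n) y))"
      by (simp only: sum.distrib sum_distrib_left[symmetric] distrib_left)
    finally have sd: "(sumsq (cidx n) s) + (sumsq (cidx n) d)
        = 2 * ((sumsq (cidx n) x) + (sumsq (cidx n) y))" .
    show ?thesis unfolding distrib_left[symmetric, of K] sd by simp
  qed
  also have "\<dots> \<le> K * (1 + 1) / 2" using x y K0 by (intro divide_right_mono mult_left_mono add_mono) auto
  finally show ?thesis by simp
qed

text \<open>Decompose \<open>X\<close> into rank-one projections onto eigenvectors; the sum of the absolute values of the
  eigenvalues is at most \<open>n powr (1 - 1 / p)\<close> times the Schatten norm.\<close>

lemma functional_le_rank_one:
  assumes f: "f \<in> Sp_functionals p n" and p: "1 \<le> p" and n: "0 < n"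
    and K: "\<And>x. \<bar>f (symprod n x x)\<bar> \<le> K * (sumsq (cidx n) x)" and K0: "0 \<le> K" and X: "X \<in> sa n"
  shows "\<bar>f X\<bar> \<le> K * real n powr (1 - 1 / p) * schatten_norm p X"
proof -
  obtain U d where U: "U \<in> unitary_mats n" and Xd: "X = spec U d" using sa_eq_spec[OF X] by blast
  note Uc = unitary_mats_carrier[OF U]
  have "f X = (\<Sum>m\<in>idx n. (\<Sum>k<n. d k * coord (eigproj n U k) m) * f (bas n m))"
    unfolding linear_functional_expand[OF f X] by (intro sum.cong refl) (simp add: Xd coord_spec[OF Uc])
  also have "\<dots> = (\<Sum>m\<in>idx n. \<Sum>k<n. d k * (coord (eigproj n U k) m * f (bas n m)))"
    by (simp add: sum_distrib_right mult.assoc)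
  also have "\<dots> = (\<Sum>k<n. \<Sum>m\<in>idx n. d k * (coord (eigproj n U k) m * f (bas n m)))"
    by (rule sum.swap)
  also have "\<dots> = (\<Sum>k<n. d k * f (eigproj n U k))"
    unfolding linear_functional_expand[OF f symprod_sa] by (simp add: sum_distrib_left)
  finally have "\<bar>f X\<bar> \<le> (\<Sum>k<n. \<bar>d k * f (eigproj n U k)\<bar>)" by simp
  also have "\<dots> \<le> (\<Sum>k<n. \<bar>d k\<bar> * K)"
  proof (rule sum_mono)
    fix k assume "k \<in> {..<n}"
    then have "\<bar>f (eigproj n U k)\<bar> \<le> K"
      using K[of "rvec U k"] sum_rvec_square[OF U, of k] by simp
    then show "\<bar>d k * f (eigproj n U k)\<bar> \<le> \<bar>d k\<bar> * K"
      unfolding abs_mult by (intro mult_left_mono) auto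
  qed
  also have "\<dots> = K * (\<Sum>k<n. \<bar>d k\<bar> powr 1) powr (1 / 1)"
    by (simp add: sum_distrib_left mult.commute sum_nonneg)
  also have "\<dots> \<le> K * (real n powr (1 / 1 - 1 / p) * (\<Sum>k<n. \<bar>d k\<bar> powr p) powr (1 / p))"
    using p n K0 by (intro mult_left_mono lp_norm_le_lq_norm) auto
  finally show ?thesis unfolding Xd schatten_norm_spec[OF U] by (simp add: mult.assoc)
qed

text \<open>Boundedness of every functional is what makes the suprema that define the dual norm and the norm
  of a map into the dual meaningful.\<close>

lemma functional_bounded:
  assumes f: "f \<in> Sp_functionals p n" and p: "1 \<le> p" and n: "0 < n"
  shows "\<exists>K\<ge>0. \<forall>X\<in>sa n. \<bar>f X\<bar> \<le> K * schatten_norm p X"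
proof -
  define K where "K = sqrt (\<Sum>k\<in>idx n. (f (bas n k))\<^sup>2)"
  have K0: "0 \<le> K" by (simp add: K_def sum_nonneg)
  have "\<bar>f (symprod n x x)\<bar> \<le> K * (sumsq (cidx n) x)" for x
  proof -
    have "\<bar>f (symprod n x x)\<bar> \<le> sqrt (\<Sum>k\<in>idx n. (coord (symprod n x x) k)\<^sup>2) * K"
      unfolding linear_functional_expand[OF f symprod_sa] K_def by (rule sum_mult_le_sqrt)
    also have "\<dots> \<le> (sumsq (cidx n) x) * K"
      using sum_coord_symprod_le[of n x x] K0
      by (intro mult_right_mono real_le_lsqrt) (auto simp: sum_nonneg power2_eq_square)
    finally show ?thesis by (simp add: mult.commute)
  qed
  from functional_le_rank_one[OF f p n this K0] K0 show ?thesis by (intro exI[of _ "K * real n powr (1 - 1 / p)"]) auto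
qed

lemma schatten_norm_zero: "schatten_norm p (herm n (\<lambda>_. 0)) = 0" if "0 < p"
proof -
  have "herm n (\<lambda>_. 0) = complex_of_real 0 \<cdot>\<^sub>m herm n (\<lambda>_. 0)" by (simp only: herm_smult mult_zero_left)
  then show ?thesis using schatten_norm_smult[OF herm_sa[of n "\<lambda>_. 0"] that, of 0] by simp
qed

lemma dual_norm_le:
  assumes p: "0 < p" and K: "\<And>X. X \<in> sa n \<Longrightarrow> \<bar>f X\<bar> \<le> K * schatten_norm p X" "0 \<le> K"
  shows "dual_norm p n f \<le> K"
  unfolding op_norm_def
proof (rule cSup_least)
  show "{vnorm real_line (f x) |x. x \<in> points (Sp p n) \<and> vnorm (Sp p n) x \<le> 1} \<noteq> {}"
    using herm_sa[of n "\<lambda>_. 0"] schatten_norm_zero[OF p, of n] by auto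
  fix t assume "t \<in> {vnorm real_line (f x) |x. x \<in> points (Sp p n) \<and> vnorm (Sp p n) x \<le> 1}"
  then obtain X where X: "t = \<bar>f X\<bar>" "X \<in> sa n" "schatten_norm p X \<le> 1" by auto
  have "t \<le> K * schatten_norm p X" using K(1)[OF X(2)] X(1) by simp
  also have "\<dots> \<le> K * 1" using X K(2) by (intro mult_left_mono) auto
  finally show "t \<le> K" by simp
qed

lemma dual_norm_apply:
  assumes f: "f \<in> Sp_functionals p n" and p: "1 \<le> p" and n: "0 < n" and X: "X \<in> sa n"
  shows "\<bar>f X\<bar> \<le> dual_norm p n f * schatten_norm p X"
proof -
  obtain K where K: "0 \<le> K" "\<And>X. X \<in> sa n \<Longrightarrow> \<bar>f X\<bar> \<le> K * schatten_norm p X"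
    using functional_bounded[OF f p n] by blast
  define S where "S = {vnorm real_line (f x) |x. x \<in> points (Sp p n) \<and> vnorm (Sp p n) x \<le> 1}"
  have "bdd_above S"
  proof (rule bdd_aboveI)
    fix t assume "t \<in> S"
    then obtain Y where Y: "t = \<bar>f Y\<bar>" "Y \<in> sa n" "schatten_norm p Y \<le> 1" by (auto simp: S_def)
    have "t \<le> K * schatten_norm p Y" using K(2)[OF Y(2)] Y(1) by simp
    also have "\<dots> \<le> K * 1" using Y K(1) by (intro mult_left_mono) auto
    finally show "t \<le> K" by simp
  qed
  then have S: "\<bar>f Y\<bar> \<le> dual_norm p n f" if "Y \<in> sa n" "schatten_norm p Y \<le> 1" for Y
    unfolding op_norm_def S_def[symmetric] using that by (intro cSup_upper) (auto simp: S_def)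
  define N where "N = schatten_norm p X"
  show ?thesis
  proof (cases "N = 0")
    case True
    then show ?thesis using K(2)[OF X] by (simp add: N_def)
  next
    case False
    then have N: "0 < N" using schatten_norm_nonneg[of p X] by (simp add: N_def)
    define Z where "Z = complex_of_real (1 / N) \<cdot>\<^sub>m X"
    have "schatten_norm p Z = 1"
      unfolding Z_def using schatten_norm_smult[OF X, of p "1 / N"] p N by (simp only: N_def[symmetric]) simp
    then have "\<bar>f Z\<bar> \<le> dual_norm p n f"
      by (intro S) (simp_all add: Z_def sa_smult[OF X] del: of_real_divide)
    moreover have "f Z = 1 / N * f X" using f X unfolding linear_functional_iff Z_def by blast
    ultimately show ?thesis using N by (simp add: abs_mult field_simps N_def[symmetric])
  qed
qed

lemma dual_norm_nonneg:
  assumes f: "f \<in> Sp_functionals p n" and p: "1 \<le> p" and n: "0 < n"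
  shows "0 \<le> dual_norm p n f"
proof -
  have U: "1\<^sub>m n \<in> unitary_mats n"
    by (rule unitary_matsI) (auto simp: if_distrib[of cnj] if_distrib[of "\<lambda>t. t * _"] cong: if_cong)
  define Y where "Y = spec (1\<^sub>m n) (\<lambda>k. if k = 0 then 1 else 0)"
  have Y: "Y \<in> sa n" unfolding Y_def by (rule spec_sa) simp
  have "(\<Sum>k<n. \<bar>if k = 0 then 1 else 0\<bar> powr p) = (\<Sum>k<n. if k = 0 then 1 else 0 :: real)"
    by (intro sum.cong refl) auto
  then have "schatten_norm p Y = 1" unfolding Y_def schatten_norm_spec[OF U] using n by simp
  then show ?thesis using dual_norm_apply[OF f p n Y] by simp
qed

text \<open>The set of norms whose supremum is the operator norm is bounded: expand \<open>X\<close> in the basis and use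
  that the coordinates and the functionals \<open>A (bas n k)\<close> are bounded.\<close>

lemma contraction_apply:
  assumes A: "A \<in> linear_maps (Sp p n) (dual (Sp p n))"
    and A1: "op_norm (Sp p n) (dual (Sp p n)) A \<le> 1"
    and p: "1 \<le> p" and n: "0 < n" and X: "X \<in> sa n" and Y: "Y \<in> sa n"
  shows "\<bar>A X Y\<bar> \<le> schatten_norm p X * schatten_norm p Y"
proof -
  let ?E = "Sp p n"
  have lin: "A Z \<in> linear_maps ?E real_line" if "Z \<in> sa n" for Z
    using A that by (simp add: linear_maps_def)
  have lin2: "(\<lambda>Z. A Z W) \<in> linear_maps ?E real_line" for W
    using A by (simp add: linear_functional_iff) (simp add: linear_maps_def)
  have ex: "\<forall>k. \<exists>K\<ge>0. k \<in> idx n \<longrightarrow> (\<forall>W\<in>sa n. \<bar>A (bas n k) W\<bar> \<le> K * schatten_norm p W)"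
    using functional_bounded[OF lin[OF bas_sa] p n] by blast
  then obtain K where K: "\<And>k. 0 \<le> K k" "\<And>k W. k \<in> idx n \<Longrightarrow> W \<in> sa n \<Longrightarrow> \<bar>A (bas n k) W\<bar> \<le> K k * schatten_norm p W"
    by metis
  have ex2: "\<forall>k. \<exists>L\<ge>0. k \<in> idx n \<longrightarrow> (\<forall>W\<in>sa n. \<bar>coord W k\<bar> \<le> L * schatten_norm p W)"
  proof
    fix k
    show "\<exists>L\<ge>0. k \<in> idx n \<longrightarrow> (\<forall>W\<in>sa n. \<bar>coord W k\<bar> \<le> L * schatten_norm p W)"
    proof -
      obtain L where "0 \<le> L" "\<And>W. W \<in> sa n \<Longrightarrow> \<bar>coord_functional n (\<lambda>l. if l = k then 1 else 0) W\<bar> \<le> L * schatten_norm p W"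
        using functional_bounded[OF coord_functional_linear p n] by blast
      then show ?thesis by (intro exI[of _ L]) (auto simp: coord_functional_def if_distrib cong: if_cong)
    qed
  qed
  then obtain L where L: "\<And>k. 0 \<le> L k" "\<And>k W. k \<in> idx n \<Longrightarrow> W \<in> sa n \<Longrightarrow> \<bar>coord W k\<bar> \<le> L k * schatten_norm p W"
    by metis
  define S where "S = {vnorm (dual ?E) (A x) |x. x \<in> points ?E \<and> vnorm ?E x \<le> 1}"
  have "bdd_above S"
  proof (rule bdd_aboveI)
    fix t assume "t \<in> S"
    then obtain Z where Z: "t = op_norm ?E real_line (A Z)" "Z \<in> sa n" "schatten_norm p Z \<le> 1" by (auto simp: S_def)
    show "t \<le> (\<Sum>k\<in>idx n. L k * K k)"
      unfolding Z(1)
    proof (rule dual_norm_le)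
      fix W assume W: "W \<in> sa n"
      have "\<bar>A Z W\<bar> \<le> (\<Sum>k\<in>idx n. \<bar>coord Z k * A (bas n k) W\<bar>)"
        unfolding linear_functional_expand[OF lin2 Z(2)] by (rule sum_abs)
      also have "\<dots> \<le> (\<Sum>k\<in>idx n. L k * (K k * schatten_norm p W))"
        unfolding abs_mult
      proof (intro sum_mono mult_mono)
        fix k assume k: "k \<in> idx n"
        show "\<bar>coord Z k\<bar> \<le> L k"
          using L(2)[OF k Z(2)] mult_left_mono[OF Z(3) L(1)[of k]] by simp
      qed (use K L W in auto)
      finally show "\<bar>A Z W\<bar> \<le> (\<Sum>k\<in>idx n. L k * K k) * schatten_norm p W"
        by (simp add: sum_distrib_right mult.assoc)
    qed (use p K L in \<open>auto simp: sum_nonneg\<close>)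
  qed
  then have S: "op_norm ?E real_line (A Z) \<le> 1" if "Z \<in> sa n" "schatten_norm p Z \<le> 1" for Z
  proof -
    have "op_norm ?E real_line (A Z) \<le> op_norm ?E (dual ?E) A"
      unfolding op_norm_def[of ?E "dual ?E"] S_def[symmetric]
      using that \<open>bdd_above S\<close> by (intro cSup_upper) (auto simp: S_def)
    then show ?thesis using A1 by simp
  qed
  define N where "N = schatten_norm p X"
  show ?thesis
  proof (cases "N = 0")
    case True
    obtain Kx where "\<And>Z. Z \<in> sa n \<Longrightarrow> \<bar>A Z Y\<bar> \<le> Kx * schatten_norm p Z"
      using functional_bounded[OF lin2 p n] by blast
    from this[OF X] True show ?thesis by (simp add: N_def)
  next
    case False
    then have N: "0 < N" using schatten_norm_nonneg[of p X] by (simp add: N_def)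
    define Z where "Z = complex_of_real (1 / N) \<cdot>\<^sub>m X"
    have Z: "Z \<in> sa n" unfolding Z_def by (rule sa_smult[OF X])
    have Z1: "schatten_norm p Z \<le> 1"
      unfolding Z_def using schatten_norm_smult[OF X, of p "1 / N"] p N by (simp only: N_def[symmetric]) simp
    have "A Z Y = 1 / N * A X Y" using lin2[of Y] X unfolding linear_functional_iff Z_def by blast
    then have "\<bar>A X Y\<bar> = N * \<bar>A Z Y\<bar>" using N by (simp add: abs_mult)
    also have "\<dots> \<le> N * (1 * schatten_norm p Y)"
      using dual_norm_apply[OF lin[OF Z] p n Y] mult_right_mono[OF S[OF Z Z1] schatten_norm_nonneg[of p Y]] N
      by (intro mult_left_mono) linarith+
    finally show ?thesis by (simp add: N_def)
  qed
qed

section \<open>The upper bound\<close>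

lemma card_plus_1_le_exp:
  assumes "real N \<le> 48 ^ m" "1 \<le> m"
  shows "real N + 1 \<le> exp (7 * real m)"
proof -
  have "real N + 1 \<le> 48 ^ m + 48 ^ m" using assms one_le_power[of "48::real" m] by linarith
  also have "\<dots> = 2 * 48 ^ m" by simp
  also have "\<dots> \<le> 2 ^ m * 48 ^ m" using assms(2) self_le_power[of "2::real" m] by (intro mult_right_mono) auto
  also have "\<dots> = (96::real) ^ m" by (simp flip: power_mult_distrib)
  also have "\<dots> \<le> 128 ^ m" by (intro power_mono) auto
  also have "\<dots> = (2 ^ 7) ^ m" by simp
  also have "\<dots> \<le> (exp 1 ^ 7) ^ m"
    using exp_ge_add_one_self[of "1::real"] by (intro power_mono) auto
  also have "\<dots> = exp (7 * real m)" by (simp add: exp_of_nat_mult[symmetric] mult.commute flip: power_mult)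
  finally show ?thesis .
qed

lemma finite_idx: "finite (idx n)" by simp

lemma card_cidx: "card (cidx n) = 2 * n"
  by (simp add: card_cartesian_product)

text \<open>The constant \<open>2 * (c + 2)\<^sup>2 + 4\<close> of \<open>expected_square_of_max\<close> for \<open>c = 28\<close>.\<close>

definition random_const :: real where "random_const = 1804"

text \<open>The values of the random functional at the matrices \<open>symprod n z w\<close>, with \<open>z\<close> and \<open>w\<close> in the net, are
  at most \<open>48 ^ (4 * n)\<close> sign sums of variance at most 1, and \<open>M\<close> bounds all of them. Passing from the net to all vectors costs a
  factor 2 for each of the two variables.\<close>

lemma random_functional_bound:
  fixes F :: "nat \<times> nat \<Rightarrow> complex mat \<Rightarrow> real"
  assumes F: "\<And>k. k \<in> idx n \<Longrightarrow> F k \<in> Sp_functionals p n"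
    and F1: "\<And>x y. (sumsq (cidx n) x) \<le> 1 \<Longrightarrow> (sumsq (cidx n) y) \<le> 1 \<Longrightarrow>
      (\<Sum>k\<in>idx n. (F k (symprod n x y))\<^sup>2) \<le> 1"
    and p: "1 \<le> p" and n: "0 < n"
  obtains M :: "(nat \<times> nat \<Rightarrow> real) \<Rightarrow> real"
  where "\<And>e. 1 \<le> M e"
    "\<And>e X. X \<in> sa n \<Longrightarrow> \<bar>\<Sum>k\<in>idx n. e k * F k X\<bar> \<le> 4 * M e * real n powr (1 - 1 / p) * schatten_norm p X"
    "(\<Sum>e\<in>signs (idx n). (M e)\<^sup>2) \<le> random_const * n * 2 ^ card (idx n)"
proof -
  let ?B = "ball_net (cidx n)"
  define J where "J = ?B \<times> ?B"
  define a where "a j k = F k (symprod n (fst j) (snd j))" for j k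
  have fin: "finite (cidx n)" by simp
  have "real (card J) \<le> 48 ^ (2 * n) * 48 ^ (2 * n)"
    unfolding J_def card_cartesian_product of_nat_mult
    using card_ball_net_le[OF fin] unfolding card_cidx by (intro mult_mono) auto
  also have "\<dots> = 48 ^ (4 * n)" by (simp flip: power_add)
  finally have cJ: "real (card J) + 1 \<le> exp (28 * real n)"
    using card_plus_1_le_exp[of "card J" "4 * n"] n by simp
  have fJ: "finite J" unfolding J_def using finite_ball_net[OF fin] by simp
  have aJ: "(\<Sum>k\<in>idx n. (a j k)\<^sup>2) \<le> 1" if "j \<in> J" for j
    unfolding a_def using that ball_net_le_1[OF fin] by (intro F1) (auto simp: J_def)
  have n1: "1 \<le> real n" using n by simp
  obtain M where M: "\<And>e. 1 \<le> M e" "\<And>e j. j \<in> J \<Longrightarrow> (\<Sum>k\<in>idx n. a j k * e k) \<le> M e"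
    "(\<Sum>e\<in>signs (idx n). (M e)\<^sup>2) \<le> (2 * (28 + 2)\<^sup>2 + 4) * real n * 2 ^ card (idx n)"
    by (rule expected_square_of_max[where a = a, OF finite_idx fJ cJ n1 _ aJ]) auto
  have "\<bar>\<Sum>k\<in>idx n. e k * F k X\<bar> \<le> 4 * M e * real n powr (1 - 1 / p) * schatten_norm p X" if X: "X \<in> sa n" for e X
  proof (rule functional_le_rank_one[OF _ p n _ _ X, where f = "\<lambda>X. \<Sum>k\<in>idx n. e k * F k X"])
    have add: "F k (X + Y) = F k X + F k Y" if "k \<in> idx n" "X \<in> sa n" "Y \<in> sa n" for k X Y
      using F[OF that(1)] that unfolding linear_functional_iff by blast
    have scale: "F k (complex_of_real c \<cdot>\<^sub>m X) = c * F k X" if "k \<in> idx n" "X \<in> sa n" for k c X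
      using F[OF that(1)] that unfolding linear_functional_iff by blast
    show lin: "(\<lambda>X. \<Sum>k\<in>idx n. e k * F k X) \<in> Sp_functionals p n"
      unfolding linear_functional_iff
    proof (intro conjI ballI allI)
      fix X Y assume X: "X \<in> sa n" and Y: "Y \<in> sa n"
      show "(\<Sum>k\<in>idx n. e k * F k (X + Y)) = (\<Sum>k\<in>idx n. e k * F k X) + (\<Sum>k\<in>idx n. e k * F k Y)"
        unfolding sum.distrib[symmetric] by (intro sum.cong refl) (simp only: add X Y distrib_left)
    next
      fix c X assume X: "X \<in> sa n"
      show "(\<Sum>k\<in>idx n. e k * F k (complex_of_real c \<cdot>\<^sub>m X)) = c * (\<Sum>k\<in>idx n. e k * F k X)"
        unfolding sum_distrib_left by (intro sum.cong refl) (simp only: scale X mult.left_commute)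
    qed
    show "0 \<le> 4 * M e" using M(1)[of e] by simp
    let ?f = "\<lambda>x y. \<Sum>k\<in>idx n. e k * F k (symprod n x y)"
    fix x
    have 1: "\<bar>?f x z\<bar> \<le> 2 * M e * sqrt (sumsq (cidx n) x)" if z: "z \<in> ?B" for z x
    proof (rule linear_form_le_of_ball_net[OF fin, where f = "\<lambda>x. ?f x z"])
      show "linear_form (cidx n) (\<lambda>x. ?f x z)" by (rule linear_functional_symprod[OF lin])
      fix w assume "w \<in> ?B"
      then show "?f w z \<le> M e" using M(2)[of "(w, z)" e] z by (simp add: J_def a_def mult.commute)
    qed
    have "\<bar>?f y x\<bar> \<le> 2 * (2 * M e * sqrt (sumsq (cidx n) x)) * sqrt (sumsq (cidx n) y)" for y
    proof (rule linear_form_le_of_ball_net[OF fin, where f = "\<lambda>y. ?f y x"])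
      show "linear_form (cidx n) (\<lambda>y. ?f y x)" by (rule linear_functional_symprod[OF lin])
      fix w assume "w \<in> ?B"
      from 1[OF this, of x] show "?f w x \<le> 2 * M e * sqrt (sumsq (cidx n) x)"
        by (simp add: symprod_commute[of n w x])
    qed
    from this[of x] show "\<bar>?f x x\<bar> \<le> 4 * M e * (sumsq (cidx n) x)"
      by (simp add: mult.assoc sum_nonneg)
  qed
  then show thesis using that[of M] M(1,3) by (simp add: random_const_def)
qed

text \<open>The set whose supremum is the injective norm is bounded by the sum of the products of norms in any
  representation of \<open>u\<close>.\<close>

lemma le_injective_norm:
  assumes p: "1 \<le> p" and n: "0 < n" and u: "u \<in> tensors (Sp p n) (Sp p n)"
    and phi: "\<phi> \<in> dual_ball (Sp p n)" and psi: "\<psi> \<in> dual_ball (Sp p n)"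
  shows "\<bar>u (\<lambda>x y. \<phi> x * \<psi> y)\<bar> \<le> injective_norm (Sp p n) (Sp p n) u"
proof -
  let ?E = "Sp p n"
  let ?S = "{\<bar>u (\<lambda>x y. \<phi> x * \<psi> y)\<bar> |\<phi> \<psi>. \<phi> \<in> dual_ball ?E \<and> \<psi> \<in> dual_ball ?E}"
  obtain xs where xs: "u = tensor_of ?E ?E xs" "set xs \<subseteq> sa n \<times> sa n" using u by (auto simp: tensors_def)
  have bil: "(\<lambda>x y. \<phi> x * \<psi> y) \<in> bilinear_forms ?E ?E" if "\<phi> \<in> dual_ball ?E" "\<psi> \<in> dual_ball ?E" for \<phi> \<psi>
    using that by (auto simp: bilinear_forms_def dual_ball_def linear_maps_def algebra_simps)
  have le: "\<bar>\<Sum>(x, y)\<leftarrow>xs. \<phi> x * \<psi> y\<bar> \<le> (\<Sum>(x, y)\<leftarrow>xs. schatten_norm p x * schatten_norm p y)"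
    if "\<phi> \<in> dual_ball ?E" "\<psi> \<in> dual_ball ?E" for \<phi> \<psi>
    using xs(2)
  proof (induction xs)
    case (Cons z xs)
    obtain x y where z: "z = (x, y)" by (cases z)
    have "\<bar>\<phi> x * \<psi> y\<bar> \<le> schatten_norm p x * schatten_norm p y"
      unfolding abs_mult using that Cons.prems z schatten_norm_nonneg
      by (intro mult_mono) (auto simp: dual_ball_def)
    then show ?case using Cons z by (auto intro: order.trans[OF abs_triangle_ineq])
  qed simp
  show ?thesis
    unfolding injective_norm_def
  proof (rule cSup_upper)
    show "\<bar>u (\<lambda>x y. \<phi> x * \<psi> y)\<bar> \<in> ?S"
      using phi psi by blast
    show "bdd_above ?S"
    proof (rule bdd_aboveI)
      fix t assume "t \<in> ?S"
      then obtain \<phi> \<psi> where t: "t = \<bar>u (\<lambda>x y. \<phi> x * \<psi> y)\<bar>" "\<phi> \<in> dual_ball ?E" "\<psi> \<in> dual_ball ?E" by blast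
      show "t \<le> (\<Sum>(x, y)\<leftarrow>xs. schatten_norm p x * schatten_norm p y)"
        using le[OF t(2,3)] bil[OF t(2,3)] unfolding t(1) xs(1) tensor_of_def by simp
    qed
  qed
qed

lemma projective_norm_le:
  assumes p: "1 \<le> p" and n: "0 < n"
    and zs: "set zs \<subseteq> points (dual (Sp p n)) \<times> sa n" "u = tensor_of (dual (Sp p n)) (Sp p n) zs"
  shows "projective_norm (dual (Sp p n)) (Sp p n) u
    \<le> (\<Sum>(f, y)\<leftarrow>zs. vnorm (dual (Sp p n)) f * schatten_norm p y)"
  unfolding projective_norm_def
proof (rule cInf_lower)
  let ?E = "Sp p n"
  let ?S = "{\<Sum>(x, y)\<leftarrow>xs. vnorm (dual ?E) x * vnorm ?E y |xs.
       set xs \<subseteq> points (dual ?E) \<times> points ?E \<and> u = tensor_of (dual ?E) ?E xs}"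
  show "(\<Sum>(f, y)\<leftarrow>zs. vnorm (dual ?E) f * schatten_norm p y) \<in> ?S"
    using zs by (intro CollectI exI[of _ zs]) auto
  have nn: "0 \<le> (\<Sum>(x, y)\<leftarrow>xs. vnorm (dual ?E) x * vnorm ?E y)" if "set xs \<subseteq> points (dual ?E) \<times> points ?E" for xs
    using that dual_norm_nonneg[OF _ p n] schatten_norm_nonneg
    by (intro sum_list_nonneg) fastforce
  then show "bdd_below ?S" by (intro bdd_belowI[of _ 0]) blast
qed

lemma sum_sum_list: "(\<Sum>e\<in>S. \<Sum>z\<leftarrow>xs. f e z) = (\<Sum>z\<leftarrow>xs. \<Sum>e\<in>S. (f e z :: real))"
  by (induction xs) (simp_all add: sum.distrib)

lemma mult_sum_list: "c * (\<Sum>z\<leftarrow>xs. f z) = (\<Sum>z\<leftarrow>xs. c * (f z :: real))"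
  by (induction xs) (simp_all add: distrib_left)

text \<open>For a random sign matrix \<open>g\<close>, the mean of \<open>tr (g X) g\<close> is \<open>X\<close>, since distinct signs are uncorrelated.\<close>

lemma random_expansion:
  assumes f: "f \<in> Sp_functionals p n" and X: "X \<in> sa n"
  shows "(\<Sum>e\<in>signs (idx n). (\<Sum>k\<in>idx n. e k * coord X k) * f (herm n e)) = 2 ^ card (idx n) * f X"
proof -
  have "(\<Sum>e\<in>signs (idx n). (\<Sum>k\<in>idx n. e k * coord X k) * f (herm n e))
      = (\<Sum>e\<in>signs (idx n). \<Sum>k\<in>idx n. \<Sum>l\<in>idx n. coord X k * f (bas n l) * (e k * e l))"
    unfolding linear_functional_herm[OF f] sum_product by (intro sum.cong refl) (simp add: mult_ac)
  also have "\<dots> = (\<Sum>k\<in>idx n. \<Sum>l\<in>idx n. \<Sum>e\<in>signs (idx n). coord X k * f (bas n l) * (e k * e l))"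
    by (rule trans[OF sum.swap], rule sum.cong[OF refl], rule sum.swap)
  also have "\<dots> = (\<Sum>k\<in>idx n. \<Sum>l\<in>idx n. if k = l then 2 ^ card (idx n) * (coord X k * f (bas n l)) else 0)"
    by (intro sum.cong refl) (simp add: sum_distrib_left[symmetric] sum_signs_mult[OF finite_idx] del: card_cartesian_product)
  also have "\<dots> = 2 ^ card (idx n) * (\<Sum>k\<in>idx n. coord X k * f (bas n k))"
    unfolding sum_distrib_left by (intro sum.cong refl) (simp del: card_cartesian_product)
  finally show ?thesis unfolding linear_functional_expand[OF f X] .
qed

text \<open>Test \<open>f\<close> against the matrix whose coordinates are the coefficients of \<open>f\<close>, and compare its Schatten
  norm with its Hilbert-Schmidt norm.\<close>

lemma functional_coefficients_le:
  assumes lin: "f \<in> Sp_functionals p n"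
    and f: "\<And>X. X \<in> sa n \<Longrightarrow> \<bar>f X\<bar> \<le> schatten_norm p X"
    and p: "1 \<le> p" "p \<le> 2" and n: "0 < n"
  shows "sqrt (\<Sum>k\<in>idx n. (f (bas n k))\<^sup>2) \<le> real n powr (1 / p - 1 / 2)"
proof -
  define a where "a k = f (bas n k)" for k
  define s where "s = sqrt (sumsq (idx n) a)"
  have ss: "s * s = (sumsq (idx n) a)" and s0: "0 \<le> s" by (simp_all add: s_def sum_nonneg)
  have "f (herm n a) = s * s" unfolding linear_functional_herm[OF lin] ss by (simp add: a_def power2_eq_square)
  moreover have "\<bar>f (herm n a)\<bar> \<le> schatten_norm p (herm n a)" by (rule f[OF herm_sa])
  moreover have "schatten_norm p (herm n a) \<le> real n powr (1 / p - 1 / 2) * sqrt (\<Sum>k\<in>idx n. (coord (herm n a) k)\<^sup>2)"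
    by (rule schatten_norm_le_hs[OF herm_sa p n])
  moreover have "(\<Sum>k\<in>idx n. (coord (herm n a) k)\<^sup>2) = (sumsq (idx n) a)"
    by (intro sum.cong refl) (simp add: coord_herm)
  ultimately have "s * s \<le> real n powr (1 / p - 1 / 2) * s" by (simp add: s_def)
  then have "s \<le> real n powr (1 / p - 1 / 2)"
    using s0 by (cases "s = 0") (auto simp: mult_le_cancel_right)
  then show ?thesis by (simp add: s_def a_def)
qed

text \<open>This bounds the variance of the random functional \<open>A g\<close> at \<open>symprod n x y\<close>: the map \<open>Z \<mapsto> A Z (symprod n x y)\<close>
  is a functional of norm at most 1.\<close>

lemma contraction_coefficients_le:
  assumes A: "A \<in> linear_maps (Sp p n) (dual (Sp p n))"
    and A1: "op_norm (Sp p n) (dual (Sp p n)) A \<le> 1"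
    and p: "1 \<le> p" "p \<le> 2" and n: "0 < n"
    and x: "(sumsq (cidx n) x) \<le> 1" and y: "(sumsq (cidx n) y) \<le> 1"
  shows "sqrt (\<Sum>k\<in>idx n. (A (bas n k) (symprod n x y))\<^sup>2) \<le> real n powr (1 / p - 1 / 2)"
proof (rule functional_coefficients_le[OF _ _ p n, where f = "\<lambda>Z. A Z (symprod n x y)"])
  show "(\<lambda>Z. A Z (symprod n x y)) \<in> Sp_functionals p n"
    using A by (simp add: linear_functional_iff) (simp add: linear_maps_def)
  fix Z assume Z: "Z \<in> sa n"
  then have lin: "A Z \<in> Sp_functionals p n" using A by (simp add: linear_maps_def)
  show "\<bar>A Z (symprod n x y)\<bar> \<le> schatten_norm p Z"
  proof (rule functional_polarization[OF lin _ x y schatten_norm_nonneg])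
    fix z
    have "\<bar>A Z (symprod n z z)\<bar> \<le> schatten_norm p Z * schatten_norm p (symprod n z z)"
      by (rule contraction_apply[OF A A1 p(1) n Z symprod_sa])
    also have "\<dots> \<le> schatten_norm p Z * (sumsq (cidx n) z)"
      by (intro mult_left_mono schatten_norm_symprod_le p schatten_norm_nonneg)
    finally show "\<bar>A Z (symprod n z z)\<bar> \<le> schatten_norm p Z * (sumsq (cidx n) z)" .
  qed
qed

text \<open>The representation of \<open>(A \<otimes> id) u\<close> as a mean over signs. The dual norms of \<open>A g\<close> and of \<open>tr (g _)\<close> are
  both controlled by \<open>random_functional_bound\<close>, and the mean of their product by the means of their
  squares.\<close>

lemma projective_norm_upper:
  assumes A: "A \<in> linear_maps (Sp p n) (dual (Sp p n))"
    and A1: "op_norm (Sp p n) (dual (Sp p n)) A \<le> 1"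
    and p: "1 \<le> p" "p \<le> 2" and n: "0 < n"
    and u: "u \<in> tensors (Sp p n) (Sp p n)"
    and u1: "injective_norm (Sp p n) (Sp p n) u \<le> 1"
  shows "projective_norm (dual (Sp p n)) (Sp p n) (tensor_id (dual (Sp p n)) (Sp p n) A u)
    \<le> 16 * random_const * real n powr (5 / 2 - 1 / p)"
proof -
  let ?E = "Sp p n"
  let ?I = "idx n"
  let ?N = "2 ^ card ?I :: real"
  define s where "s = real n powr (1 / p - 1 / 2)"
  define t where "t = real n powr (1 - 1 / p)"
  have s0: "0 < s" and t0: "0 < t" using n by (auto simp: s_def t_def)
  have lin: "A Z \<in> linear_maps ?E real_line" if "Z \<in> sa n" for Z
    using A that by (simp add: linear_maps_def)
  have lin2: "(\<lambda>Z. A Z W) \<in> linear_maps ?E real_line" for W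
    using A by (simp add: linear_functional_iff) (simp add: linear_maps_def)
  have Azero: "A Z W = 0" if "Z \<in> sa n" "W \<notin> sa n" for Z W
    using A that by (simp add: linear_maps_def)
  \<comment> \<open>The variance of \<open>A g\<close> at \<open>symprod n x y\<close> is at most \<open>s\<^sup>2\<close> for unit vectors; dividing by \<open>s\<close> normalises it.\<close>
  obtain M1 where M1: "\<And>e. 1 \<le> M1 e"
    "\<And>e X. X \<in> sa n \<Longrightarrow> \<bar>\<Sum>k\<in>?I. e k * (A (bas n k) X / s)\<bar> \<le> 4 * M1 e * real n powr (1 - 1 / p) * schatten_norm p X"
    "(\<Sum>e\<in>signs ?I. (M1 e)\<^sup>2) \<le> random_const * n * ?N"
  proof (rule random_functional_bound[where F = "\<lambda>k X. A (bas n k) X / s" and p = p and n = n])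
    show "(\<lambda>X. A (bas n k) X / s) \<in> linear_maps ?E real_line" for k
      using lin[OF bas_sa] by (simp add: linear_functional_iff add_divide_distrib)
    fix x y :: "nat \<times> bool \<Rightarrow> real"
    assume "(sumsq (cidx n) x) \<le> 1" "(sumsq (cidx n) y) \<le> 1"
    from contraction_coefficients_le[OF A A1 p n this]
    have "(\<Sum>k\<in>?I. (A (bas n k) (symprod n x y))\<^sup>2) \<le> s\<^sup>2"
      by (simp add: s_def real_sqrt_le_iff real_le_lsqrt sqrt_le_D)
    then show "(\<Sum>k\<in>?I. (A (bas n k) (symprod n x y) / s)\<^sup>2) \<le> 1"
      using s0 by (simp add: power_divide divide_le_eq flip: sum_divide_distrib)
  qed (use p n in auto)
  define cf where "cf k = coord_functional n (\<lambda>l. if l = k then 1 else 0)" for k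
  have cf: "cf k X = coord X k" if "k \<in> ?I" "X \<in> sa n" for k X
    using that by (simp add: cf_def coord_functional_def if_distrib cong: if_cong)
  obtain M2 where M2: "\<And>e. 1 \<le> M2 e"
    "\<And>e X. X \<in> sa n \<Longrightarrow> \<bar>\<Sum>k\<in>?I. e k * cf k X\<bar> \<le> 4 * M2 e * real n powr (1 - 1 / p) * schatten_norm p X"
    "(\<Sum>e\<in>signs ?I. (M2 e)\<^sup>2) \<le> random_const * n * ?N"
  proof (rule random_functional_bound[where F = cf and p = p and n = n])
    show "cf k \<in> linear_maps ?E real_line" for k unfolding cf_def by (rule coord_functional_linear)
    fix x y :: "nat \<times> bool \<Rightarrow> real"
    assume xy: "(sumsq (cidx n) x) \<le> 1" "(sumsq (cidx n) y) \<le> 1"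
    have "(\<Sum>k\<in>?I. (cf k (symprod n x y))\<^sup>2) = (\<Sum>k\<in>?I. (coord (symprod n x y) k)\<^sup>2)"
      by (intro sum.cong refl) (simp add: cf symprod_sa)
    also have "\<dots> \<le> (sumsq (cidx n) x) * (sumsq (cidx n) y)" by (rule sum_coord_symprod_le)
    also have "\<dots> \<le> 1" using xy by (intro mult_le_one) (auto simp: sum_nonneg)
    finally show "(\<Sum>k\<in>?I. (cf k (symprod n x y))\<^sup>2) \<le> 1" .
  qed (use p n in auto)
  define ph where "ph e X = (\<Sum>k\<in>?I. e k * coord X k)" for e X
  have ph_le: "\<bar>ph e X\<bar> \<le> 4 * M2 e * t * schatten_norm p X" if "X \<in> sa n" for e X
    using M2(2)[OF that, of e] that by (simp add: ph_def cf t_def cong: sum.cong)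
  have A_le: "\<bar>A (herm n e) X\<bar> \<le> 4 * M1 e * s * t * schatten_norm p X" if "X \<in> sa n" for e X
  proof -
    have "A (herm n e) X = s * (\<Sum>k\<in>?I. e k * (A (bas n k) X / s))"
      unfolding linear_functional_herm[OF lin2] using s0 by (simp add: sum_distrib_left)
    then have "\<bar>A (herm n e) X\<bar> = s * \<bar>\<Sum>k\<in>?I. e k * (A (bas n k) X / s)\<bar>" using s0 by (simp add: abs_mult)
    also have "\<dots> \<le> s * (4 * M1 e * t * schatten_norm p X)"
      using M1(2)[OF that, of e] s0 unfolding t_def by (intro mult_left_mono) auto
    finally show ?thesis by (simp add: mult_ac)
  qed
  obtain xs where xs: "u = tensor_of ?E ?E xs" "set xs \<subseteq> sa n \<times> sa n" using u by (auto simp: tensors_def)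
  \<comment> \<open>The value of \<open>tr (g _) \<otimes> id\<close> on \<open>u\<close> for the sign matrix \<open>g\<close> with coordinates \<open>e\<close>.\<close>
  define yy where "yy e = herm n (\<lambda>k. \<Sum>(x, y)\<leftarrow>xs. ph e x * coord y k)" for e
  have fun_yy: "f (yy e) = (\<Sum>(x, y)\<leftarrow>xs. ph e x * f y)" if f: "f \<in> linear_maps ?E real_line" for f e
  proof -
    have "f (yy e) = (\<Sum>k\<in>?I. \<Sum>z\<leftarrow>xs. (ph e (fst z) * coord (snd z) k) * f (bas n k))"
      unfolding yy_def linear_functional_herm[OF f] case_prod_unfold
      by (simp add: mult.commute[of "sum_list _"] mult_sum_list mult_ac)
    also have "\<dots> = (\<Sum>z\<leftarrow>xs. ph e (fst z) * (\<Sum>k\<in>?I. coord (snd z) k * f (bas n k)))"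
      unfolding sum_sum_list by (simp add: sum_distrib_left mult.assoc)
    also have "\<dots> = (\<Sum>z\<leftarrow>xs. ph e (fst z) * f (snd z))"
      using xs(2) by (intro arg_cong[of _ _ sum_list] map_cong refl) (auto simp: linear_functional_expand[OF f])
    finally show ?thesis by (simp add: case_prod_unfold)
  qed
  \<comment> \<open>A norming functional of \<open>yy e\<close> turns its norm into a value of \<open>u\<close> on an elementary functional.\<close>
  have yy_le: "schatten_norm p (yy e) \<le> 4 * M2 e * t" for e
  proof -
    define K where "K = 4 * M2 e * t"
    have K0: "0 < K" using M2(1)[of e] t0 by (simp add: K_def)
    obtain B where B: "B \<in> sa n" "(\<Sum>m\<in>?I. coord (yy e) m * coord B m) = schatten_norm p (yy e)"
      "\<And>X. X \<in> sa n \<Longrightarrow> \<bar>\<Sum>m\<in>?I. coord X m * coord B m\<bar> \<le> schatten_norm p X"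
      using schatten_norming[OF herm_sa p(1)] unfolding yy_def by blast
    have 1: "coord_functional n (coord B) \<in> dual_ball ?E"
      unfolding dual_ball_def using coord_functional_dual B(3) by (auto simp: coord_functional_def)
    have c2: "coord_functional n (\<lambda>k. e k / K) X = ph e X / K" if "X \<in> sa n" for X
      using that by (simp add: coord_functional_def ph_def sum_divide_distrib mult.commute)
    have 2: "coord_functional n (\<lambda>k. e k / K) \<in> dual_ball ?E"
    proof -
      have "\<bar>coord_functional n (\<lambda>k. e k / K) X\<bar> \<le> schatten_norm p X" if X: "X \<in> sa n" for X
        unfolding c2[OF X] using ph_le[OF X, of e] K0 unfolding K_def[symmetric]
        by (simp add: divide_le_eq mult.commute)
      then show ?thesis unfolding dual_ball_def using coord_functional_dual by auto
    qed
    have bil: "(\<lambda>x y. coord_functional n (\<lambda>k. e k / K) x * coord_functional n (coord B) y) \<in> bilinear_forms ?E ?E"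
      using coord_functional_linear[of n "\<lambda>k. e k / K" p] coord_functional_linear[of n "coord B" p]
      by (simp add: bilinear_forms_def linear_functional_iff algebra_simps)
    have "u (\<lambda>x y. coord_functional n (\<lambda>k. e k / K) x * coord_functional n (coord B) y) = (\<Sum>(x, y)\<leftarrow>xs. (ph e x / K) * coord_functional n (coord B) y)"
      unfolding xs(1) tensor_of_def using bil xs(2)
      by (auto simp: c2 intro!: arg_cong[of _ _ sum_list] map_cong)
    also have "\<dots> = (1 / K) * (\<Sum>(x, y)\<leftarrow>xs. ph e x * coord_functional n (coord B) y)"
      unfolding mult_sum_list by (simp add: case_prod_unfold)
    also have "\<dots> = (1 / K) * coord_functional n (coord B) (yy e)" unfolding fun_yy[OF coord_functional_linear] ..
    also have "coord_functional n (coord B) (yy e) = schatten_norm p (yy e)"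
      using B(2) by (simp add: coord_functional_def) (simp add: yy_def herm_sa)
    finally have eq: "u (\<lambda>x y. coord_functional n (\<lambda>k. e k / K) x * coord_functional n (coord B) y) = 1 / K * schatten_norm p (yy e)" .
    have "1 / K * schatten_norm p (yy e) \<le> 1"
      using order.trans[OF abs_ge_self order.trans[OF le_injective_norm[OF p(1) n u 2 1] u1]]
      unfolding eq .
    then show ?thesis using K0 by (simp add: K_def divide_le_eq)
  qed
  have finS: "finite (signs ?I)" by (rule finite_signs) simp
  obtain es where es: "set es = signs ?I" "distinct es" using finite_distinct_list[OF finS] by blast
  have sum_es: "(\<Sum>e\<leftarrow>es. g e) = (\<Sum>e\<in>signs ?I. g e)" for g :: "_ \<Rightarrow> real"
    using es by (simp add: sum_list_distinct_conv_sum_set)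
  \<comment> \<open>The list of all \<open>A g \<otimes> yy e\<close>, each with weight one over the number of sign matrices.\<close>
  define zs where "zs = map (\<lambda>e. ((\<lambda>Y. (1 / ?N) * A (herm n e) Y), yy e)) es"
  have N0: "0 < ?N" by simp
  have zs1: "set zs \<subseteq> points (dual ?E) \<times> sa n"
  proof -
    have "(\<lambda>Y. (1 / ?N) * A (herm n e) Y) \<in> points (dual ?E)" for e
      using lin[OF herm_sa] Azero[OF herm_sa] by (simp add: linear_functional_iff add_divide_distrib)
    then show ?thesis by (auto simp: zs_def yy_def herm_sa simp del: dual_simps)
  qed
  have zs2: "tensor_id (dual ?E) ?E A u = tensor_of (dual ?E) ?E zs"
  proof
    fix b
    show "tensor_id (dual ?E) ?E A u b = tensor_of (dual ?E) ?E zs b"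
    proof (cases "b \<in> bilinear_forms (dual ?E) ?E")
      case True
      have b1: "b f \<in> linear_maps ?E real_line" if "f \<in> points (dual ?E)" for f
        using True that by (simp add: bilinear_forms_def)
      have b2: "(\<lambda>f. b f y) \<in> linear_maps (dual ?E) real_line" if "y \<in> sa n" for y
        using True that by (simp add: bilinear_forms_def)
      have sc: "b (\<lambda>Y. c * f Y) y = c * b f y" if "f \<in> points (dual ?E)" "y \<in> sa n" for c f y
        using b2[OF that(2)] that(1) by (simp add: linear_maps_def)
      have Ap: "A Z \<in> points (dual ?E)" if "Z \<in> sa n" for Z
        using A that by (simp add: linear_maps_def)
      have bA: "(\<lambda>X. b (A X) y) \<in> linear_maps ?E real_line" if "y \<in> sa n" for y
        using b2[OF that] A unfolding linear_maps_def by auto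
      have "tensor_of (dual ?E) ?E zs b = (\<Sum>e\<in>signs ?I. b (\<lambda>Y. (1 / ?N) * A (herm n e) Y) (yy e))"
        using True by (simp add: tensor_of_def zs_def comp_def sum_es)
      also have "\<dots> = (\<Sum>e\<in>signs ?I. (1 / ?N) * (\<Sum>(x, y)\<leftarrow>xs. ph e x * b (A (herm n e)) y))"
      proof (intro sum.cong refl)
        fix e
        have "b (\<lambda>Y. (1 / ?N) * A (herm n e) Y) (yy e) = (1 / ?N) * b (A (herm n e)) (yy e)"
          by (rule sc[OF Ap[OF herm_sa]]) (simp add: yy_def herm_sa)
        then show "b (\<lambda>Y. (1 / ?N) * A (herm n e) Y) (yy e) = (1 / ?N) * (\<Sum>(x, y)\<leftarrow>xs. ph e x * b (A (herm n e)) y)"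
          unfolding fun_yy[OF b1[OF Ap[OF herm_sa]]] .
      qed
      also have "\<dots> = (1 / ?N) * (\<Sum>z\<leftarrow>xs. \<Sum>e\<in>signs ?I. ph e (fst z) * b (A (herm n e)) (snd z))"
        unfolding sum_distrib_left[symmetric] case_prod_unfold sum_sum_list ..
      also have "(\<Sum>z\<leftarrow>xs. \<Sum>e\<in>signs ?I. ph e (fst z) * b (A (herm n e)) (snd z)) = (\<Sum>z\<leftarrow>xs. ?N * b (A (fst z)) (snd z))"
      proof (intro arg_cong[of _ _ sum_list] map_cong refl)
        fix z assume "z \<in> set xs"
        then have z: "fst z \<in> sa n" "snd z \<in> sa n" using xs(2) by auto
        show "(\<Sum>e\<in>signs ?I. ph e (fst z) * b (A (herm n e)) (snd z)) = ?N * b (A (fst z)) (snd z)"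
          using random_expansion[OF bA[OF z(2)] z(1)] by (simp only: ph_def)
      qed
      also have "(1 / ?N) * \<dots> = (\<Sum>z\<leftarrow>xs. b (A (fst z)) (snd z))"
        unfolding mult_sum_list[symmetric] by simp
      also have "\<dots> = tensor_id (dual ?E) ?E A u b"
        unfolding xs(1) using tensor_id_tensor_of[of A ?E "dual ?E" xs ?E] A xs(2) True
        by (simp add: tensor_of_def comp_def case_prod_unfold)
      finally show ?thesis by simp
    next
      case False
      then show ?thesis by (simp add: tensor_id_def tensor_of_def)
    qed
  qed
  have "projective_norm (dual ?E) ?E (tensor_id (dual ?E) ?E A u)
      \<le> (\<Sum>(f, y)\<leftarrow>zs. vnorm (dual ?E) f * schatten_norm p y)"
    by (rule projective_norm_le[OF p(1) n zs1 zs2])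
  also have "\<dots> = (\<Sum>e\<in>signs ?I. vnorm (dual ?E) (\<lambda>Y. (1 / ?N) * A (herm n e) Y) * schatten_norm p (yy e))"
    by (simp add: zs_def comp_def sum_es)
  also have "\<dots> \<le> (\<Sum>e\<in>signs ?I. 16 * s * t * t / ?N * (((M1 e)\<^sup>2 + (M2 e)\<^sup>2) / 2))"
  proof (rule sum_mono)
    fix e
    have "vnorm (dual ?E) (\<lambda>Y. (1 / ?N) * A (herm n e) Y) \<le> 4 * M1 e * s * t / ?N"
      unfolding dual_simps
    proof (rule dual_norm_le)
      fix X assume X: "X \<in> sa n"
      show "\<bar>(1 / ?N) * A (herm n e) X\<bar> \<le> 4 * M1 e * s * t / ?N * schatten_norm p X"
        using divide_right_mono[OF A_le[OF X, of e], of ?N] by (simp add: abs_mult)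
    qed (use p M1(1)[of e] s0 t0 in auto)
    then have "vnorm (dual ?E) (\<lambda>Y. (1 / ?N) * A (herm n e) Y) * schatten_norm p (yy e)
        \<le> (4 * M1 e * s * t / ?N) * (4 * M2 e * t)"
      using M1(1)[of e] s0 t0 yy_le schatten_norm_nonneg by (intro mult_mono) auto
    also have "\<dots> = 16 * s * t * t / ?N * (M1 e * M2 e)" by simp
    also have "\<dots> \<le> 16 * s * t * t / ?N * (((M1 e)\<^sup>2 + (M2 e)\<^sup>2) / 2)"
      using s0 t0 by (intro mult_left_mono mult_le_mean_squares) auto
    finally show "vnorm (dual ?E) (\<lambda>Y. (1 / ?N) * A (herm n e) Y) * schatten_norm p (yy e)
        \<le> 16 * s * t * t / ?N * (((M1 e)\<^sup>2 + (M2 e)\<^sup>2) / 2)" .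
  qed
  also have "\<dots> = 16 * s * t * t / ?N * (((\<Sum>e\<in>signs ?I. (M1 e)\<^sup>2) + (\<Sum>e\<in>signs ?I. (M2 e)\<^sup>2)) / 2)"
    by (simp only: sum_distrib_left[symmetric] sum_divide_distrib[symmetric] sum.distrib)
  also have "\<dots> \<le> 16 * s * t * t / ?N * ((random_const * n * ?N + random_const * n * ?N) / 2)"
    using s0 t0 M1(3) M2(3) by (intro mult_left_mono divide_right_mono add_mono) auto
  also have "\<dots> = 16 * random_const * (s * t * t * real n)" by simp
  also have "s * t * t * real n = real n powr (5 / 2 - 1 / p)"
  proof -
    have "s * t * t * real n = s * t * t * real n powr 1" using n by simp
    also have "\<dots> = real n powr (1 / p - 1 / 2 + (1 - 1 / p) + (1 - 1 / p) + 1)"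
      by (simp only: s_def t_def powr_add)
    also have "1 / p - 1 / 2 + (1 - 1 / p) + (1 - 1 / p) + 1 = 5 / 2 - 1 / p" by simp
    finally show ?thesis .
  qed
  finally show ?thesis .
qed

section \<open>The lower bound\<close>

lemma sum_idx_square_product:
  "(\<Sum>q\<in>A \<times> B. (u (fst q) * v (snd q))\<^sup>2) = (\<Sum>k\<in>A. (u k)\<^sup>2) * (\<Sum>l\<in>B. (v l :: real)\<^sup>2)"
  by (simp add: sum_product power_mult_distrib sum.cartesian_product case_prod_unfold)

definition matrix_form :: "nat \<Rightarrow> ((nat \<times> nat) \<times> (nat \<times> nat) \<Rightarrow> real) \<Rightarrow> (nat \<times> nat \<Rightarrow> real) \<Rightarrow> (nat \<times> nat \<Rightarrow> real) \<Rightarrow> real" where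
  "matrix_form n g a b = (\<Sum>q\<in>idx n \<times> idx n. g q * (a (fst q) * b (snd q)))"

text \<open>The sum of the two functions, each divided by the bound of its mean, is at most 2 somewhere.\<close>

lemma exists_le_twice_mean:
  fixes F G :: "'a \<Rightarrow> real" and c d :: real
  assumes S: "finite S" "S \<noteq> {}" and c: "0 < c" "0 < d"
    and F: "\<And>e. 0 \<le> F e" "(\<Sum>e\<in>S. F e) \<le> c * card S" and G: "\<And>e. 0 \<le> G e" "(\<Sum>e\<in>S. G e) \<le> d * card S"
  shows "\<exists>e\<in>S. F e \<le> 2 * c \<and> G e \<le> 2 * d"
proof -
  have "\<exists>e\<in>S. F e / c + G e / d \<le> 2"
  proof (rule ccontr)
    assume "\<not> ?thesis"
    then have "(\<Sum>e\<in>S. 2) < (\<Sum>e\<in>S. F e / c + G e / d)" using S by (intro sum_strict_mono) auto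
    also have "\<dots> = (\<Sum>e\<in>S. F e) / c + (\<Sum>e\<in>S. G e) / d" by (simp add: sum.distrib sum_divide_distrib)
    also have "\<dots> \<le> real (card S) + real (card S)"
      using F(2) G(2) c by (intro add_mono) (auto simp: divide_le_eq mult.commute)
    finally show False by simp
  qed
  then obtain e where e: "e \<in> S" "F e / c + G e / d \<le> 2" by blast
  moreover have "0 \<le> F e / c" "0 \<le> G e / d" using F G c by auto
  ultimately have "F e / c \<le> 2" "G e / d \<le> 2" by linarith+
  then show ?thesis using e(1) c by (intro bexI[of _ e]) (simp_all add: pos_divide_le_eq)
qed

text \<open>Both estimates hold in mean square for a random sign matrix, so some sign matrix satisfies both.
  The first is a 4-linear form in vectors of real dimension \<open>2n\<close>, at the cost of a factor
  \<open>2 ^ 4\<close>; the second is a bilinear form in vectors of dimension \<open>n\<^sup>2\<close>, at the cost of \<open>2 ^ 2\<close>.\<close>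

lemma random_matrix_form:
  assumes n: "0 < n"
  shows "\<exists>g\<in>signs (idx n \<times> idx n).
    (\<forall>x y. \<bar>matrix_form n g (coord (symprod n x x)) (coord (symprod n y y))\<bar>
      \<le> 1872 * sqrt n * (sumsq (cidx n) x) * (sumsq (cidx n) y)) \<and>
    (\<forall>a b. \<bar>matrix_form n g a b\<bar> \<le> 132 * real n * sqrt (sumsq (idx n) a) * sqrt (sumsq (idx n) b))"
proof -
  let ?I = "idx n \<times> idx n"
  let ?B = "ball_net (cidx n)"
  let ?D = "ball_net (idx n)"
  have finc: "finite (cidx n)" and fini: "finite (idx n)" and finI: "finite ?I" by auto
  define J1 where "J1 = (?B \<times> ?B) \<times> (?B \<times> ?B)"
  define a1 where "a1 j q = coord (symprod n (fst (fst j)) (snd (fst j))) (fst q)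
      * coord (symprod n (fst (snd j)) (snd (snd j))) (snd q)" for j q
  define J2 where "J2 = ?D \<times> ?D"
  define a2 where "a2 j q = fst j (fst q) * snd j (snd q)" for j :: "(nat \<times> nat \<Rightarrow> real) \<times> (nat \<times> nat \<Rightarrow> real)" and q
  have cB: "real (card ?B) \<le> 48 ^ (2 * n)" using card_ball_net_le[OF finc] unfolding card_cidx .
  have cD: "real (card ?D) \<le> 48 ^ (n * n)" using card_ball_net_le[OF fini] by simp
  have "real (card J1) \<le> (48 ^ (2 * n) * 48 ^ (2 * n)) * (48 ^ (2 * n) * 48 ^ (2 * n))"
    unfolding J1_def card_cartesian_product of_nat_mult using cB by (intro mult_mono) auto
  also have "\<dots> = 48 ^ (8 * n)" by (simp flip: power_add)
  finally have cJ1: "real (card J1) + 1 \<le> exp (56 * real n)"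
    using card_plus_1_le_exp[of "card J1" "8 * n"] n by simp
  have "real (card J2) \<le> 48 ^ (n * n) * 48 ^ (n * n)"
    unfolding J2_def card_cartesian_product of_nat_mult using cD by (intro mult_mono) auto
  also have "\<dots> = 48 ^ (2 * (n * n))" by (simp flip: power_add)
  finally have cJ2: "real (card J2) + 1 \<le> exp (14 * real (n * n))"
    using card_plus_1_le_exp[of "card J2" "2 * (n * n)"] n by (simp add: mult.assoc)
  have fJ: "finite J1" "finite J2" unfolding J1_def J2_def using finite_ball_net[OF finc] finite_ball_net[OF fini] by auto
  have sB: "(\<Sum>k\<in>idx n. (coord (symprod n z w) k)\<^sup>2) \<le> 1" if "z \<in> ?B" "w \<in> ?B" for z w
    using sum_coord_symprod_le[of n z w] ball_net_le_1[OF finc that(1)] ball_net_le_1[OF finc that(2)]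
    by (meson mult_le_one order.trans sum_nonneg zero_le_power2)
  have s1: "(\<Sum>q\<in>?I. (a1 j q)\<^sup>2) \<le> 1" if "j \<in> J1" for j
    unfolding a1_def sum_idx_square_product using that
    by (intro mult_le_one sB) (auto simp: J1_def sum_nonneg)
  have s2: "(\<Sum>q\<in>?I. (a2 j q)\<^sup>2) \<le> 1" if "j \<in> J2" for j
    unfolding a2_def sum_idx_square_product using that
    by (intro mult_le_one ball_net_le_1[OF fini]) (auto simp: J2_def sum_nonneg)
  have n1: "1 \<le> real n" using n by simp
  have n2: "1 \<le> real (n * n)" using n by (simp add: Suc_leI flip: of_nat_mult)
  obtain M1 where M1: "\<And>e. 1 \<le> M1 e" "\<And>e j. j \<in> J1 \<Longrightarrow> (\<Sum>q\<in>?I. a1 j q * e q) \<le> M1 e"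
    "(\<Sum>e\<in>signs ?I. (M1 e)\<^sup>2) \<le> (2 * (56 + 2)\<^sup>2 + 4) * real n * 2 ^ card ?I"
    by (rule expected_square_of_max[where a = a1, OF finI fJ(1) cJ1 n1 _ s1]) auto
  obtain M2 where M2: "\<And>e. 1 \<le> M2 e" "\<And>e j. j \<in> J2 \<Longrightarrow> (\<Sum>q\<in>?I. a2 j q * e q) \<le> M2 e"
    "(\<Sum>e\<in>signs ?I. (M2 e)\<^sup>2) \<le> (2 * (14 + 2)\<^sup>2 + 4) * real (n * n) * 2 ^ card ?I"
    by (rule expected_square_of_max[where a = a2, OF finI fJ(2) cJ2 n2 _ s2]) auto
  have fS: "finite (signs ?I)" by (rule finite_signs[OF finI])
  have cS: "real (card (signs ?I)) = 2 ^ card ?I" unfolding card_signs[OF finI] by simp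
  have "signs ?I \<noteq> {}"
  proof
    assume "signs ?I = {}"
    then have "real (card (signs ?I)) = 0" by simp
    then show False unfolding cS by simp
  qed
  then have "\<exists>e\<in>signs ?I. (M1 e)\<^sup>2 \<le> 2 * (6732 * real n) \<and> (M2 e)\<^sup>2 \<le> 2 * (516 * real (n * n))"
    using M1(3) M2(3) n fS by (intro exists_le_twice_mean) (simp_all add: cS del: card_cartesian_product)
  then obtain g where g: "g \<in> signs ?I" "(M1 g)\<^sup>2 \<le> 2 * (6732 * real n)" "(M2 g)\<^sup>2 \<le> 2 * (516 * real (n * n))" by blast
  \<comment> \<open>The numbers 117 and 33 are the square roots, rounded up, of \<open>2 * 6732\<close> and \<open>2 * 516\<close>.\<close>
  have "M1 g \<le> 117 * sqrt n"
  proof (rule power2_le_imp_le)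
    show "(M1 g)\<^sup>2 \<le> (117 * sqrt n)\<^sup>2" using g(2) by (simp add: power_mult_distrib)
  qed simp
  then have m1: "16 * M1 g \<le> 1872 * sqrt n" by simp
  have "M2 g \<le> 33 * real n"
  proof (rule power2_le_imp_le)
    have "0 \<le> real n * real n" by simp
    then have "(M2 g)\<^sup>2 \<le> 1089 * (real n * real n)" using g(3) unfolding of_nat_mult by linarith
    then show "(M2 g)\<^sup>2 \<le> (33 * real n)\<^sup>2" by (simp add: power_mult_distrib power2_eq_square[of "real n"])
  qed simp
  then have m2: "4 * M2 g \<le> 132 * real n" by simp
  define f where "f x1 x2 x3 x4 = matrix_form n g (coord (symprod n x1 x2)) (coord (symprod n x3 x4))" for x1 x2 x3 x4
  define nm where "nm x = sqrt (sumsq (cidx n) x)" for x :: "nat \<times> bool \<Rightarrow> real"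
  have l1: "linear_form (cidx n) (\<lambda>x. f x x2 x3 x4)" for x2 x3 x4
  proof -
    have "f x x2 x3 x4 = (\<Sum>q\<in>?I. coord (symprod n x x2) (fst q) * (g q * coord (symprod n x3 x4) (snd q)))" for x
      unfolding f_def matrix_form_def by (intro sum.cong refl) simp
    then show ?thesis by (simp only:) (intro linear_form_sum linear_form_coord_symprod, auto)
  qed
  have l3: "linear_form (cidx n) (\<lambda>x. f x1 x2 x x4)" for x1 x2 x4
  proof -
    have "f x1 x2 x x4 = (\<Sum>q\<in>?I. coord (symprod n x x4) (snd q) * (g q * coord (symprod n x1 x2) (fst q)))" for x
      unfolding f_def matrix_form_def by (intro sum.cong refl) simp
    then show ?thesis by (simp only:) (intro linear_form_sum linear_form_coord_symprod, auto)
  qed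
  have c12: "f x1 x2 x3 x4 = f x2 x1 x3 x4" and c34: "f x1 x2 x3 x4 = f x1 x2 x4 x3" for x1 x2 x3 x4
    unfolding f_def by (simp_all only: symprod_commute[of n x1 x2] symprod_commute[of n x3 x4])
  have f0: "f z1 z2 z3 z4 \<le> M1 g" if "z1 \<in> ?B" "z2 \<in> ?B" "z3 \<in> ?B" "z4 \<in> ?B" for z1 z2 z3 z4
    using M1(2)[of "((z1, z2), (z3, z4))" g] that
    by (simp add: J1_def a1_def f_def matrix_form_def mult.commute)
  have f1: "\<bar>f x1 z2 z3 z4\<bar> \<le> 2 * M1 g * nm x1" if "z2 \<in> ?B" "z3 \<in> ?B" "z4 \<in> ?B" for x1 z2 z3 z4
    unfolding nm_def using that f0 by (intro linear_form_le_of_ball_net[OF finc l1]) auto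
  have f2: "\<bar>f x1 x2 z3 z4\<bar> \<le> 2 * (2 * M1 g * nm x1) * nm x2" if "z3 \<in> ?B" "z4 \<in> ?B" for x1 x2 z3 z4
    unfolding c12[of x1 x2] nm_def[of x2]
    using that f1 by (intro linear_form_le_of_ball_net[OF finc l1]) (metis abs_le_D1 c12)
  have f3: "\<bar>f x1 x2 x3 z4\<bar> \<le> 2 * (2 * (2 * M1 g * nm x1) * nm x2) * nm x3" if "z4 \<in> ?B" for x1 x2 x3 z4
    unfolding nm_def[of x3]
    using that f2 by (intro linear_form_le_of_ball_net[OF finc l3]) (metis abs_le_D1)
  have f4: "\<bar>f x1 x2 x3 x4\<bar> \<le> 2 * (2 * (2 * (2 * M1 g * nm x1) * nm x2) * nm x3) * nm x4" for x1 x2 x3 x4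
    unfolding c34[of x1 x2 x3 x4] nm_def[of x4]
    using f3 by (intro linear_form_le_of_ball_net[OF finc l3]) (metis abs_le_D1 c34)
  have p1: "\<bar>matrix_form n g (coord (symprod n x x)) (coord (symprod n y y))\<bar>
      \<le> 1872 * sqrt n * (sumsq (cidx n) x) * (sumsq (cidx n) y)" for x y
  proof -
    have "\<bar>f x x y y\<bar> \<le> 16 * M1 g * ((nm x * nm x) * (nm y * nm y))" using f4[of x x y y] by (simp add: mult_ac)
    also have "\<dots> \<le> 1872 * sqrt n * ((nm x * nm x) * (nm y * nm y))"
      by (intro mult_right_mono m1) simp
    finally show ?thesis by (simp add: f_def nm_def sum_nonneg mult.assoc)
  qed
  have p2: "\<bar>matrix_form n g a b\<bar> \<le> 132 * real n * sqrt (sumsq (idx n) a) * sqrt (sumsq (idx n) b)" for a b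
  proof -
    have la: "linear_form (idx n) (\<lambda>x. matrix_form n g x b)" for b
    proof -
      have "matrix_form n g x b = (\<Sum>q\<in>?I. (x (fst q) * 1) * (g q * b (snd q)))" for x
        unfolding matrix_form_def by (intro sum.cong refl) simp
      then show ?thesis by (simp only:) (intro linear_form_sum linear_form_coord, auto)
    qed
    have lb: "linear_form (idx n) (\<lambda>x. matrix_form n g a x)" for a
    proof -
      have "matrix_form n g a x = (\<Sum>q\<in>?I. (x (snd q) * 1) * (g q * a (fst q)))" for x
        unfolding matrix_form_def by (intro sum.cong refl) simp
      then show ?thesis by (simp only:) (intro linear_form_sum linear_form_coord, auto)
    qed
    have h0: "matrix_form n g z w \<le> M2 g" if "z \<in> ?D" "w \<in> ?D" for z w
      using M2(2)[of "(z, w)" g] that by (simp add: J2_def a2_def matrix_form_def mult.commute)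
    have h1: "\<bar>matrix_form n g a w\<bar> \<le> 2 * M2 g * sqrt (sumsq (idx n) a)" if "w \<in> ?D" for w
      using that h0 by (intro linear_form_le_of_ball_net[OF fini la]) auto
    have "\<bar>matrix_form n g a b\<bar> \<le> 2 * (2 * M2 g * sqrt (sumsq (idx n) a)) * sqrt (sumsq (idx n) b)"
      using h1 by (intro linear_form_le_of_ball_net[OF fini lb]) (metis abs_le_D1)
    also have "\<dots> = 4 * M2 g * (sqrt (sumsq (idx n) a) * sqrt (sumsq (idx n) b))" by simp
    also have "\<dots> \<le> 132 * real n * (sqrt (sumsq (idx n) a) * sqrt (sumsq (idx n) b))"
      by (intro mult_right_mono m2) (simp add: sum_nonneg)
    finally show ?thesis by (simp add: mult.assoc)
  qed
  show ?thesis using g(1) p1 p2 by (intro bexI[of _ g]) blast+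
qed

text \<open>For fixed bases of eigenvectors of \<open>X\<close> and \<open>Y\<close>, the form is a bilinear form in the eigenvalues. Its
  entries are values at pairs of rank-one projections, and it inherits the \<open>l\<^sub>2\<close> bound because
  the eigenvectors are orthonormal.\<close>

lemma matrix_form_schatten_le:
  assumes p: "1 \<le> p" "p < 2" and K: "0 < K1" "0 < K2"
    and g1: "\<And>x y. \<bar>matrix_form n g (coord (symprod n x x)) (coord (symprod n y y))\<bar>
      \<le> K1 * (sumsq (cidx n) x) * (sumsq (cidx n) y)"
    and g2: "\<And>a b. \<bar>matrix_form n g a b\<bar> \<le> K2 * sqrt (sumsq (idx n) a) * sqrt (sumsq (idx n) b)"
    and X: "X \<in> sa n" and Y: "Y \<in> sa n"
  shows "\<bar>matrix_form n g (coord X) (coord Y)\<bar>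
    \<le> interp_const p * K1 powr (2 / p - 1) * K2 powr (2 - 2 / p) * (schatten_norm p X * schatten_norm p Y)"
proof -
  let ?L = "interp_const p * K1 powr (2 / p - 1) * K2 powr (2 - 2 / p)"
  obtain U d where U: "U \<in> unitary_mats n" and Xd: "X = spec U d" using sa_eq_spec[OF X] by blast
  obtain V e where V: "V \<in> unitary_mats n" and Ye: "Y = spec V e" using sa_eq_spec[OF Y] by blast
  note Uc = unitary_mats_carrier[OF U] and Vc = unitary_mats_carrier[OF V]
  define P where "P i = coord (eigproj n U i)" for i
  define Q where "Q j = coord (eigproj n V j)" for j
  define m where "m i j = matrix_form n g (P i) (Q j)" for i j
  have ex: "matrix_form n g (coord (spec U a)) (coord (spec V b)) = (\<Sum>i<n. \<Sum>j<n. m i j * a i * b j)" for a b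
  proof -
    have "matrix_form n g (coord (spec U a)) (coord (spec V b))
        = (\<Sum>q\<in>idx n \<times> idx n. \<Sum>i<n. \<Sum>j<n. g q * (P i (fst q) * Q j (snd q)) * (a i * b j))"
      unfolding matrix_form_def
    proof (intro sum.cong refl)
      fix q assume "q \<in> idx n \<times> idx n"
      then have q: "fst q \<in> idx n" "snd q \<in> idx n" by auto
      show "g q * (coord (spec U a) (fst q) * coord (spec V b) (snd q))
          = (\<Sum>i<n. \<Sum>j<n. g q * (P i (fst q) * Q j (snd q)) * (a i * b j))"
      proof -
        have "coord (spec U a) (fst q) * coord (spec V b) (snd q)
            = (\<Sum>i<n. \<Sum>j<n. (a i * P i (fst q)) * (b j * Q j (snd q)))"
          unfolding coord_spec[OF Uc q(1)] coord_spec[OF Vc q(2)] sum_product P_def Q_def ..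
        then show ?thesis
          by (simp only: sum_distrib_left) (intro sum.cong refl, simp add: mult_ac)
      qed
    qed
    also have "\<dots> = (\<Sum>i<n. \<Sum>j<n. \<Sum>q\<in>idx n \<times> idx n. g q * (P i (fst q) * Q j (snd q)) * (a i * b j))"
      by (rule trans[OF sum.swap], rule sum.cong[OF refl], rule sum.swap)
    also have "\<dots> = (\<Sum>i<n. \<Sum>j<n. m i j * a i * b j)"
      unfolding m_def matrix_form_def by (simp add: sum_distrib_right mult.assoc)
    finally show ?thesis .
  qed
  define N where "N = schatten_norm p X"
  define M where "M = schatten_norm p Y"
  have N: "N = (\<Sum>k<n. \<bar>d k\<bar> powr p) powr (1 / p)" unfolding N_def Xd schatten_norm_spec[OF U] ..
  have M: "M = (\<Sum>k<n. \<bar>e k\<bar> powr p) powr (1 / p)" unfolding M_def Ye schatten_norm_spec[OF V] ..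
  have zero: "h k = 0" if "(\<Sum>k<n. \<bar>h k\<bar> powr p) powr (1 / p) = 0" "k < n" for h :: "nat \<Rightarrow> real" and k
  proof -
    have "(\<Sum>k<n. \<bar>h k\<bar> powr p) = 0" using that(1) by (simp add: sum_nonneg)
    then have "\<bar>h k\<bar> powr p = 0" using that(2) by (subst (asm) sum_nonneg_eq_0_iff) auto
    then show ?thesis by simp
  qed
  have one: "(\<Sum>k<n. \<bar>h k / R\<bar> powr p) \<le> 1" if "R = (\<Sum>k<n. \<bar>h k\<bar> powr p) powr (1 / p)" "R \<noteq> 0" for h :: "nat \<Rightarrow> real" and R
  proof -
    have R0: "0 < R" using that by simp
    have "R powr p = (\<Sum>k<n. \<bar>h k\<bar> powr p)" using that(1) p by (simp add: powr_powr sum_nonneg)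
    moreover have "(\<Sum>k<n. \<bar>h k / R\<bar> powr p) = (\<Sum>k<n. \<bar>h k\<bar> powr p) / R powr p"
      using R0 by (simp add: powr_divide sum_divide_distrib)
    ultimately show ?thesis by simp
  qed
  show ?thesis
  proof (cases "N = 0 \<or> M = 0")
    case True
    then have "(\<Sum>i<n. \<Sum>j<n. m i j * d i * e j) = 0"
    proof
      assume "N = 0"
      then have "d i = 0" if "i < n" for i using zero[of d i] that N by simp
      then show ?thesis by simp
    next
      assume "M = 0"
      then have "e i = 0" if "i < n" for i using zero[of e i] that M by simp
      then show ?thesis by simp
    qed
    then have "matrix_form n g (coord X) (coord Y) = 0" unfolding Xd Ye ex .
    moreover have "schatten_norm p X * schatten_norm p Y = 0" using True unfolding N_def M_def by simp
    ultimately show ?thesis by (simp only: abs_zero mult_zero_right order_refl)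
  next
    case False
    then have NM: "0 < N" "0 < M" using schatten_norm_nonneg[of p X] schatten_norm_nonneg[of p Y] by (auto simp: N_def M_def)
    have "\<bar>\<Sum>i<n. \<Sum>j<n. m i j * (d i / N) * (e j / M)\<bar> \<le> ?L"
    proof (rule matrix_interpolation[OF p K])
      fix i j assume ij: "i < n" "j < n"
      show "\<bar>m i j\<bar> \<le> K1"
        using g1[of "rvec U i" "rvec V j"] unfolding m_def P_def Q_def
        by (simp add: sum_rvec_square[OF U ij(1)] sum_rvec_square[OF V ij(2)])
    next
      fix a b :: "nat \<Rightarrow> real"
      show "\<bar>\<Sum>i<n. \<Sum>j<n. m i j * a i * b j\<bar> \<le> K2 * sqrt (\<Sum>i<n. (a i)\<^sup>2) * sqrt (\<Sum>j<n. (b j)\<^sup>2)"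
        using g2[of "coord (spec U a)" "coord (spec V b)"] sum_coord_spec_same[OF U, of a a] sum_coord_spec_same[OF V, of b b]
        unfolding ex by (simp add: power2_eq_square)
    qed (use one[OF N] one[OF M] False in auto)
    moreover have "(\<Sum>i<n. \<Sum>j<n. m i j * d i * e j) = N * M * (\<Sum>i<n. \<Sum>j<n. m i j * (d i / N) * (e j / M))"
      unfolding sum_distrib_left using NM by (intro sum.cong refl) simp
    ultimately have "\<bar>\<Sum>i<n. \<Sum>j<n. m i j * d i * e j\<bar> \<le> N * M * ?L"
      using NM by (simp only: abs_mult) (auto intro!: mult_left_mono)
    then show ?thesis unfolding N_def M_def by (simp add: Xd Ye ex mult_ac)
  qed
qed

lemma contraction_norm_le:
  assumes p: "0 < p" and A: "\<And>X Y. X \<in> sa n \<Longrightarrow> Y \<in> sa n \<Longrightarrow> \<bar>A X Y\<bar> \<le> schatten_norm p X * schatten_norm p Y"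
  shows "op_norm (Sp p n) (dual (Sp p n)) A \<le> 1"
  unfolding op_norm_def[of "Sp p n" "dual (Sp p n)"]
proof (rule cSup_least)
  let ?E = "Sp p n"
  show "{vnorm (dual ?E) (A x) |x. x \<in> points ?E \<and> vnorm ?E x \<le> 1} \<noteq> {}"
    using herm_sa[of n "\<lambda>_. 0"] schatten_norm_zero[OF p, of n] by auto
  fix t assume "t \<in> {vnorm (dual ?E) (A x) |x. x \<in> points ?E \<and> vnorm ?E x \<le> 1}"
  then obtain X where X: "t = op_norm ?E real_line (A X)" "X \<in> sa n" "schatten_norm p X \<le> 1" by auto
  show "t \<le> 1" unfolding X(1)
  proof (rule dual_norm_le[OF p])
    fix Y assume Y: "Y \<in> sa n"
    show "\<bar>A X Y\<bar> \<le> 1 * schatten_norm p Y"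
      using A[OF X(2) Y] mult_right_mono[OF X(3) schatten_norm_nonneg[of p Y]] by simp
  qed simp
qed

lemma dual_ball_nonempty: "coord_functional n (\<lambda>_. 0) \<in> dual_ball (Sp p n)"
  unfolding dual_ball_def using coord_functional_dual[of n "\<lambda>_. 0" p] schatten_norm_nonneg by (simp add: coord_functional_def)

lemma tensor_id_norm_bounds:
  assumes A: "A \<in> linear_maps (Sp p n) (dual (Sp p n))"
    and A1: "op_norm (Sp p n) (dual (Sp p n)) A \<le> 1"
    and p: "1 \<le> p" "p \<le> 2" and n: "0 < n"
  shows "op_norm (injective_tensor (Sp p n) (Sp p n)) (projective_tensor (dual (Sp p n)) (Sp p n))
      (tensor_id (dual (Sp p n)) (Sp p n) A) \<le> 16 * random_const * real n powr (5 / 2 - 1 / p)" (is "_ \<le> ?C")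
    and "u \<in> tensors (Sp p n) (Sp p n) \<Longrightarrow> injective_norm (Sp p n) (Sp p n) u \<le> 1 \<Longrightarrow>
      projective_norm (dual (Sp p n)) (Sp p n) (tensor_id (dual (Sp p n)) (Sp p n) A u)
      \<le> op_norm (injective_tensor (Sp p n) (Sp p n)) (projective_tensor (dual (Sp p n)) (Sp p n))
      (tensor_id (dual (Sp p n)) (Sp p n) A)" (is "_ \<Longrightarrow> _ \<Longrightarrow> _ \<le> ?op")
proof -
  let ?E = "Sp p n"
  define S where "S = {vnorm (projective_tensor (dual ?E) ?E) (tensor_id (dual ?E) ?E A x) |x.
      x \<in> points (injective_tensor ?E ?E) \<and> vnorm (injective_tensor ?E ?E) x \<le> 1}"
  have op: "?op = Sup S" by (simp add: op_norm_def S_def)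
  have S: "S = {projective_norm (dual ?E) ?E (tensor_id (dual ?E) ?E A x) |x. x \<in> tensors ?E ?E \<and> injective_norm ?E ?E x \<le> 1}"
    by (simp add: S_def injective_tensor_def projective_tensor_def)
  have le: "t \<le> ?C" if "t \<in> S" for t
    using that projective_norm_upper[OF A A1 p n] unfolding S by blast
  have z: "tensor_of ?E ?E [] \<in> tensors ?E ?E" unfolding tensors_def by (intro CollectI exI[of _ "[]"]) simp
  have "injective_norm ?E ?E (tensor_of ?E ?E []) \<le> 1"
    unfolding injective_norm_def
    by (rule cSup_least) (use dual_ball_nonempty[of n p] in \<open>auto simp: tensor_of_def\<close>)
  then have "S \<noteq> {}" using z unfolding S by blast
  then show "?op \<le> ?C" unfolding op using le by (intro cSup_least)
  assume u: "u \<in> tensors ?E ?E" "injective_norm ?E ?E u \<le> 1"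
  have "bdd_above S" using le by (intro bdd_aboveI)
  then show "projective_norm (dual ?E) ?E (tensor_id (dual ?E) ?E A u) \<le> ?op"
    unfolding op using u by (intro cSup_upper) (auto simp: S)
qed

lemma K_G_upper:
  assumes p: "1 \<le> p" "p \<le> 2" and n: "0 < n"
  shows "K_G (Sp p n) (Sp p n) \<le> 16 * random_const * real n powr (5 / 2 - 1 / p)"
  unfolding K_G_def
proof (rule cSup_least)
  let ?E = "Sp p n"
  have "(\<lambda>_ _. 0) \<in> linear_maps ?E (dual ?E)" by (simp add: linear_maps_def)
  moreover have "op_norm ?E (dual ?E) (\<lambda>_ _. 0) \<le> 1"
    using p by (intro contraction_norm_le) (auto simp: schatten_norm_nonneg)
  ultimately show "{op_norm (injective_tensor ?E ?E) (projective_tensor (dual ?E) ?E) (tensor_id (dual ?E) ?E A) |A.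
     A \<in> linear_maps ?E (dual ?E) \<and> op_norm ?E (dual ?E) A \<le> 1} \<noteq> {}" by blast
qed (use tensor_id_norm_bounds(1)[OF _ _ p n] in blast)

lemma projective_norm_le_K_G:
  assumes A: "A \<in> linear_maps (Sp p n) (dual (Sp p n))"
    and A1: "op_norm (Sp p n) (dual (Sp p n)) A \<le> 1"
    and p: "1 \<le> p" "p \<le> 2" and n: "0 < n"
    and u: "u \<in> tensors (Sp p n) (Sp p n)" "injective_norm (Sp p n) (Sp p n) u \<le> 1"
  shows "projective_norm (dual (Sp p n)) (Sp p n) (tensor_id (dual (Sp p n)) (Sp p n) A u)
    \<le> K_G (Sp p n) (Sp p n)"
proof -
  let ?E = "Sp p n"
  define S where "S = {op_norm (injective_tensor ?E ?E) (projective_tensor (dual ?E) ?E) (tensor_id (dual ?E) ?E A) |A.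
     A \<in> linear_maps ?E (dual ?E) \<and> op_norm ?E (dual ?E) A \<le> 1}"
  have "bdd_above S"
    using tensor_id_norm_bounds(1)[OF _ _ p n] by (intro bdd_aboveI) (auto simp: S_def)
  then have "op_norm (injective_tensor ?E ?E) (projective_tensor (dual ?E) ?E) (tensor_id (dual ?E) ?E A) \<le> Sup S"
    using A A1 by (intro cSup_upper) (auto simp: S_def)
  then show ?thesis
    using tensor_id_norm_bounds(2)[OF A A1 p n u] unfolding K_G_def S_def by linarith
qed

lemma dual_ball_coefficients_le:
  assumes "1 \<le> p" "p \<le> 2" "0 < n" "f \<in> dual_ball (Sp p n)"
  shows "sqrt (\<Sum>k\<in>idx n. (f (bas n k))\<^sup>2) \<le> real n powr (1 / p - 1 / 2)"
  using assms by (intro functional_coefficients_le) (auto simp: dual_ball_def)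

text \<open>The map \<open>A\<close> and the tensor \<open>u\<close> are normalisations of the same sign matrix, so that evaluating
  \<open>(A \<otimes> id) u\<close> on the form \<open>(f, y) \<mapsto> f y\<close> adds up the squares of all \<open>n ^ 4\<close> entries.\<close>

lemma K_G_lower:
  assumes p: "1 \<le> p" "p < 2" and n: "0 < n"
  shows "1 / (132 * interp_const p * 1872 powr (2 / p - 1) * 132 powr (2 - 2 / p)) * real n powr (5 / 2 - 1 / p)
    \<le> K_G (Sp p n) (Sp p n)"
proof -
  let ?E = "Sp p n"
  let ?I = "idx n \<times> idx n"
  have p2: "p \<le> 2" using p by simp
  have finI: "finite ?I" by simp
  obtain g where g: "g \<in> signs ?I" and g1: "\<And>x y. \<bar>matrix_form n g (coord (symprod n x x)) (coord (symprod n y y))\<bar>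
      \<le> 1872 * sqrt n * (sumsq (cidx n) x) * (sumsq (cidx n) y)"
    and g2: "\<And>a b. \<bar>matrix_form n g a b\<bar> \<le> 132 * real n * sqrt (sumsq (idx n) a) * sqrt (sumsq (idx n) b)"
    using random_matrix_form[OF n] by blast
  have gg: "g q * g q = 1" if "q \<in> ?I" for q
    using g that unfolding signs_def by (fastforce dest: PiE_mem)
  define L where "L = interp_const p * (1872 * sqrt n) powr (2 / p - 1) * (132 * real n) powr (2 - 2 / p)"
  have L0: "0 < L" using interp_const_pos[OF p(2)] n by (simp add: L_def)
  define A where "A X Y = (if X \<in> sa n \<and> Y \<in> sa n then matrix_form n g (coord X) (coord Y) / L else 0)" for X Y
  have A_le: "\<bar>A X Y\<bar> \<le> schatten_norm p X * schatten_norm p Y" if "X \<in> sa n" "Y \<in> sa n" for X Y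
  proof -
    have "\<bar>matrix_form n g (coord X) (coord Y)\<bar> \<le> L * (schatten_norm p X * schatten_norm p Y)"
      unfolding L_def using n by (intro matrix_form_schatten_le[OF p _ _ g1 g2 that]) auto
    then show ?thesis using that L0 by (simp add: A_def divide_le_eq mult.commute)
  qed
  have add1: "matrix_form n g (coord (X + Y)) b = matrix_form n g (coord X) b + matrix_form n g (coord Y) b"
    if "X \<in> sa n" "Y \<in> sa n" for X Y b
    unfolding matrix_form_def sum.distrib[symmetric]
    by (intro sum.cong refl) (auto simp: coord_add[OF that] algebra_simps)
  have add2: "matrix_form n g b (coord (X + Y)) = matrix_form n g b (coord X) + matrix_form n g b (coord Y)"
    if "X \<in> sa n" "Y \<in> sa n" for X Y b
    unfolding matrix_form_def sum.distrib[symmetric]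
    by (intro sum.cong refl) (auto simp: coord_add[OF that] algebra_simps)
  have sm1: "matrix_form n g (coord (complex_of_real c \<cdot>\<^sub>m X)) b = c * matrix_form n g (coord X) b"
    if "X \<in> sa n" for X b c
    unfolding matrix_form_def sum_distrib_left
    by (intro sum.cong refl) (auto simp: coord_smult[OF that] algebra_simps)
  have sm2: "matrix_form n g b (coord (complex_of_real c \<cdot>\<^sub>m X)) = c * matrix_form n g b (coord X)"
    if "X \<in> sa n" for X b c
    unfolding matrix_form_def sum_distrib_left
    by (intro sum.cong refl) (auto simp: coord_smult[OF that] algebra_simps)
  have Alin2: "A X \<in> linear_maps ?E real_line" if "X \<in> sa n" for X
    using that by (simp add: linear_functional_iff A_def sa_add sa_smult add2 sm2 add_divide_distrib)
  have Alin1: "(\<lambda>X. A X Y) \<in> linear_maps ?E real_line" if "Y \<in> sa n" for Y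
    using that by (simp add: linear_functional_iff A_def sa_add sa_smult add1 sm1 add_divide_distrib)
  have Abil: "A \<in> bilinear_forms ?E ?E" using Alin1 Alin2 by (simp add: bilinear_forms_def)
  have A: "A \<in> linear_maps ?E (dual ?E)"
  proof -
    have "A (X + Y) = (\<lambda>W. A X W + A Y W)" if "X \<in> sa n" "Y \<in> sa n" for X Y
      using that by (auto simp: A_def sa_add add1 add_divide_distrib)
    moreover have "A (complex_of_real c \<cdot>\<^sub>m X) = (\<lambda>W. c * A X W)" if "X \<in> sa n" for c X
      using that by (auto simp: A_def sa_smult sm1)
    moreover have "A X W = 0" if "W \<notin> sa n" for X W using that by (simp add: A_def)
    ultimately show ?thesis using Alin2 unfolding linear_maps_def[of ?E "dual ?E"] by simp
  qed
  have A1: "op_norm ?E (dual ?E) A \<le> 1" using p A_le by (intro contraction_norm_le) auto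
  have Abas: "A (bas n k) (bas n l) = g (k, l) / L" if "k \<in> idx n" "l \<in> idx n" for k l
  proof -
    have "matrix_form n g (coord (bas n k)) (coord (bas n l)) = (\<Sum>q\<in>?I. if q = (k, l) then g q else 0)"
      unfolding matrix_form_def by (intro sum.cong refl) (auto simp: coord_bas split: if_splits)
    also have "\<dots> = g (k, l)" using that by simp
    finally show ?thesis by (simp add: A_def bas_sa)
  qed
  define s where "s = real n powr (1 / p - 1 / 2)"
  have s0: "0 < s" using n by (simp add: s_def)
  \<comment> \<open>The injective norm of the sign tensor is at most \<open>132 * n * s\<^sup>2\<close>, by the Hilbert-Schmidt bound of \<open>g\<close>.\<close>
  define r where "r = 1 / (132 * real n * (s * s))"
  have r0: "0 < r" using n s0 by (simp add: r_def)
  obtain qs where qs: "set qs = ?I" "distinct qs" using finite_distinct_list[OF finI] by blast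
  have sum_qs: "(\<Sum>q\<leftarrow>qs. h q) = (\<Sum>q\<in>?I. h q)" for h :: "_ \<Rightarrow> real"
    using qs by (simp add: sum_list_distinct_conv_sum_set)
  define us where "us = map (\<lambda>q. (complex_of_real (r * g q) \<cdot>\<^sub>m bas n (fst q), bas n (snd q))) qs"
  have us: "set us \<subseteq> sa n \<times> sa n" by (auto simp: us_def bas_sa simp del: of_real_mult intro!: sa_smult)
  define u where "u = tensor_of ?E ?E us"
  have u: "u \<in> tensors ?E ?E" unfolding tensors_def u_def using us by auto
  have ub: "u b = r * (\<Sum>q\<in>?I. g q * b (bas n (fst q)) (bas n (snd q)))" if b: "b \<in> bilinear_forms ?E ?E" for b
  proof -
    have "(\<lambda>x. b x y) \<in> linear_maps ?E real_line" if "y \<in> sa n" for y using b that by (simp add: bilinear_forms_def)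
    then have sc: "b (complex_of_real c \<cdot>\<^sub>m x) y = c * b x y" if "x \<in> sa n" "y \<in> sa n" for c x y
      using that unfolding linear_functional_iff by blast
    have "u b = (\<Sum>q\<in>?I. b (complex_of_real (r * g q) \<cdot>\<^sub>m bas n (fst q)) (bas n (snd q)))"
      using b by (simp add: u_def tensor_of_def us_def comp_def sum_qs del: of_real_mult)
    also have "\<dots> = (\<Sum>q\<in>?I. r * (g q * b (bas n (fst q)) (bas n (snd q))))"
      by (intro sum.cong refl) (simp only: sc[OF bas_sa bas_sa] mult.assoc)
    finally show ?thesis by (simp only: sum_distrib_left)
  qed
  let ?S1 = "{\<bar>u (\<lambda>x y. \<phi> x * \<psi> y)\<bar> |\<phi> \<psi>. \<phi> \<in> dual_ball ?E \<and> \<psi> \<in> dual_ball ?E}"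
  let ?S2 = "{\<Sum>(x, y)\<leftarrow>xs. vnorm (dual ?E) x * vnorm ?E y |xs. set xs \<subseteq> points (dual ?E) \<times> points ?E
       \<and> tensor_id (dual ?E) ?E A u = tensor_of (dual ?E) ?E xs}"
  have u1: "injective_norm ?E ?E u \<le> 1"
    unfolding injective_norm_def
  proof (rule cSup_least)
    show "?S1 \<noteq> {}"
      using dual_ball_nonempty by blast
    fix t assume "t \<in> ?S1"
    then obtain \<phi> \<psi> where t: "t = \<bar>u (\<lambda>x y. \<phi> x * \<psi> y)\<bar>" and phi: "\<phi> \<in> dual_ball ?E" and psi: "\<psi> \<in> dual_ball ?E" by blast
    have bil: "(\<lambda>x y. \<phi> x * \<psi> y) \<in> bilinear_forms ?E ?E"
      using phi psi by (auto simp: bilinear_forms_def dual_ball_def linear_maps_def algebra_simps)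
    have "t = r * \<bar>matrix_form n g (\<lambda>k. \<phi> (bas n k)) (\<lambda>k. \<psi> (bas n k))\<bar>"
      unfolding t ub[OF bil] using r0 by (simp add: matrix_form_def abs_mult)
    also have "\<dots> \<le> r * (132 * real n * sqrt (\<Sum>k\<in>idx n. (\<phi> (bas n k))\<^sup>2) * sqrt (\<Sum>k\<in>idx n. (\<psi> (bas n k))\<^sup>2))"
      using r0 by (intro mult_left_mono g2) auto
    also have "\<dots> \<le> r * (132 * real n * s * s)"
      unfolding s_def using r0 dual_ball_coefficients_le[OF p(1) p2 n phi] dual_ball_coefficients_le[OF p(1) p2 n psi]
      by (intro mult_left_mono mult_mono) (auto simp: sum_nonneg)
    also have "\<dots> = 1" using n s0 by (simp add: r_def)
    finally show "t \<le> 1" .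
  qed
  define v where "v = r / L * real n ^ 4"
  have "v \<le> projective_norm (dual ?E) ?E (tensor_id (dual ?E) ?E A u)"
    unfolding projective_norm_def
  proof (rule cInf_greatest)
    have "set (map (\<lambda>(x, y). (A x, y)) us) \<subseteq> points (dual ?E) \<times> points ?E"
      using us A unfolding linear_maps_def by auto
    moreover have "tensor_id (dual ?E) ?E A u = tensor_of (dual ?E) ?E (map (\<lambda>(x, y). (A x, y)) us)"
      unfolding u_def using us by (intro tensor_id_tensor_of[OF A]) simp
    ultimately show "?S2 \<noteq> {}" by blast
  next
    fix t assume "t \<in> ?S2"
    then obtain xs where t: "t = (\<Sum>(x, y)\<leftarrow>xs. vnorm (dual ?E) x * vnorm ?E y)"
      and xs: "set xs \<subseteq> points (dual ?E) \<times> points ?E" "tensor_id (dual ?E) ?E A u = tensor_of (dual ?E) ?E xs" by blast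
    have b0: "(\<lambda>f y. f y) \<in> bilinear_forms (dual ?E) ?E"
      by (simp add: bilinear_forms_def linear_maps_def)
    have "v = r * (\<Sum>q\<in>?I. g q * A (bas n (fst q)) (bas n (snd q)))"
    proof -
      have "(\<Sum>q\<in>?I. g q * A (bas n (fst q)) (bas n (snd q))) = (\<Sum>q\<in>?I. 1 / L)"
      proof (intro sum.cong refl)
        fix q assume q: "q \<in> ?I"
        then have "A (bas n (fst q)) (bas n (snd q)) = g q / L" using Abas[of "fst q" "snd q"] by auto
        then show "g q * A (bas n (fst q)) (bas n (snd q)) = 1 / L" using gg[OF q] by simp
      qed
      then show ?thesis by (simp add: v_def power4_eq_xxxx)
    qed
    also have "\<dots> = tensor_id (dual ?E) ?E A u (\<lambda>f y. f y)"
      using b0 ub[OF Abil] by (simp add: tensor_id_def)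
    also have "\<dots> = (\<Sum>(f, y)\<leftarrow>xs. f y)" unfolding xs(2) tensor_of_def using b0 by simp
    also have "\<dots> \<le> t"
      unfolding t
    proof (intro sum_list_mono)
      fix z assume "z \<in> set xs"
      then obtain f y where z: "z = (f, y)" "f \<in> linear_maps ?E real_line" "y \<in> sa n" using xs(1) by auto
      show "(case z of (f, y) \<Rightarrow> f y) \<le> (case z of (x, y) \<Rightarrow> vnorm (dual ?E) x * vnorm ?E y)"
        using dual_norm_apply[OF z(2) p(1) n z(3)] by (simp add: z(1))
    qed
    finally show "v \<le> t" .
  qed
  also have "\<dots> \<le> K_G ?E ?E" by (rule projective_norm_le_K_G[OF A A1 p(1) p2 n u u1])
  finally have "v \<le> K_G ?E ?E" .
  moreover have "v = 1 / (132 * interp_const p * 1872 powr (2 / p - 1) * 132 powr (2 - 2 / p)) * real n powr (5 / 2 - 1 / p)"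
  proof -
    define N where "N = real n"
    have N0: "0 < N" using n by (simp add: N_def)
    have sq: "sqrt N powr (2 / p - 1) = N powr (1 / p - 1 / 2)"
    proof -
      have "sqrt N powr (2 / p - 1) = (N powr (1 / 2)) powr (2 / p - 1)" using N0 by (simp add: powr_half_sqrt)
      also have "\<dots> = N powr (1 / 2 * (2 / p - 1))" by (rule powr_powr)
      also have "1 / 2 * (2 / p - 1) = 1 / p - 1 / 2" by (simp add: right_diff_distrib)
      finally show ?thesis .
    qed
    have "N * (s * s) * (sqrt N powr (2 / p - 1) * N powr (2 - 2 / p))
        = N powr (1 + ((1 / p - 1 / 2) + (1 / p - 1 / 2)) + ((1 / p - 1 / 2) + (2 - 2 / p)))"
      unfolding sq s_def N_def[symmetric] powr_add using N0 by simp
    also have "\<dots> = N powr (4 - (5 / 2 - 1 / p))"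
      by (intro arg_cong[of _ _ "\<lambda>t. N powr t"]) (simp add: field_simps)
    also have "\<dots> = N powr 4 / N powr (5 / 2 - 1 / p)" by (rule powr_diff)
    also have "N powr 4 = N ^ 4" using N0 by (simp add: powr_numeral)
    finally have eq: "N * (s * s) * (sqrt N powr (2 / p - 1) * N powr (2 - 2 / p)) = N ^ 4 / N powr (5 / 2 - 1 / p)" .
    define a where "a = sqrt N powr (2 / p - 1)"
    define b where "b = N powr (2 - 2 / p)"
    define cc where "cc = N powr (5 / 2 - 1 / p)"
    have pos: "0 < a" "0 < b" "0 < cc" using N0 by (auto simp: a_def b_def cc_def)
    have eq': "N ^ 4 = N * (s * s) * (a * b) * cc"
      using eq pos by (simp add: a_def[symmetric] b_def[symmetric] cc_def[symmetric])
    have Lab: "L = interp_const p * (1872 powr (2 / p - 1) * a) * (132 powr (2 - 2 / p) * b)"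
      using N0 unfolding L_def a_def b_def N_def[symmetric] by (simp add: powr_mult)
    have "v = 1 / (132 * N * (s * s)) / L * N ^ 4" by (simp add: v_def r_def N_def)
    also have "\<dots> = 1 / (132 * interp_const p * 1872 powr (2 / p - 1) * 132 powr (2 - 2 / p)) * cc"
      unfolding eq' Lab using N0 s0 pos interp_const_pos[OF p(2)] by (simp add: field_simps)
    finally show ?thesis by (simp add: cc_def N_def)
  qed
  ultimately show ?thesis by simp
qed

theorem corollary4p15:
  fixes p :: real
  assumes "1 \<le> p" and "p < 2"
  shows "\<exists>c C :: real. 0 < c \<and> 0 < C \<and>
    (\<forall>n::nat. n \<ge> 1 \<longrightarrow>
       c * real n powr (5 / 2 - 1 / p) \<le> K_G (schatten_sa p n) (schatten_sa p n) \<and>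
       K_G (schatten_sa p n) (schatten_sa p n) \<le> C * real n powr (5 / 2 - 1 / p))"
proof -
  let ?c = "1 / (132 * interp_const p * 1872 powr (2 / p - 1) * 132 powr (2 - 2 / p))"
  have "0 < ?c" using interp_const_pos[OF assms(2)] by simp
  moreover have "0 < 16 * random_const" by (simp add: random_const_def)
  moreover have "?c * real n powr (5 / 2 - 1 / p) \<le> K_G (schatten_sa p n) (schatten_sa p n) \<and>
       K_G (schatten_sa p n) (schatten_sa p n) \<le> 16 * random_const * real n powr (5 / 2 - 1 / p)" if "1 \<le> n" for n
    using K_G_lower[OF assms, of n] K_G_upper[of p n] assms that by simp
  ultimately show ?thesis by blast
qed

end
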